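(* Let $\Gamma$ be an $\widetilde A_2$ group with generating set $P$, let $a,b,c\in P$ be distinct mutually commuting generators, and let $\Gamma_0=\langle a,b,c\rangle$ (which is isomorphic to $\mathbb{Z}^2$). Then $W^*(\Gamma_0)$ is a singular masa of $W^*(\Gamma)$.
   Context: $\widetilde A_2$ groups: let $(P,L)$ be a finite projective plane of order $q\ge 2$ with point set $P$ and line set $L$ (so $\#P=\#L=q^2+q+1$, each line contains $q+1$ points and each point lies on $q+1$ lines). Let $\lambda:P\to L$ be a bijection. A triangle presentation compatible with $\lambda$ is a set $\mathcal T$ of triples $(x,y,z)$, $x,y,z\in P$, such that (i) given $x,y\in P$, $(x,y,z)\in\mathcal T$ for some $z\in P$ if and only if $y\in\lambda(x)$ ($y$ is incident with $\lambda(x)$); (ii) $(x,y,z)\in\mathcal T\Rightarrow (y,z,x)\in\mathcal T$; (iii) given $x,y\in P$, $(x,y,z)\in\mathcal T$ for at most one $z\in P$. The associated $\widetilde A_2$ group is $\Gamma=\langle a_x,\ x\in P \mid a_xa_ya_z=e \text{ for } (x,y,z)\in\mathcal T\rangle$. The point $x\in P$ is identified with the generator $a_x\in\Gamma$, so $P\subset\Gamma$. For a discrete group $\Gamma$, $W^*(\Gamma)$ is the group von Neumann algebra, generated by the left regular representation on $\ell^2(\Gamma)$ and identified with the convolution algebra $\{f\in \ell^2(\Gamma): f*\ell^2(\Gamma)\subset \ell^2(\Gamma)\}$. For a subgroup $\Gamma_0$, $W^*(\Gamma_0)$ is identified with the set of elements of $W^*(\Gamma)$ supported in $\Gamma_0$.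 A masa is a maximal abelian von Neumann subalgebra. For an abelian von Neumann subalgebra $A$ of a von Neumann algebra $M$, the normalizer $N(A)$ is the set of unitaries $u\in M$ with $u^*Au=A$; $A$ is singular if $N(A)''=A$. *)

theory Defs
  imports "HOL-Analysis.Infinite_Sum" "HOL-Algebra.Elementary_Groups" "HOL-Algebra.Generated_Groups"
begin

section \<open>Finite projective planes and triangle presentations\<close>

text \<open>\<open>I x l\<close> means that the point \<open>x\<close> is incident with the line \<open>l\<close>.\<close>

definition projective_plane ::
  "'p set \<Rightarrow> 'l set \<Rightarrow> ('p \<Rightarrow> 'l \<Rightarrow> bool) \<Rightarrow> nat \<Rightarrow> bool" where
  "projective_plane P L I q \<longleftrightarrow>
     finite P \<and> finite L \<and> card P = q\<^sup>2 + q + 1 \<and> card L = q\<^sup>2 + q + 1 \<and>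
     (\<forall>x\<in>P. \<forall>y\<in>P. x \<noteq> y \<longrightarrow> (\<exists>!l. l \<in> L \<and> I x l \<and> I y l)) \<and>
     (\<forall>l\<in>L. \<forall>m\<in>L. l \<noteq> m \<longrightarrow> (\<exists>!x. x \<in> P \<and> I x l \<and> I x m)) \<and>
     (\<forall>l\<in>L. card {x\<in>P. I x l} = q + 1) \<and>
     (\<forall>x\<in>P. card {l\<in>L. I x l} = q + 1)"

definition triangle_presentation ::
  "'p set \<Rightarrow> 'l set \<Rightarrow> ('p \<Rightarrow> 'l \<Rightarrow> bool) \<Rightarrow> ('p \<Rightarrow> 'l) \<Rightarrow> ('p \<times> 'p \<times> 'p) set \<Rightarrow> bool" where
  "triangle_presentation P L I lam \<T> \<longleftrightarrow>
     bij_betw lam P L \<and> \<T> \<subseteq> P \<times> P \<times> P \<and>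
     (\<forall>x\<in>P. \<forall>y\<in>P. (\<exists>z\<in>P. (x, y, z) \<in> \<T>) \<longleftrightarrow> I y (lam x)) \<and>
     (\<forall>x y z. (x, y, z) \<in> \<T> \<longrightarrow> (y, z, x) \<in> \<T>) \<and>
     (\<forall>x\<in>P. \<forall>y\<in>P. \<forall>z z'. (x, y, z) \<in> \<T> \<and> (x, y, z') \<in> \<T> \<longrightarrow> z = z')"


section \<open>Groups given by generators and relations\<close>

text \<open>The letter \<open>(x, True)\<close> stands for the generator \<open>x\<close> and \<open>(x, False)\<close> for its formal
  inverse. Two words are equivalent if one arises from the other by inserting and deleting
  subwords that are trivial cancellations or relators; the group consists of the
  equivalence classes.\<close>

type_synonym 'x word = "('x \<times> bool) list"

definition words_over :: "'x set \<Rightarrow> 'x word set" where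
  "words_over X = lists (X \<times> UNIV)"

inductive word_equiv :: "'x set \<Rightarrow> 'x word set \<Rightarrow> 'x word \<Rightarrow> 'x word \<Rightarrow> bool"
  for X :: "'x set" and R :: "'x word set" where
  refl: "w \<in> words_over X \<Longrightarrow> word_equiv X R w w"
| sym: "word_equiv X R v w \<Longrightarrow> word_equiv X R w v"
| trans: "word_equiv X R u v \<Longrightarrow> word_equiv X R v w \<Longrightarrow> word_equiv X R u w"
| cancel: "u \<in> words_over X \<Longrightarrow> v \<in> words_over X \<Longrightarrow> x \<in> X \<Longrightarrow>
    word_equiv X R (u @ [(x, e), (x, \<not> e)] @ v) (u @ v)"
| relator: "u \<in> words_over X \<Longrightarrow> v \<in> words_over X \<Longrightarrow> r \<in> R \<Longrightarrow> r \<in> words_over X \<Longrightarrow>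
    word_equiv X R (u @ r @ v) (u @ v)"

definition word_class :: "'x set \<Rightarrow> 'x word set \<Rightarrow> 'x word \<Rightarrow> 'x word set" where
  "word_class X R w = {v. word_equiv X R w v}"

definition presented_group :: "'x set \<Rightarrow> 'x word set \<Rightarrow> 'x word set monoid" where
  "presented_group X R =
     \<lparr>carrier = word_class X R ` words_over X,
      monoid.mult = (\<lambda>A B. {w. \<exists>u\<in>A. \<exists>v\<in>B. word_equiv X R (u @ v) w}),
      one = word_class X R []\<rparr>"

lemma word_equiv_words:
  assumes "word_equiv X R u v"
  shows "u \<in> words_over X" "v \<in> words_over X"
  using assms by (induction rule: word_equiv.induct) (auto simp: words_over_def)

lemma word_equiv_append_left:
  assumes "word_equiv X R v w" "u \<in> words_over X"
  shows "word_equiv X R (u @ v) (u @ w)"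
  using assms
proof (induction rule: word_equiv.induct)
  case (cancel u' v x e)
  then show ?case
    using word_equiv.cancel[of "u @ u'" X v x R e] by (auto simp: words_over_def)
next
  case (relator u' v r)
  then show ?case
    using word_equiv.relator[of "u @ u'" X v r R] by (auto simp: words_over_def)
qed (auto intro: word_equiv.intros simp: words_over_def)

lemma word_equiv_append_right:
  assumes "word_equiv X R v w" "u \<in> words_over X"
  shows "word_equiv X R (v @ u) (w @ u)"
  using assms
proof (induction rule: word_equiv.induct)
  case (cancel u' v x e)
  then show ?case
    using word_equiv.cancel[of u' X "v @ u" x R e] by (auto simp: words_over_def)
next
  case (relator u' v r)
  then show ?case
    using word_equiv.relator[of u' X "v @ u" r R] by (auto simp: words_over_def)
qed (auto intro: word_equiv.intros simp: words_over_def)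

lemma word_class_eq_iff:
  assumes "u \<in> words_over X"
  shows "word_class X R u = word_class X R v \<longleftrightarrow> word_equiv X R u v"
proof
  assume "word_class X R u = word_class X R v"
  moreover have "u \<in> word_class X R u"
    using assms by (simp add: word_class_def word_equiv.refl)
  ultimately show "word_equiv X R u v"
    by (simp add: word_class_def word_equiv.sym)
next
  assume "word_equiv X R u v"
  then show "word_class X R u = word_class X R v"
    unfolding word_class_def by (blast intro: word_equiv.sym word_equiv.trans)
qed

lemma presented_group_mult:
  assumes "u \<in> words_over X" "v \<in> words_over X"
  shows "word_class X R u \<otimes>\<^bsub>presented_group X R\<^esub> word_class X R v = word_class X R (u @ v)"
proof -
  have "word_equiv X R (u @ v) w"
    if "word_equiv X R u u'" "word_equiv X R v v'" "word_equiv X R (u' @ v') w" for u' v' w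
    using word_equiv_append_right[OF that(1) assms(2)]
      word_equiv_append_left[OF that(2) word_equiv_words(2)[OF that(1)]] that(3)
    by (blast intro: word_equiv.trans)
  moreover have "word_equiv X R u u" "word_equiv X R v v"
    using assms by (auto intro: word_equiv.refl)
  ultimately show ?thesis
    by (auto simp: presented_group_def word_class_def)
qed

lemma word_inverse:
  assumes "w \<in> words_over X"
  shows "word_equiv X R (rev (map (\<lambda>(x, e). (x, \<not> e)) w) @ w) []"
  using assms
proof (induction w)
  case Nil
  then show ?case by (simp add: word_equiv.refl)
next
  case (Cons p w)
  obtain x e where p: "p = (x, e)" by (cases p)
  let ?i = "\<lambda>w :: 'a word. rev (map (\<lambda>(x, e). (x, \<not> e)) w)"
  have w: "w \<in> words_over X" "x \<in> X" using Cons.prems p by (auto simp: words_over_def)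
  then have "?i w \<in> words_over X" by (auto simp: words_over_def)
  then have "word_equiv X R (?i w @ [(x, \<not> e), (x, \<not> \<not> e)] @ w) (?i w @ w)"
    using w by (intro word_equiv.cancel)
  then show ?case using Cons.IH[OF w(1)] p by (auto intro: word_equiv.trans)
qed

lemma group_presented_group: "group (presented_group X R)"
proof (rule groupI)
  fix A B assume "A \<in> carrier (presented_group X R)" "B \<in> carrier (presented_group X R)"
  then obtain u v where
    "A = word_class X R u" "B = word_class X R v" "u \<in> words_over X" "v \<in> words_over X"
    by (auto simp: presented_group_def)
  moreover have "u @ v \<in> words_over X"
    using calculation by (auto simp: words_over_def)
  then have "word_class X R (u @ v) \<in> carrier (presented_group X R)"
    by (auto simp: presented_group_def)
  ultimately show "A \<otimes>\<^bsub>presented_group X R\<^esub> B \<in> carrier (presented_group X R)"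
    by (simp add: presented_group_mult)
next
  show "\<one>\<^bsub>presented_group X R\<^esub> \<in> carrier (presented_group X R)"
    by (auto simp: presented_group_def words_over_def)
next
  fix A B C
  assume "A \<in> carrier (presented_group X R)" "B \<in> carrier (presented_group X R)"
    "C \<in> carrier (presented_group X R)"
  then obtain u v w where
    uvw: "A = word_class X R u" "B = word_class X R v" "C = word_class X R w"
      "u \<in> words_over X" "v \<in> words_over X" "w \<in> words_over X"
    by (auto simp: presented_group_def)
  moreover have "u @ v \<in> words_over X" "v @ w \<in> words_over X"
    using uvw by (auto simp: words_over_def)
  ultimately show "A \<otimes>\<^bsub>presented_group X R\<^esub> B \<otimes>\<^bsub>presented_group X R\<^esub> C
    = A \<otimes>\<^bsub>presented_group X R\<^esub> (B \<otimes>\<^bsub>presented_group X R\<^esub> C)"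
    by (simp add: presented_group_mult)
next
  fix A assume "A \<in> carrier (presented_group X R)"
  then obtain u where u: "A = word_class X R u" "u \<in> words_over X"
    by (auto simp: presented_group_def)
  have e: "\<one>\<^bsub>presented_group X R\<^esub> = word_class X R []" "[] \<in> words_over X"
    by (auto simp: presented_group_def words_over_def)
  show "\<one>\<^bsub>presented_group X R\<^esub> \<otimes>\<^bsub>presented_group X R\<^esub> A = A"
    using u e by (simp add: presented_group_mult)
  let ?v = "rev (map (\<lambda>(x, e). (x, \<not> e)) u)"
  have v: "?v \<in> words_over X" using u by (auto simp: words_over_def)
  then have "word_class X R ?v \<otimes>\<^bsub>presented_group X R\<^esub> A = word_class X R (?v @ u)"
    using u by (simp add: presented_group_mult)
  also have "\<dots> = word_class X R []"
    using word_inverse[OF u(2)] word_equiv_words(1)[OF word_inverse[OF u(2)]]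
    by (metis word_class_eq_iff)
  finally show "\<exists>B\<in>carrier (presented_group X R).
      B \<otimes>\<^bsub>presented_group X R\<^esub> A = \<one>\<^bsub>presented_group X R\<^esub>"
    using v e by (auto simp: presented_group_def)
qed

definition A2_relators :: "('p \<times> 'p \<times> 'p) set \<Rightarrow> 'p word set" where
  "A2_relators \<T> = {[(x, True), (y, True), (z, True)] | x y z. (x, y, z) \<in> \<T>}"

definition A2_group :: "'p set \<Rightarrow> ('p \<times> 'p \<times> 'p) set \<Rightarrow> 'p word set monoid" where
  "A2_group P \<T> = presented_group P (A2_relators \<T>)"

definition A2_gen :: "'p set \<Rightarrow> ('p \<times> 'p \<times> 'p) set \<Rightarrow> 'p \<Rightarrow> 'p word set" where
  "A2_gen P \<T> x = word_class P (A2_relators \<T>) [(x, True)]"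


section \<open>Bounded operators on the Hilbert space of square-summable functions\<close>

text \<open>An element of \<open>l2 S\<close> is a total function vanishing off \<open>S\<close>. An operator is a function
  on \<open>l2 S\<close>, extensional (undefined off \<open>l2 S\<close>), so that equality of operators is equality
  of functions and the product of operators is \<^const>\<open>compose\<close> on \<open>l2 S\<close>.\<close>

definition l2 :: "'i set \<Rightarrow> ('i \<Rightarrow> complex) set" where
  "l2 S = {f. (\<forall>x. x \<notin> S \<longrightarrow> f x = 0) \<and> (\<lambda>x. (cmod (f x))\<^sup>2) summable_on S}"

definition l2_inner :: "'i set \<Rightarrow> ('i \<Rightarrow> complex) \<Rightarrow> ('i \<Rightarrow> complex) \<Rightarrow> complex" where
  "l2_inner S f g = (\<Sum>\<^sub>\<infinity>x\<in>S. f x * cnj (g x))"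

definition l2_norm :: "'i set \<Rightarrow> ('i \<Rightarrow> complex) \<Rightarrow> real" where
  "l2_norm S f = sqrt (\<Sum>\<^sub>\<infinity>x\<in>S. (cmod (f x))\<^sup>2)"

type_synonym 'i l2_op = "('i \<Rightarrow> complex) \<Rightarrow> ('i \<Rightarrow> complex)"

definition bounded_ops :: "'i set \<Rightarrow> 'i l2_op set" where
  "bounded_ops S = {T \<in> l2 S \<rightarrow>\<^sub>E l2 S.
     (\<forall>f\<in>l2 S. \<forall>g\<in>l2 S. T (\<lambda>x. f x + g x) = (\<lambda>x. T f x + T g x)) \<and>
     (\<forall>c. \<forall>f\<in>l2 S. T (\<lambda>x. c * f x) = (\<lambda>x. c * T f x)) \<and>
     (\<exists>C. \<forall>f\<in>l2 S. l2_norm S (T f) \<le> C * l2_norm S f)}"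

definition is_adjoint :: "'i set \<Rightarrow> 'i l2_op \<Rightarrow> 'i l2_op \<Rightarrow> bool" where
  "is_adjoint S T T' \<longleftrightarrow> T \<in> bounded_ops S \<and> T' \<in> bounded_ops S \<and>
     (\<forall>f\<in>l2 S. \<forall>g\<in>l2 S. l2_inner S (T f) g = l2_inner S f (T' g))"

abbreviation op_id :: "'i set \<Rightarrow> 'i l2_op" where
  "op_id S \<equiv> restrict id (l2 S)"

abbreviation op_mult :: "'i set \<Rightarrow> 'i l2_op \<Rightarrow> 'i l2_op \<Rightarrow> 'i l2_op" where
  "op_mult S A B \<equiv> compose (l2 S) A B"

definition commutant :: "'i set \<Rightarrow> 'i l2_op set \<Rightarrow> 'i l2_op set" where
  "commutant S A = {T \<in> bounded_ops S. \<forall>B\<in>A. op_mult S T B = op_mult S B T}"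

abbreviation bicommutant :: "'i set \<Rightarrow> 'i l2_op set \<Rightarrow> 'i l2_op set" where
  "bicommutant S A \<equiv> commutant S (commutant S A)"


section \<open>Von Neumann algebras and singular masas\<close>

definition von_neumann_algebra :: "'i set \<Rightarrow> 'i l2_op set \<Rightarrow> bool" where
  "von_neumann_algebra S M \<longleftrightarrow> M \<subseteq> bounded_ops S \<and>
     (\<forall>T\<in>M. \<exists>T'\<in>M. is_adjoint S T T') \<and> bicommutant S M = M"

definition abelian_vn_subalgebra :: "'i set \<Rightarrow> 'i l2_op set \<Rightarrow> 'i l2_op set \<Rightarrow> bool" where
  "abelian_vn_subalgebra S A M \<longleftrightarrow> von_neumann_algebra S A \<and> A \<subseteq> M \<and>
     (\<forall>T\<in>A. \<forall>R\<in>A. op_mult S T R = op_mult S R T)"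

definition masa :: "'i set \<Rightarrow> 'i l2_op set \<Rightarrow> 'i l2_op set \<Rightarrow> bool" where
  "masa S A M \<longleftrightarrow> abelian_vn_subalgebra S A M \<and>
     (\<forall>B. abelian_vn_subalgebra S B M \<and> A \<subseteq> B \<longrightarrow> B = A)"

text \<open>In the next definition \<open>v\<close> is the adjoint of the unitary \<open>u\<close>.\<close>

definition normalizer :: "'i set \<Rightarrow> 'i l2_op set \<Rightarrow> 'i l2_op set \<Rightarrow> 'i l2_op set" where
  "normalizer S A M = {u \<in> M. \<exists>v. is_adjoint S u v \<and>
     op_mult S v u = op_id S \<and> op_mult S u v = op_id S \<and>
     (\<lambda>T. op_mult S v (op_mult S T u)) ` A = A}"

definition singular :: "'i set \<Rightarrow> 'i l2_op set \<Rightarrow> 'i l2_op set \<Rightarrow> bool" where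
  "singular S A M \<longleftrightarrow> bicommutant S (normalizer S A M) = A"


section \<open>Group von Neumann algebras\<close>

definition left_regular :: "('g, 'm) monoid_scheme \<Rightarrow> 'g \<Rightarrow> 'g l2_op" where
  "left_regular G g = restrict
     (\<lambda>f x. if x \<in> carrier G then f (inv\<^bsub>G\<^esub> g \<otimes>\<^bsub>G\<^esub> x) else 0) (l2 (carrier G))"

definition group_vna :: "('g, 'm) monoid_scheme \<Rightarrow> 'g l2_op set" where
  "group_vna G = bicommutant (carrier G) (left_regular G ` carrier G)"

text \<open>An operator \<open>T\<close> in \<open>group_vna G\<close> is left convolution by the square-summable function
  \<open>T \<delta>\<^sub>e\<close>; this is the identification of \<open>group_vna G\<close> with a convolution algebra, and
  the support of \<open>T\<close> means the support of \<open>T \<delta>\<^sub>e\<close>.\<close>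

definition vna_symbol :: "('g, 'm) monoid_scheme \<Rightarrow> 'g l2_op \<Rightarrow> 'g \<Rightarrow> complex" where
  "vna_symbol G T = T (\<lambda>x. if x = \<one>\<^bsub>G\<^esub> then 1 else 0)"

definition subgroup_vna :: "('g, 'm) monoid_scheme \<Rightarrow> 'g set \<Rightarrow> 'g l2_op set" where
  "subgroup_vna G H = {T \<in> group_vna G. \<forall>x. x \<notin> H \<longrightarrow> vna_symbol G T x = 0}"

end

theory Submission
  imports Defs "HOL-Analysis.L2_Norm"
begin

text \<open>
  Everything follows from one property of the subgroup \<open>H = \<langle>a, b, c\<rangle>\<close>: for every finite set \<open>F\<close>
  of group elements outside \<open>H\<close> there is \<open>h \<in> H\<close> with \<open>s h t \<notin> H\<close> for all \<open>s, t \<in> F\<close>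
  (\<open>flat_avoids_double_coset\<close>). For an abelian subgroup this property suffices.
  An operator of \<open>W*(\<Gamma>)\<close> commuting with \<open>W*(H)\<close> has a symbol that is constant on \<open>H\<close>-conjugacy
  orbits; a square-summable function takes a nonzero value only finitely often, and the property
  moves a point outside \<open>H\<close> away from any finite set, so the symbol lives on \<open>H\<close>. This is
  maximality (\<open>subgroup_vna_masa\<close>). If a unitary \<open>u\<close> with symbol \<open>f\<close> normalizes \<open>W*(H)\<close>, then
  for each \<open>h \<in> H\<close> the vector \<open>u* \<lambda>(h) f\<close> has norm 1 and lives on \<open>H\<close>; for a suitable
  \<open>h\<close> the part of \<open>f\<close> outside \<open>H\<close> contributes almost nothing to it, so the part of \<open>f\<close> on
  \<open>H\<close> already has norm 1 and \<open>f\<close> vanishes outside \<open>H\<close> (\<open>normalizer_in_subgroup_vna\<close>).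
  The operator algebra needed is elementary: an operator belongs to \<open>W*(\<Gamma>)\<close> exactly if it
  commutes with right translations, and its matrix is then given by its symbol.

  The group theory is done with words. The relations \<open>x y = z\<^sup>-\<^sup>1\<close>, together with
  \<open>x\<^sup>-\<^sup>1 y = z v\<^sup>-\<^sup>1\<close> (where the line through the points \<open>x\<close> and \<open>y\<close> decides what \<open>z\<close> and
  \<open>v\<close> are), form a terminating and confluent rewriting system, so every element has a unique
  irreducible word. In such a word positive letters precede negative ones.

  Comparing normal forms, commuting generators \<open>a, b, c\<close> satisfy \<open>abc = 1\<close>, all permutations of
  \<open>(a, b, c)\<close> are triangles, and the elements of \<open>H\<close> are the words \<open>x\<^sup>m y\<^sup>-\<^sup>n\<close> with
  \<open>x, y\<close> distinct in \<open>{a, b, c}\<close>; hence \<open>H\<close> is free abelian of rank 2.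

  The avoidance property is reduced to a commensurator statement: if \<open>t\<^sup>-\<^sup>1 x\<^sup>K t \<in> H\<close>
  for all \<open>x \<in> {a, b, c}\<close> and some \<open>K > 0\<close>, then \<open>t \<in> H\<close> (\<open>commensurator_word\<close>). Indeed, by
  growth of weighted word length, \<open>t\<^sup>-\<^sup>1 x\<^sup>K t = y\<^sup>K\<close> for some \<open>y \<in> {a, b, c}\<close>
  (\<open>conjugate_power\<close>). Take \<open>t\<close> outside \<open>H\<close> and shortest in \<open>H t H\<close>, with irreducible word
  \<open>w\<close>. Its outer letters are not among \<open>a, b, c\<close>, so the first one can interact with at most one
  of the three letters \<open>x\<close> placed before it, and the last one with at most one \<open>y\<^sup>-\<^sup>1\<close>
  placed after it. By counting, some pair with \<open>t\<^sup>-\<^sup>1 x\<^sup>K t = y\<^sup>K\<close> makes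
  \<open>x\<^sup>K w y\<^sup>-\<^sup>K\<close> irreducible, although it represents \<open>t\<close>, as does the shorter \<open>w\<close>.
\<close>

section \<open>Square-summable functions\<close>

definition delta :: "'i \<Rightarrow> 'i \<Rightarrow> complex" where
  "delta x = (\<lambda>y. if y = x then 1 else 0)"

definition cutoff :: "'i set \<Rightarrow> ('i \<Rightarrow> complex) \<Rightarrow> 'i \<Rightarrow> complex" where
  "cutoff F f = (\<lambda>x. if x \<in> F then f x else 0)"

lemma cutoff_apply [simp]: "cutoff F f x = (if x \<in> F then f x else 0)"
  by (simp add: cutoff_def)

lemma l2_outside: "f \<in> l2 S \<Longrightarrow> x \<notin> S \<Longrightarrow> f x = 0"
  by (simp add: l2_def)

lemma l2_summable: "f \<in> l2 S \<Longrightarrow> (\<lambda>x. (cmod (f x))\<^sup>2) summable_on S"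
  by (simp add: l2_def)

lemma l2_norm_nonneg [simp]: "l2_norm S f \<ge> 0"
  by (simp add: l2_norm_def infsum_nonneg)

lemma l2_norm_sq: "(l2_norm S f)\<^sup>2 = (\<Sum>\<^sub>\<infinity>x\<in>S. (cmod (f x))\<^sup>2)"
  by (simp add: l2_norm_def infsum_nonneg)

lemma L2_set_le_l2_norm:
  assumes "f \<in> l2 S" "finite F" "F \<subseteq> S"
  shows "L2_set (\<lambda>x. cmod (f x)) F \<le> l2_norm S f"
  unfolding L2_set_def l2_norm_def
  using assms by (intro real_sqrt_le_mono finite_sum_le_infsum) (auto simp: l2_def)

text \<open>Square-summability and norm bounds are both reduced to finite subsets, where the
  inequalities for \<^const>\<open>L2_set\<close> apply.\<close>

lemma l2_boundI:
  assumes out: "\<And>x. x \<notin> S \<Longrightarrow> f x = 0"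
    and bound: "\<And>F. finite F \<Longrightarrow> F \<subseteq> S \<Longrightarrow> L2_set (\<lambda>x. cmod (f x)) F \<le> C"
  shows "f \<in> l2 S" "l2_norm S f \<le> C"
proof -
  have C: "C \<ge> 0" using bound[of "{}"] by simp
  have sq: "(\<Sum>x\<in>F. (cmod (f x))\<^sup>2) \<le> C\<^sup>2" if "finite F" "F \<subseteq> S" for F
    using bound[OF that] C unfolding L2_set_def by (intro sqrt_le_D)
  have summ: "(\<lambda>x. (cmod (f x))\<^sup>2) summable_on S"
    by (rule nonneg_bdd_above_summable_on) (auto intro!: bdd_aboveI2[of _ _ "C\<^sup>2"] sq)
  then show "f \<in> l2 S" using out by (simp add: l2_def)
  have "(\<Sum>\<^sub>\<infinity>x\<in>S. (cmod (f x))\<^sup>2) \<le> C\<^sup>2"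
    using summ sq by (intro infsum_le_finite_sums) auto
  then show "l2_norm S f \<le> C" using C by (simp add: l2_norm_def real_le_lsqrt infsum_nonneg)
qed

lemma l2_dominated:
  assumes "f \<in> l2 S" "\<And>x. x \<notin> S \<Longrightarrow> g x = 0" "\<And>x. x \<in> S \<Longrightarrow> cmod (g x) \<le> cmod (f x)"
  shows "g \<in> l2 S" "l2_norm S g \<le> l2_norm S f"
proof -
  have "L2_set (\<lambda>x. cmod (g x)) F \<le> l2_norm S f" if "finite F" "F \<subseteq> S" for F
    using L2_set_le_l2_norm[OF assms(1) that] assms(3) that
    by (meson L2_set_mono norm_ge_zero order_trans subsetD)
  then show "g \<in> l2 S" "l2_norm S g \<le> l2_norm S f"
    using l2_boundI[of S g] assms(2) by blast+
qed

lemma l2_add: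
  assumes "f \<in> l2 S" "g \<in> l2 S"
  shows "(\<lambda>x. f x + g x) \<in> l2 S" "l2_norm S (\<lambda>x. f x + g x) \<le> l2_norm S f + l2_norm S g"
proof -
  have "L2_set (\<lambda>x. cmod (f x + g x)) F \<le> l2_norm S f + l2_norm S g" if "finite F" "F \<subseteq> S" for F
  proof -
    have "L2_set (\<lambda>x. cmod (f x + g x)) F \<le> L2_set (\<lambda>x. cmod (f x) + cmod (g x)) F"
      by (intro L2_set_mono) (auto intro: norm_triangle_ineq)
    also have "\<dots> \<le> L2_set (\<lambda>x. cmod (f x)) F + L2_set (\<lambda>x. cmod (g x)) F"
      by (rule L2_set_triangle_ineq)
    also have "\<dots> \<le> l2_norm S f + l2_norm S g"
      using assms that by (intro add_mono L2_set_le_l2_norm)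
    finally show ?thesis .
  qed
  then show "(\<lambda>x. f x + g x) \<in> l2 S" "l2_norm S (\<lambda>x. f x + g x) \<le> l2_norm S f + l2_norm S g"
    using l2_boundI[of S "\<lambda>x. f x + g x"] assms by (auto simp: l2_outside)
qed

lemma l2_scale:
  assumes "f \<in> l2 S"
  shows "(\<lambda>x. c * f x) \<in> l2 S" "l2_norm S (\<lambda>x. c * f x) \<le> cmod c * l2_norm S f"
proof -
  have "L2_set (\<lambda>x. cmod (c * f x)) F \<le> cmod c * l2_norm S f" if "finite F" "F \<subseteq> S" for F
    using L2_set_le_l2_norm[OF assms that]
    by (simp add: norm_mult L2_set_right_distrib[symmetric] mult_left_mono)
  then show "(\<lambda>x. c * f x) \<in> l2 S" "l2_norm S (\<lambda>x. c * f x) \<le> cmod c * l2_norm S f"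
    using l2_boundI[of S "\<lambda>x. c * f x"] assms by (auto simp: l2_outside)
qed

lemma l2_zero: "(\<lambda>x. 0) \<in> l2 S" "l2_norm S (\<lambda>x. 0) = 0"
  by (auto simp: l2_def l2_norm_def)

lemma l2_sum:
  assumes "finite F" "\<And>t. t \<in> F \<Longrightarrow> g t \<in> l2 S"
  shows "(\<lambda>y. \<Sum>t\<in>F. c t * g t y) \<in> l2 S"
    and "l2_norm S (\<lambda>y. \<Sum>t\<in>F. c t * g t y) \<le> (\<Sum>t\<in>F. cmod (c t) * l2_norm S (g t))"
proof -
  have "(\<lambda>y. \<Sum>t\<in>F. c t * g t y) \<in> l2 S \<and>
    l2_norm S (\<lambda>y. \<Sum>t\<in>F. c t * g t y) \<le> (\<Sum>t\<in>F. cmod (c t) * l2_norm S (g t))"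
    using assms
  proof (induction F rule: finite_induct)
    case (insert t F)
    then have "(\<lambda>y. c t * g t y) \<in> l2 S" "l2_norm S (\<lambda>y. c t * g t y) \<le> cmod (c t) * l2_norm S (g t)"
      by (auto intro: l2_scale)
    moreover have "(\<lambda>y. \<Sum>t\<in>F. c t * g t y) \<in> l2 S"
      "l2_norm S (\<lambda>y. \<Sum>t\<in>F. c t * g t y) \<le> (\<Sum>t\<in>F. cmod (c t) * l2_norm S (g t))"
      using insert by auto
    ultimately show ?case
      using insert l2_add[of "\<lambda>y. c t * g t y" S "\<lambda>y. \<Sum>t\<in>F. c t * g t y"] by auto
  qed (simp add: l2_zero)
  then show "(\<lambda>y. \<Sum>t\<in>F. c t * g t y) \<in> l2 S"
    and "l2_norm S (\<lambda>y. \<Sum>t\<in>F. c t * g t y) \<le> (\<Sum>t\<in>F. cmod (c t) * l2_norm S (g t))" by auto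
qed

lemma l2_delta: "x \<in> S \<Longrightarrow> delta x \<in> l2 S"
  by (rule l2_boundI(1)[of _ _ 1])
    (auto simp: delta_def L2_set_def if_distrib[of cmod] if_distrib[of "\<lambda>t. t\<^sup>2"] sum.delta' cong: if_cong)

lemma l2_cutoff: "f \<in> l2 S \<Longrightarrow> cutoff F f \<in> l2 S" "f \<in> l2 S \<Longrightarrow> l2_norm S (cutoff F f) \<le> l2_norm S f"
  by (rule l2_dominated[of f]; auto simp: l2_outside)+

lemma l2_coord_le: "f \<in> l2 S \<Longrightarrow> cmod (f x) \<le> l2_norm S f"
  using L2_set_le_l2_norm[of f S "{x}"] by (cases "x \<in> S") (auto simp: l2_outside)

text \<open>One half of the Pythagorean theorem. It serves both to truncate a function and to remove a
  single point from its support.\<close>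

lemma l2_norm_cutoff_finite:
  assumes f: "f \<in> l2 S" and E: "finite E" "E \<subseteq> S"
  shows "(l2_norm S (cutoff (- E) f))\<^sup>2 \<le> (l2_norm S f)\<^sup>2 - (\<Sum>x\<in>E. (cmod (f x))\<^sup>2)"
  unfolding l2_norm_sq
proof (rule infsum_le_finite_sums)
  show "(\<lambda>x. (cmod (cutoff (- E) f x))\<^sup>2) summable_on S"
    by (rule l2_summable[OF l2_cutoff(1)[OF f]])
  fix D assume D: "finite D" "D \<subseteq> S"
  have "(\<Sum>x\<in>D. (cmod (cutoff (- E) f x))\<^sup>2) = (\<Sum>x\<in>D - E. (cmod (f x))\<^sup>2)"
    using D by (intro sum.mono_neutral_cong_right) auto
  also have "\<dots> = (\<Sum>x\<in>(D - E) \<union> E. (cmod (f x))\<^sup>2) - (\<Sum>x\<in>E. (cmod (f x))\<^sup>2)"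
    using D E by (subst sum.union_disjoint) auto
  also have "\<dots> \<le> (\<Sum>\<^sub>\<infinity>x\<in>S. (cmod (f x))\<^sup>2) - (\<Sum>x\<in>E. (cmod (f x))\<^sup>2)"
    using D E l2_summable[OF f] by (intro diff_right_mono finite_sum_le_infsum) auto
  finally show "(\<Sum>x\<in>D. (cmod (cutoff (- E) f x))\<^sup>2)
    \<le> (\<Sum>\<^sub>\<infinity>x\<in>S. (cmod (f x))\<^sup>2) - (\<Sum>x\<in>E. (cmod (f x))\<^sup>2)" .
qed

lemma l2_tail_small:
  assumes f: "f \<in> l2 S" and e: "e > 0"
  obtains F where "finite F" "F \<subseteq> S"
    "\<And>E. finite E \<Longrightarrow> F \<subseteq> E \<Longrightarrow> E \<subseteq> S \<Longrightarrow> l2_norm S (cutoff (- E) f) \<le> e"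
proof -
  obtain F where F: "finite F" "F \<subseteq> S"
    "dist (\<Sum>x\<in>F. (cmod (f x))\<^sup>2) (\<Sum>\<^sub>\<infinity>x\<in>S. (cmod (f x))\<^sup>2) \<le> e\<^sup>2"
    using infsum_finite_approximation[OF l2_summable[OF f], of "e\<^sup>2"] e by auto
  have "l2_norm S (cutoff (- E) f) \<le> e" if E: "finite E" "F \<subseteq> E" "E \<subseteq> S" for E
  proof -
    have "(l2_norm S (cutoff (- E) f))\<^sup>2 \<le> (l2_norm S f)\<^sup>2 - (\<Sum>x\<in>E. (cmod (f x))\<^sup>2)"
      by (rule l2_norm_cutoff_finite[OF f E(1,3)])
    also have "\<dots> \<le> (l2_norm S f)\<^sup>2 - (\<Sum>x\<in>F. (cmod (f x))\<^sup>2)"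
      using E by (intro diff_left_mono sum_mono2) auto
    also have "\<dots> \<le> e\<^sup>2" using F by (simp add: dist_real_def l2_norm_sq)
    finally show ?thesis by (rule power2_le_imp_le) (use e in simp)
  qed
  with F that show ?thesis by blast
qed

lemma l2_inner_abs_summable:
  assumes "f \<in> l2 S" "g \<in> l2 S"
  shows "(\<lambda>x. f x * cnj (g x)) abs_summable_on S" "cmod (l2_inner S f g) \<le> l2_norm S f * l2_norm S g"
proof -
  have fin: "(\<Sum>x\<in>F. norm (f x * cnj (g x))) \<le> l2_norm S f * l2_norm S g" if "finite F" "F \<subseteq> S" for F
  proof -
    have "(\<Sum>x\<in>F. norm (f x * cnj (g x))) \<le> L2_set (\<lambda>x. cmod (f x)) F * L2_set (\<lambda>x. cmod (g x)) F"
      using L2_set_mult_ineq[of "\<lambda>x. cmod (f x)" "\<lambda>x. cmod (g x)" F] by (simp add: norm_mult)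
    also have "\<dots> \<le> l2_norm S f * l2_norm S g"
      using assms that by (intro mult_mono L2_set_le_l2_norm) auto
    finally show ?thesis .
  qed
  show s: "(\<lambda>x. f x * cnj (g x)) abs_summable_on S"
    by (rule nonneg_bdd_above_summable_on)
      (auto intro!: bdd_aboveI2[of _ _ "l2_norm S f * l2_norm S g"] fin)
  have "cmod (l2_inner S f g) \<le> (\<Sum>\<^sub>\<infinity>x\<in>S. norm (f x * cnj (g x)))"
    unfolding l2_inner_def using s by (rule norm_infsum_bound)
  also have "\<dots> \<le> l2_norm S f * l2_norm S g"
    using s fin by (intro infsum_le_finite_sums) auto
  finally show "cmod (l2_inner S f g) \<le> l2_norm S f * l2_norm S g" .
qed

lemma l2_inner_summable: "f \<in> l2 S \<Longrightarrow> g \<in> l2 S \<Longrightarrow> (\<lambda>x. f x * cnj (g x)) summable_on S"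
  by (rule abs_summable_summable[OF l2_inner_abs_summable(1)])

lemma l2_inner_add: "f \<in> l2 S \<Longrightarrow> g \<in> l2 S \<Longrightarrow> h \<in> l2 S \<Longrightarrow>
    l2_inner S (\<lambda>x. f x + g x) h = l2_inner S f h + l2_inner S g h"
  unfolding l2_inner_def using l2_inner_summable[of f S h] l2_inner_summable[of g S h]
  by (simp add: distrib_right infsum_add)

lemma l2_inner_scale: "l2_inner S (\<lambda>x. c * f x) h = c * l2_inner S f h"
  unfolding l2_inner_def by (simp add: mult.assoc infsum_cmult_right')

lemma l2_inner_cnj: "cnj (l2_inner S f g) = l2_inner S g f"
  unfolding l2_inner_def by (simp flip: infsum_cnj add: mult.commute)

lemma l2_inner_delta_right: "x \<in> S \<Longrightarrow> l2_inner S f (delta x) = f x"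
  unfolding l2_inner_def
  by (subst infsum_cong_neutral[where T = "{x}" and g = f]) (auto simp: delta_def)

lemma l2_inner_delta_left: "x \<in> S \<Longrightarrow> l2_inner S (delta x) f = cnj (f x)"
  using l2_inner_delta_right[of x S f] l2_inner_cnj[of S f "delta x"] by simp

lemma l2_inner_self: "f \<in> l2 S \<Longrightarrow> l2_inner S f f = of_real ((l2_norm S f)\<^sup>2)"
proof -
  assume f: "f \<in> l2 S"
  have "l2_inner S f f = (\<Sum>\<^sub>\<infinity>x\<in>S. of_real ((cmod (f x))\<^sup>2))"
    unfolding l2_inner_def complex_norm_square ..
  then show ?thesis unfolding l2_norm_sq using infsumI[OF has_sum_of_real[OF has_sum_infsum[OF l2_summable[OF f]]]] by simp
qed

section \<open>Matrix coefficients and adjoints of bounded operators\<close>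

lemma bounded_ops_l2: "T \<in> bounded_ops S \<Longrightarrow> f \<in> l2 S \<Longrightarrow> T f \<in> l2 S"
  by (auto simp: bounded_ops_def PiE_iff)

lemma bounded_ops_undefined: "T \<in> bounded_ops S \<Longrightarrow> f \<notin> l2 S \<Longrightarrow> T f = undefined"
  by (auto simp: bounded_ops_def PiE_iff extensional_def)

lemma bounded_ops_add: "T \<in> bounded_ops S \<Longrightarrow> f \<in> l2 S \<Longrightarrow> g \<in> l2 S \<Longrightarrow>
    T (\<lambda>x. f x + g x) = (\<lambda>x. T f x + T g x)"
  by (simp add: bounded_ops_def)

lemma bounded_ops_scale: "T \<in> bounded_ops S \<Longrightarrow> f \<in> l2 S \<Longrightarrow> T (\<lambda>x. c * f x) = (\<lambda>x. c * T f x)"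
  by (simp add: bounded_ops_def)

lemma bounded_ops_bound:
  assumes "T \<in> bounded_ops S"
  obtains C where "C \<ge> 0" "\<And>f. f \<in> l2 S \<Longrightarrow> l2_norm S (T f) \<le> C * l2_norm S f"
proof -
  obtain C where C: "\<And>f. f \<in> l2 S \<Longrightarrow> l2_norm S (T f) \<le> C * l2_norm S f"
    using assms unfolding bounded_ops_def by blast
  have "l2_norm S (T f) \<le> max C 0 * l2_norm S f" if "f \<in> l2 S" for f
    using C[OF that] by (meson l2_norm_nonneg max.cobounded1 mult_right_mono order_trans)
  then show ?thesis using that[of "max C 0"] by simp
qed

lemma functional_finite:
  assumes add: "\<And>f g. f \<in> l2 S \<Longrightarrow> g \<in> l2 S \<Longrightarrow> \<Phi> (\<lambda>x. f x + g x) = \<Phi> f + \<Phi> g"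
    and scale: "\<And>c f. f \<in> l2 S \<Longrightarrow> \<Phi> (\<lambda>x. c * f x) = c * (\<Phi> f :: complex)"
    and F: "finite F" "F \<subseteq> S" and f: "f \<in> l2 S"
  shows "\<Phi> (cutoff F f) = (\<Sum>x\<in>F. f x * \<Phi> (delta x))"
  using F
proof (induction F rule: finite_induct)
  case empty
  have "cutoff {} f = (\<lambda>x. 0 * f x)" by auto
  then show ?case using scale[OF f, of 0] by simp
next
  case (insert x F)
  have "cutoff (insert x F) f = (\<lambda>y. f x * delta x y + cutoff F f y)"
    using insert(2) by (auto simp: delta_def)
  moreover have "(\<lambda>y. f x * delta x y) \<in> l2 S" "cutoff F f \<in> l2 S"
    using insert f by (auto intro!: l2_scale l2_cutoff l2_delta)
  ultimately have "\<Phi> (cutoff (insert x F) f) = f x * \<Phi> (delta x) + \<Phi> (cutoff F f)"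
    using insert by (simp add: add scale l2_delta del: cutoff_apply)
  then show ?case using insert by (simp del: cutoff_apply)
qed

text \<open>Truncations converge in norm, so a bounded functional is determined by its values at the
  point masses. The values of \<open>T f\<close> at a point and the numbers \<open>\<langle>T f, g\<rangle>\<close> are the two instances
  used below.\<close>

lemma functional_has_sum:
  assumes add: "\<And>f g. f \<in> l2 S \<Longrightarrow> g \<in> l2 S \<Longrightarrow> \<Phi> (\<lambda>x. f x + g x) = \<Phi> f + \<Phi> g"
    and scale: "\<And>c f. f \<in> l2 S \<Longrightarrow> \<Phi> (\<lambda>x. c * f x) = c * (\<Phi> f :: complex)"
    and bound: "\<And>f. f \<in> l2 S \<Longrightarrow> cmod (\<Phi> f) \<le> C * l2_norm S f"
    and f: "f \<in> l2 S"
  shows "((\<lambda>x. f x * \<Phi> (delta x)) has_sum \<Phi> f) S"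
  unfolding has_sum_def tendsto_iff eventually_finite_subsets_at_top
proof (intro allI impI)
  fix e :: real assume e: "e > 0"
  define K where "K = \<bar>C\<bar> + 1"
  have C: "K > 0" "C \<le> K" unfolding K_def by (auto intro: add_nonneg_pos)
  define d where "d = e / 2 / K"
  have d: "d > 0" using e C by (simp add: d_def)
  obtain F where F: "finite F" "F \<subseteq> S"
    "\<And>E. finite E \<Longrightarrow> F \<subseteq> E \<Longrightarrow> E \<subseteq> S \<Longrightarrow> l2_norm S (cutoff (- E) f) \<le> d"
    using l2_tail_small[OF f d] by metis
  have "dist (\<Sum>x\<in>E. f x * \<Phi> (delta x)) (\<Phi> f) < e" if E: "finite E" "F \<subseteq> E" "E \<subseteq> S" for E
  proof -
    have "f = (\<lambda>x. cutoff E f x + cutoff (- E) f x)" by auto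
    then have "\<Phi> f = \<Phi> (cutoff E f) + \<Phi> (cutoff (- E) f)"
      using add[OF l2_cutoff(1)[OF f, of E] l2_cutoff(1)[OF f, of "- E"]] by simp
    moreover have "\<Phi> (cutoff E f) = (\<Sum>x\<in>E. f x * \<Phi> (delta x))"
      by (rule functional_finite[OF add scale]) (use E f in auto)
    ultimately have "dist (\<Sum>x\<in>E. f x * \<Phi> (delta x)) (\<Phi> f) = cmod (\<Phi> (cutoff (- E) f))"
      by (simp add: dist_norm)
    also have "\<dots> \<le> C * l2_norm S (cutoff (- E) f)" by (rule bound[OF l2_cutoff(1)[OF f]])
    also have "\<dots> \<le> K * d"
      using F(3)[OF E] C by (intro mult_mono) auto
    also have "\<dots> = e / 2" using C by (simp add: d_def)
    also have "\<dots> < e" using e by simp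
    finally show ?thesis .
  qed
  then show "\<exists>X. finite X \<and> X \<subseteq> S \<and> (\<forall>Y. finite Y \<and> X \<subseteq> Y \<and> Y \<subseteq> S \<longrightarrow>
      dist (\<Sum>x\<in>Y. f x * \<Phi> (delta x)) (\<Phi> f) < e)"
    using F by blast
qed

lemma bounded_ops_has_sum:
  assumes T: "T \<in> bounded_ops S" and f: "f \<in> l2 S"
  shows "((\<lambda>x. f x * T (delta x) y) has_sum T f y) S"
proof -
  obtain C where C: "C \<ge> 0" "\<And>f. f \<in> l2 S \<Longrightarrow> l2_norm S (T f) \<le> C * l2_norm S f"
    using bounded_ops_bound[OF T] by metis
  show ?thesis
    by (rule functional_has_sum[where \<Phi> = "\<lambda>f. T f y" and C = C])
      (use f C T in \<open>auto simp: bounded_ops_add bounded_ops_scale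
        intro: order_trans[OF l2_coord_le[OF bounded_ops_l2[OF T]]]\<close>)
qed

lemma bounded_ops_eqI:
  assumes T: "T \<in> bounded_ops S" and R: "R \<in> bounded_ops S"
    and eq: "\<And>x. x \<in> S \<Longrightarrow> T (delta x) = R (delta x)"
  shows "T = R"
proof
  fix f
  show "T f = R f"
  proof (cases "f \<in> l2 S")
    case True
    show ?thesis
    proof
      fix y
      have "((\<lambda>x. f x * R (delta x) y) has_sum T f y) S"
        using bounded_ops_has_sum[OF T True, of y] eq by (simp cong: has_sum_cong)
      then show "T f y = R f y" using bounded_ops_has_sum[OF R True] has_sum_unique by blast
    qed
  qed (use assms bounded_ops_undefined in metis)
qed

lemma op_mult_apply: "f \<in> l2 S \<Longrightarrow> op_mult S T R f = T (R f)"
  by (simp add: compose_def)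

lemma bounded_ops_mult:
  assumes T: "T \<in> bounded_ops S" and R: "R \<in> bounded_ops S"
  shows "op_mult S T R \<in> bounded_ops S"
proof -
  obtain C where C: "C \<ge> 0" "\<And>f. f \<in> l2 S \<Longrightarrow> l2_norm S (T f) \<le> C * l2_norm S f"
    using bounded_ops_bound[OF T] by metis
  obtain B where B: "B \<ge> 0" "\<And>f. f \<in> l2 S \<Longrightarrow> l2_norm S (R f) \<le> B * l2_norm S f"
    using bounded_ops_bound[OF R] by metis
  have bound: "l2_norm S (T (R f)) \<le> C * B * l2_norm S f" if "f \<in> l2 S" for f
    using C(2)[OF bounded_ops_l2[OF R that]] mult_left_mono[OF B(2)[OF that] C(1)] by simp
  have "op_mult S T R \<in> l2 S \<rightarrow>\<^sub>E l2 S"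
    using T R by (auto simp: compose_def bounded_ops_l2)
  then show ?thesis
    unfolding bounded_ops_def using T R bound
    by (auto simp: op_mult_apply l2_add l2_scale bounded_ops_add bounded_ops_scale bounded_ops_l2
        intro!: exI[of _ "C * B"])
qed

lemma op_mult_assoc:
  assumes "R \<in> bounded_ops S"
  shows "op_mult S (op_mult S T Q) R = op_mult S T (op_mult S Q R)"
  using assms by (auto simp: compose_def bounded_ops_l2 fun_eq_iff restrict_def)

lemma op_mult_commuteI:
  assumes "T \<in> bounded_ops S" "R \<in> bounded_ops S"
    and "\<And>x. x \<in> S \<Longrightarrow> T (R (delta x)) = R (T (delta x))"
  shows "op_mult S T R = op_mult S R T"
  by (rule bounded_ops_eqI[of _ S]) (use assms in \<open>auto simp: bounded_ops_mult op_mult_apply l2_delta\<close>)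

lemma op_mult_commuteD:
  "op_mult S T R = op_mult S R T \<Longrightarrow> f \<in> l2 S \<Longrightarrow> T (R f) = R (T f)"
  by (metis op_mult_apply)

text \<open>The adjoint is given by the conjugate transpose matrix. The function \<open>A g\<close> that it produces is
  square-summable with the right bound because testing \<open>T\<close> against a truncation \<open>k\<close> of \<open>A g\<close> gives
  \<open>\<parallel>k\<parallel>\<^sup>2 = \<langle>T k, g\<rangle> \<le> C \<parallel>k\<parallel> \<parallel>g\<parallel>\<close>.\<close>

lemma ex_adjoint:
  assumes T: "T \<in> bounded_ops S"
  shows "\<exists>T'. is_adjoint S T T'"
proof -
  obtain C where C: "C \<ge> 0" "\<And>f. f \<in> l2 S \<Longrightarrow> l2_norm S (T f) \<le> C * l2_norm S f"
    using bounded_ops_bound[OF T] by metis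
  define A where "A g x = (if x \<in> S then l2_inner S g (T (delta x)) else 0)" for g x
  have Td: "T (delta x) \<in> l2 S" if "x \<in> S" for x using T that by (simp add: bounded_ops_l2 l2_delta)
  have \<Phi>_add: "l2_inner S (T (\<lambda>x. f x + h x)) g = l2_inner S (T f) g + l2_inner S (T h) g"
    if "g \<in> l2 S" "f \<in> l2 S" "h \<in> l2 S" for f g h
    using that T by (simp add: bounded_ops_add l2_inner_add bounded_ops_l2)
  have \<Phi>_scale: "l2_inner S (T (\<lambda>x. c * f x)) g = c * l2_inner S (T f) g"
    if "g \<in> l2 S" "f \<in> l2 S" for f g c
    using that T by (simp add: bounded_ops_scale l2_inner_scale)
  have \<Phi>_bound: "cmod (l2_inner S (T f) g) \<le> C * l2_norm S g * l2_norm S f"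
    if "g \<in> l2 S" "f \<in> l2 S" for f g
    using l2_inner_abs_summable(2)[OF bounded_ops_l2[OF T that(2)] that(1)]
      mult_right_mono[OF C(2)[OF that(2)], of "l2_norm S g"] by (simp add: mult_ac)
  have A_bound: "L2_set (\<lambda>x. cmod (A g x)) F \<le> C * l2_norm S g"
    if g: "g \<in> l2 S" and F: "finite F" "F \<subseteq> S" for g F
  proof -
    \<comment> \<open>the test vector is the truncation of \<open>A g\<close> to \<open>F\<close>, whose norm is \<open>?s\<close>\<close>
    let ?s = "L2_set (\<lambda>x. cmod (A g x)) F"
    have k: "cutoff F (A g) \<in> l2 S" "l2_norm S (cutoff F (A g)) \<le> ?s"
    proof -
      have bnd: "L2_set (\<lambda>x. cmod (cutoff F (A g) x)) E \<le> ?s" if "finite E" "E \<subseteq> S" for E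
      proof -
        have "(\<Sum>x\<in>E. (cmod (cutoff F (A g) x))\<^sup>2) = (\<Sum>x\<in>E \<inter> F. (cmod (A g x))\<^sup>2)"
          using that by (intro sum.mono_neutral_cong_right) auto
        also have "\<dots> \<le> (\<Sum>x\<in>F. (cmod (A g x))\<^sup>2)"
          using F by (intro sum_mono2) auto
        finally show ?thesis by (simp add: L2_set_def)
      qed
      show "cutoff F (A g) \<in> l2 S" "l2_norm S (cutoff F (A g)) \<le> ?s"
        by (rule l2_boundI[OF _ bnd]; simp add: A_def)+
    qed
    have "cutoff F (cutoff F (A g)) = cutoff F (A g)" by auto
    then have "l2_inner S (T (cutoff F (A g))) g = (\<Sum>x\<in>F. cutoff F (A g) x * l2_inner S (T (delta x)) g)"
      using functional_finite[where \<Phi> = "\<lambda>f. l2_inner S (T f) g" and S = S and f = "cutoff F (A g)" and F = F]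
        \<Phi>_add[OF g] \<Phi>_scale[OF g] F k by simp
    also have "\<dots> = (\<Sum>x\<in>F. complex_of_real ((cmod (A g x))\<^sup>2))"
    proof (intro sum.cong HOL.refl)
      fix x assume x: "x \<in> F"
      then have "l2_inner S (T (delta x)) g = cnj (A g x)"
        using F l2_inner_cnj[of S g] by (auto simp: A_def)
      then show "cutoff F (A g) x * l2_inner S (T (delta x)) g = complex_of_real ((cmod (A g x))\<^sup>2)"
        using x by (simp only: cutoff_apply if_True complex_norm_square)
    qed
    also have "\<dots> = complex_of_real (?s\<^sup>2)"
      by (simp add: L2_set_def sum_nonneg)
    finally have "?s\<^sup>2 = cmod (l2_inner S (T (cutoff F (A g))) g)"
      by (metis abs_of_nonneg norm_of_real zero_le_power2)
    also have "\<dots> \<le> C * l2_norm S g * ?s"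
      using \<Phi>_bound[OF g k(1)] k(2) C(1) by (meson l2_norm_nonneg mult_left_mono mult_nonneg_nonneg order_trans)
    finally have "?s * ?s \<le> (C * l2_norm S g) * ?s" by (simp add: power2_eq_square)
    then show ?thesis
      using C(1) by (cases "?s = 0") (auto simp: mult_le_cancel_right L2_set_nonneg less_le)
  qed
  have A_l2: "A g \<in> l2 S" "l2_norm S (A g) \<le> C * l2_norm S g" if "g \<in> l2 S" for g
    using l2_boundI[of S "A g", OF _ A_bound[OF that]] by (auto simp: A_def)
  define T' where "T' = restrict A (l2 S)"
  have "T' \<in> bounded_ops S"
    unfolding bounded_ops_def
  proof (intro CollectI conjI ballI allI)
    show "T' \<in> l2 S \<rightarrow>\<^sub>E l2 S" using A_l2 by (auto simp: T'_def)
    show "T' (\<lambda>x. f x + g x) = (\<lambda>x. T' f x + T' g x)" if "f \<in> l2 S" "g \<in> l2 S" for f g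
      using that Td by (auto simp: T'_def l2_add A_def l2_inner_add)
    show "T' (\<lambda>x. c * f x) = (\<lambda>x. c * T' f x)" if "f \<in> l2 S" for c f
      using that by (auto simp: T'_def l2_scale A_def l2_inner_scale)
    show "\<exists>C. \<forall>f\<in>l2 S. l2_norm S (T' f) \<le> C * l2_norm S f"
      using A_l2 by (auto simp: T'_def)
  qed
  moreover have "l2_inner S (T f) g = l2_inner S f (T' g)" if f: "f \<in> l2 S" and g: "g \<in> l2 S" for f g
  proof -
    have "((\<lambda>x. f x * l2_inner S (T (delta x)) g) has_sum l2_inner S (T f) g) S"
      by (rule functional_has_sum[OF \<Phi>_add[OF g] \<Phi>_scale[OF g] \<Phi>_bound[OF g] f])
    moreover have "l2_inner S (T (delta x)) g = cnj (T' g x)" if "x \<in> S" for x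
      using that g l2_inner_cnj[of S g] by (simp add: T'_def A_def)
    ultimately have "((\<lambda>x. f x * cnj (T' g x)) has_sum l2_inner S (T f) g) S"
      by (simp cong: has_sum_cong)
    then show ?thesis unfolding l2_inner_def[of S f] by (simp add: infsumI)
  qed
  ultimately show ?thesis using T unfolding is_adjoint_def by blast
qed

lemma adjoint_commute:
  assumes "is_adjoint S T T'" "is_adjoint S R R'" "op_mult S T R = op_mult S R T"
  shows "op_mult S T' R' = op_mult S R' T'"
proof (rule op_mult_commuteI)
  show b: "T' \<in> bounded_ops S" "R' \<in> bounded_ops S" using assms by (auto simp: is_adjoint_def)
  have b': "T \<in> bounded_ops S" "R \<in> bounded_ops S" using assms by (auto simp: is_adjoint_def)
  have adj: "l2_inner S (T f) g = l2_inner S f (T' g)" "l2_inner S (R f) g = l2_inner S f (R' g)"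
    if "f \<in> l2 S" "g \<in> l2 S" for f g using assms that by (auto simp: is_adjoint_def)
  fix x assume x: "x \<in> S"
  show "T' (R' (delta x)) = R' (T' (delta x))"
  proof
    fix y
    show "T' (R' (delta x)) y = R' (T' (delta x)) y"
    proof (cases "y \<in> S")
      case True
      note l = l2_delta[OF x] l2_delta[OF True] bounded_ops_l2[OF b(1)] bounded_ops_l2[OF b(2)]
        bounded_ops_l2[OF b'(1)] bounded_ops_l2[OF b'(2)]
      have "l2_inner S (delta y) (T' (R' (delta x))) = l2_inner S (R (T (delta y))) (delta x)"
        using l by (simp add: adj)
      also have "R (T (delta y)) = T (R (delta y))"
        using op_mult_commuteD[OF assms(3)] l by simp
      also have "l2_inner S (T (R (delta y))) (delta x) = l2_inner S (delta y) (R' (T' (delta x)))"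
        using l by (simp add: adj)
      finally show ?thesis using True by (simp add: l2_inner_delta_left)
    next
      case False
      then show ?thesis
        using b x by (metis l2_outside bounded_ops_l2 l2_delta)
    qed
  qed
qed

lemma bounded_op_zero_outside: "T \<in> bounded_ops S \<Longrightarrow> f \<in> l2 S \<Longrightarrow> x \<notin> S \<Longrightarrow> T f x = 0"
  using bounded_ops_l2 l2_outside by metis

lemma commutantI:
  "T \<in> bounded_ops S \<Longrightarrow> (\<And>B. B \<in> A \<Longrightarrow> op_mult S T B = op_mult S B T) \<Longrightarrow> T \<in> commutant S A"
  by (simp add: commutant_def)

lemma commutantD: "T \<in> commutant S A \<Longrightarrow> B \<in> A \<Longrightarrow> op_mult S T B = op_mult S B T"
  by (simp add: commutant_def)

lemma commutant_bounded: "commutant S A \<subseteq> bounded_ops S"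
  by (auto simp: commutant_def)

lemma commutant_antimono: "A \<subseteq> B \<Longrightarrow> commutant S B \<subseteq> commutant S A"
  by (auto simp: commutant_def)

lemma bicommutant_incl: "A \<subseteq> bounded_ops S \<Longrightarrow> A \<subseteq> bicommutant S A"
  by (auto simp: commutant_def)

lemma commutant_triple:
  assumes "A \<subseteq> bounded_ops S"
  shows "commutant S (bicommutant S A) = commutant S A"
  using commutant_antimono[OF bicommutant_incl[OF assms]] bicommutant_incl[OF commutant_bounded] by blast

section \<open>Translation operators and group von Neumann algebras\<close>

definition translate :: "'i set \<Rightarrow> ('i \<Rightarrow> 'i) \<Rightarrow> 'i l2_op" where
  "translate S \<pi> = restrict (\<lambda>f x. if x \<in> S then f (\<pi> x) else 0) (l2 S)"

lemma translate_apply: "f \<in> l2 S \<Longrightarrow> translate S \<pi> f = (\<lambda>x. if x \<in> S then f (\<pi> x) else 0)"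
  by (simp add: translate_def)

lemma translate_l2:
  assumes "bij_betw \<pi> S S" "f \<in> l2 S"
  shows "translate S \<pi> f \<in> l2 S" "l2_norm S (translate S \<pi> f) = l2_norm S f"
proof -
  have "(\<lambda>x. (cmod (f (\<pi> x)))\<^sup>2) summable_on S"
    using summable_on_reindex_bij_betw[OF assms(1), of "\<lambda>x. (cmod (f x))\<^sup>2"] l2_summable[OF assms(2)] by simp
  then show "translate S \<pi> f \<in> l2 S"
    using assms by (simp add: translate_apply l2_def cong: summable_on_cong)
  have "(\<Sum>\<^sub>\<infinity>x\<in>S. (cmod (f (\<pi> x)))\<^sup>2) = (\<Sum>\<^sub>\<infinity>x\<in>S. (cmod (f x))\<^sup>2)"
    by (rule infsum_reindex_bij_betw[OF assms(1)])
  then show "l2_norm S (translate S \<pi> f) = l2_norm S f"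
    using assms by (simp add: translate_apply l2_norm_def cong: infsum_cong)
qed

lemma translate_bounded:
  assumes "bij_betw \<pi> S S"
  shows "translate S \<pi> \<in> bounded_ops S"
proof -
  have "translate S \<pi> \<in> l2 S \<rightarrow>\<^sub>E l2 S"
    using translate_l2(1)[OF assms] by (auto simp: translate_def)
  moreover have "\<exists>C. \<forall>f\<in>l2 S. l2_norm S (translate S \<pi> f) \<le> C * l2_norm S f"
    using translate_l2(2)[OF assms] by (intro exI[of _ 1]) simp
  ultimately show ?thesis
    by (auto simp: bounded_ops_def l2_add l2_scale translate_apply)
qed

lemma translate_adjoint:
  assumes "bij_betw \<pi> S S" "bij_betw \<rho> S S" "\<And>x. x \<in> S \<Longrightarrow> \<rho> (\<pi> x) = x"
  shows "is_adjoint S (translate S \<pi>) (translate S \<rho>)"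
  unfolding is_adjoint_def
proof (intro conjI ballI)
  fix f g assume fg: "f \<in> l2 S" "g \<in> l2 S"
  have \<pi>: "\<pi> x \<in> S" if "x \<in> S" for x using assms(1) that by (auto simp: bij_betw_def)
  have "l2_inner S f (translate S \<rho> g) = (\<Sum>\<^sub>\<infinity>x\<in>S. f (\<pi> x) * cnj (translate S \<rho> g (\<pi> x)))"
    unfolding l2_inner_def by (rule infsum_reindex_bij_betw[OF assms(1), symmetric])
  also have "\<dots> = l2_inner S (translate S \<pi> f) g"
    unfolding l2_inner_def using fg assms \<pi> by (intro infsum_cong) (simp add: translate_apply)
  finally show "l2_inner S (translate S \<pi> f) g = l2_inner S f (translate S \<rho> g)" by simp
qed (use assms translate_bounded in auto)

context group
begin

definition right_regular :: "'a \<Rightarrow> 'a l2_op" where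
  "right_regular g = translate (carrier G) (\<lambda>x. x \<otimes> g)"

lemma left_regular_translate: "left_regular G g = translate (carrier G) (\<lambda>x. inv g \<otimes> x)"
  by (simp add: left_regular_def translate_def)

lemma bij_left_mult: "g \<in> carrier G \<Longrightarrow> bij_betw (\<lambda>x. g \<otimes> x) (carrier G) (carrier G)"
  by (rule bij_betw_byWitness[where f' = "\<lambda>x. inv g \<otimes> x"]) (auto simp: m_assoc[symmetric])

lemma bij_right_mult: "g \<in> carrier G \<Longrightarrow> bij_betw (\<lambda>x. x \<otimes> g) (carrier G) (carrier G)"
  by (rule bij_betw_byWitness[where f' = "\<lambda>x. x \<otimes> inv g"]) (auto simp: m_assoc)

lemma regular_bounded [simp]:
  "g \<in> carrier G \<Longrightarrow> left_regular G g \<in> bounded_ops (carrier G)"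
  "g \<in> carrier G \<Longrightarrow> right_regular g \<in> bounded_ops (carrier G)"
  by (auto simp: left_regular_translate right_regular_def intro!: translate_bounded bij_left_mult bij_right_mult)

lemma left_regular_apply:
  "f \<in> l2 (carrier G) \<Longrightarrow> left_regular G g f = (\<lambda>x. if x \<in> carrier G then f (inv g \<otimes> x) else 0)"
  by (simp add: left_regular_def)

lemma right_regular_apply:
  "f \<in> l2 (carrier G) \<Longrightarrow> right_regular g f = (\<lambda>x. if x \<in> carrier G then f (x \<otimes> g) else 0)"
  by (simp add: right_regular_def translate_apply)

lemma left_regular_norm:
  "g \<in> carrier G \<Longrightarrow> f \<in> l2 (carrier G) \<Longrightarrow> l2_norm (carrier G) (left_regular G g f) = l2_norm (carrier G) f"
  by (simp add: left_regular_translate translate_l2 bij_left_mult)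

lemma left_regular_delta:
  assumes "g \<in> carrier G" "x \<in> carrier G"
  shows "left_regular G g (delta x) = delta (g \<otimes> x)"
proof -
  have "inv g \<otimes> y = x \<longleftrightarrow> y = g \<otimes> x" if "y \<in> carrier G" for y
    using assms that by (metis inv_solve_left)
  then show ?thesis
    using assms by (auto simp: left_regular_apply l2_delta fun_eq_iff) (auto simp: delta_def)
qed

lemma right_regular_delta:
  assumes "g \<in> carrier G" "x \<in> carrier G"
  shows "right_regular g (delta x) = delta (x \<otimes> inv g)"
proof -
  have "y \<otimes> g = x \<longleftrightarrow> y = x \<otimes> inv g" if "y \<in> carrier G" for y
    using assms that by (metis inv_solve_right)
  then show ?thesis
    using assms by (auto simp: right_regular_apply l2_delta fun_eq_iff) (auto simp: delta_def)
qed

lemma left_right_commute: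
  assumes "g \<in> carrier G" "h \<in> carrier G"
  shows "op_mult (carrier G) (left_regular G g) (right_regular h)
    = op_mult (carrier G) (right_regular h) (left_regular G g)"
  using assms by (intro op_mult_commuteI) (auto simp: left_regular_delta right_regular_delta m_assoc)

lemma left_regular_inverse:
  assumes "g \<in> carrier G"
  shows "op_mult (carrier G) (left_regular G (inv g)) (left_regular G g) = op_id (carrier G)"
proof
  fix f
  show "op_mult (carrier G) (left_regular G (inv g)) (left_regular G g) f = op_id (carrier G) f"
  proof (cases "f \<in> l2 (carrier G)")
    case True
    then have "left_regular G g f \<in> l2 (carrier G)"
      using assms bounded_ops_l2[OF regular_bounded(1)] by blast
    then show ?thesis
      using True assms
      by (auto simp: op_mult_apply left_regular_apply fun_eq_iff m_assoc[symmetric] l2_outside)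
  qed (simp add: compose_def)
qed

lemma left_regular_adjoint:
  "g \<in> carrier G \<Longrightarrow> is_adjoint (carrier G) (left_regular G g) (left_regular G (inv g))"
  unfolding left_regular_translate
  by (rule translate_adjoint) (auto intro!: bij_left_mult simp: m_assoc[symmetric])

lemma right_regular_adjoint:
  "g \<in> carrier G \<Longrightarrow> is_adjoint (carrier G) (right_regular g) (right_regular (inv g))"
  unfolding right_regular_def
  by (rule translate_adjoint) (auto intro!: bij_right_mult simp: m_assoc)

text \<open>These operators will turn out to be exactly the left convolution operators, that is, the
  elements of the group von Neumann algebra. Membership thereby becomes a condition that can be
  checked on point masses.\<close>

definition right_invariant :: "'a l2_op \<Rightarrow> bool" where
  "right_invariant T \<longleftrightarrow> T \<in> bounded_ops (carrier G) \<and>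
     (\<forall>h\<in>carrier G. op_mult (carrier G) T (right_regular h) = op_mult (carrier G) (right_regular h) T)"

lemma vna_symbol_delta: "vna_symbol G T = T (delta \<one>)"
  by (simp add: vna_symbol_def delta_def)

lemma right_invariant_matrix:
  assumes "right_invariant T" "x \<in> carrier G" "y \<in> carrier G"
  shows "T (delta x) y = vna_symbol G T (y \<otimes> inv x)"
proof -
  have T: "T \<in> bounded_ops (carrier G)" using assms by (simp add: right_invariant_def)
  have "delta x = right_regular (inv x) (delta \<one>)" using assms by (simp add: right_regular_delta)
  then have "T (delta x) = right_regular (inv x) (T (delta \<one>))"
    using assms op_mult_commuteD[of "carrier G" T "right_regular (inv x)" "delta \<one>"]
    by (simp add: right_invariant_def l2_delta)
  then show ?thesis
    using assms bounded_ops_l2[OF T l2_delta[OF one_closed]] by (simp add: right_regular_apply vna_symbol_delta)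
qed

lemma has_sum_left_shift:
  "x \<in> carrier G \<Longrightarrow> (f has_sum s) (carrier G) \<Longrightarrow> ((\<lambda>h. f (h \<otimes> x)) has_sum s) (carrier G)"
  using has_sum_reindex[of "\<lambda>h. h \<otimes> x" "carrier G" f s] bij_right_mult[of x]
  by (simp add: bij_betw_def comp_def)

lemma has_sum_inverse_shift:
  assumes "y \<in> carrier G" "(f has_sum s) (carrier G)"
  shows "((\<lambda>h. f (inv h \<otimes> y)) has_sum s) (carrier G)"
proof -
  have "bij_betw (\<lambda>h. inv h \<otimes> y) (carrier G) (carrier G)"
    by (rule bij_betw_byWitness[where f' = "\<lambda>z. y \<otimes> inv z"])
      (use assms in \<open>auto simp: inv_mult_group m_assoc[symmetric]\<close>, auto simp: m_assoc assms)
  then show ?thesis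
    using has_sum_reindex[of "\<lambda>h. inv h \<otimes> y" "carrier G" f s] assms
    by (simp add: bij_betw_def comp_def)
qed

text \<open>The matrix of \<open>T\<close> is \<open>f (y x\<^sup>-\<^sup>1)\<close> for its symbol \<open>f\<close>, so formally \<open>T\<close> is the sum of
  \<open>f h \<cdot> \<lambda>(h)\<close> over \<open>h \<in> H\<close>, and \<open>S\<close> commutes with each term. That sum need not converge
  in norm; but the matrix coefficients of \<open>T S\<close> and \<open>S T\<close> are sums over the group that become
  equal term by term after the substitutions \<open>z = h x\<close> and \<open>z = h\<^sup>-\<^sup>1 y\<close>.\<close>

lemma symbol_support_commute:
  assumes T: "right_invariant T" and supp: "\<And>x. x \<notin> H \<Longrightarrow> vna_symbol G T x = 0"
    and H: "H \<subseteq> carrier G" and S: "S \<in> commutant (carrier G) (left_regular G ` H)"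
  shows "op_mult (carrier G) T S = op_mult (carrier G) S T"
proof (rule op_mult_commuteI)
  show Tb: "T \<in> bounded_ops (carrier G)" using T by (simp add: right_invariant_def)
  show Sb: "S \<in> bounded_ops (carrier G)" using S by (simp add: commutant_def)
  fix x assume x: "x \<in> carrier G"
  note dx = l2_delta[OF x]
  show "T (S (delta x)) = S (T (delta x))"
  proof
    fix y
    show "T (S (delta x)) y = S (T (delta x)) y"
    proof (cases "y \<in> carrier G")
      case y: True
      have "((\<lambda>z. T (delta x) z * S (delta z) y) has_sum S (T (delta x)) y) (carrier G)"
        by (rule bounded_ops_has_sum[OF Sb bounded_ops_l2[OF Tb dx]])
      from has_sum_left_shift[OF x this]
      have 1: "((\<lambda>h. T (delta x) (h \<otimes> x) * S (delta (h \<otimes> x)) y) has_sum S (T (delta x)) y) (carrier G)" .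
      have "((\<lambda>z. S (delta x) z * T (delta z) y) has_sum T (S (delta x)) y) (carrier G)"
        by (rule bounded_ops_has_sum[OF Tb bounded_ops_l2[OF Sb dx]])
      from has_sum_inverse_shift[OF y this]
      have 2: "((\<lambda>h. S (delta x) (inv h \<otimes> y) * T (delta (inv h \<otimes> y)) y) has_sum T (S (delta x)) y) (carrier G)" .
      have "T (delta x) (h \<otimes> x) * S (delta (h \<otimes> x)) y = S (delta x) (inv h \<otimes> y) * T (delta (inv h \<otimes> y)) y"
        if h: "h \<in> carrier G" for h
      proof -
        have 3: "T (delta x) (h \<otimes> x) = vna_symbol G T h"
          using right_invariant_matrix[OF T x, of "h \<otimes> x"] h x by (simp add: m_assoc)
        have 4: "T (delta (inv h \<otimes> y)) y = vna_symbol G T h"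
          using right_invariant_matrix[OF T _ y, of "inv h \<otimes> y"] h y
          by (simp add: inv_mult_group m_assoc[symmetric])
        show ?thesis
        proof (cases "h \<in> H")
          case True
          have "S (left_regular G h (delta x)) = left_regular G h (S (delta x))"
            using op_mult_commuteD[OF commutantD[OF S]] True dx by blast
          then have "S (delta (h \<otimes> x)) y = S (delta x) (inv h \<otimes> y)"
            using h x y bounded_ops_l2[OF Sb dx] by (simp add: left_regular_delta left_regular_apply)
          then show ?thesis using 3 4 by simp
        qed (use supp 3 4 in simp)
      qed
      then have "((\<lambda>h. S (delta x) (inv h \<otimes> y) * T (delta (inv h \<otimes> y)) y) has_sum S (T (delta x)) y) (carrier G)"
        using 1 by (simp cong: has_sum_cong)
      then show ?thesis using 2 has_sum_unique by blast
    next
      case False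
      then show ?thesis
        using bounded_op_zero_outside Tb Sb bounded_ops_l2[OF Tb dx] bounded_ops_l2[OF Sb dx] by metis
    qed
  qed
qed

lemma symbol_outside: "T \<in> bounded_ops (carrier G) \<Longrightarrow> x \<notin> carrier G \<Longrightarrow> vna_symbol G T x = 0"
  unfolding vna_symbol_delta by (rule bounded_op_zero_outside) (auto intro: l2_delta)

text \<open>The commutation theorem for the regular representations: the double commutant of the left
  translations is the commutant of the right translations.\<close>

lemma group_vna_iff: "T \<in> group_vna G \<longleftrightarrow> right_invariant T"
proof
  assume T: "T \<in> group_vna G"
  have "right_regular h \<in> commutant (carrier G) (left_regular G ` carrier G)" if "h \<in> carrier G" for h
    using that by (intro commutantI) (auto simp: left_right_commute)
  then show "right_invariant T"
    using T unfolding group_vna_def right_invariant_def by (auto simp: commutant_def)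
next
  assume T: "right_invariant T"
  then have Tb: "T \<in> bounded_ops (carrier G)" by (simp add: right_invariant_def)
  show "T \<in> group_vna G"
    unfolding group_vna_def
    by (rule commutantI[OF Tb], rule symbol_support_commute[OF T symbol_outside[OF Tb] subset_refl])
qed

lemma left_regular_in_vna: "g \<in> carrier G \<Longrightarrow> left_regular G g \<in> group_vna G"
  by (simp add: group_vna_iff right_invariant_def left_right_commute)

lemma vna_symbol_left_regular: "g \<in> carrier G \<Longrightarrow> vna_symbol G (left_regular G g) = delta g"
  by (simp add: vna_symbol_delta left_regular_delta)

lemma adjoint_in_vna:
  assumes "T \<in> group_vna G" "is_adjoint (carrier G) T T'"
  shows "T' \<in> group_vna G"
  unfolding group_vna_iff right_invariant_def
proof (intro conjI ballI)
  show "T' \<in> bounded_ops (carrier G)" using assms by (simp add: is_adjoint_def)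
  fix h assume h: "h \<in> carrier G"
  show "op_mult (carrier G) T' (right_regular h) = op_mult (carrier G) (right_regular h) T'"
    using assms h adjoint_commute[OF assms(2) right_regular_adjoint[of "inv h"]]
    by (simp add: group_vna_iff right_invariant_def)
qed

lemma adjoint_symbol:
  assumes T: "T \<in> group_vna G" and adj: "is_adjoint (carrier G) T T'" and x: "x \<in> carrier G"
  shows "vna_symbol G T' x = cnj (vna_symbol G T (inv x))"
proof -
  have "l2_inner (carrier G) (T (delta x)) (delta \<one>) = l2_inner (carrier G) (delta x) (T' (delta \<one>))"
    using adj x by (auto simp: is_adjoint_def l2_delta)
  then have "T (delta x) \<one> = cnj (vna_symbol G T' x)"
    using x by (simp add: l2_inner_delta_left l2_inner_delta_right vna_symbol_delta)
  moreover have "T (delta x) \<one> = vna_symbol G T (inv x)"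
    using T x right_invariant_matrix[of T x \<one>] by (simp add: group_vna_iff)
  ultimately show ?thesis by simp
qed

context
  fixes H
  assumes H: "subgroup H G"
begin

lemma H_sub: "H \<subseteq> carrier G"
  using H by (simp add: subgroup.subset)

lemma subgroup_vna_iff:
  "T \<in> subgroup_vna G H \<longleftrightarrow> right_invariant T \<and> (\<forall>x. x \<notin> H \<longrightarrow> vna_symbol G T x = 0)"
  by (simp add: subgroup_vna_def group_vna_iff)

lemma subgroup_vna_bounded: "subgroup_vna G H \<subseteq> bounded_ops (carrier G)"
  by (auto simp: subgroup_vna_iff right_invariant_def)

lemma left_regular_in_subgroup_vna: "h \<in> H \<Longrightarrow> left_regular G h \<in> subgroup_vna G H"
  using H_sub left_regular_in_vna vna_symbol_left_regular[of h]
  by (auto simp: subgroup_vna_def delta_def subset_iff)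

lemma subgroup_vna_commute:
  "T \<in> subgroup_vna G H \<Longrightarrow> S \<in> commutant (carrier G) (left_regular G ` H) \<Longrightarrow>
    op_mult (carrier G) T S = op_mult (carrier G) S T"
  by (rule symbol_support_commute[OF _ _ H_sub]) (auto simp: subgroup_vna_iff)

text \<open>The orthogonal projection of \<open>\<ell>\<^sup>2(G)\<close> onto \<open>\<ell>\<^sup>2(H)\<close>.\<close>

definition subgroup_projection :: "'a l2_op" where
  "subgroup_projection = restrict (cutoff H) (l2 (carrier G))"

lemma subgroup_projection_bounded: "subgroup_projection \<in> bounded_ops (carrier G)"
proof -
  have "subgroup_projection \<in> l2 (carrier G) \<rightarrow>\<^sub>E l2 (carrier G)"
    by (auto simp: subgroup_projection_def l2_cutoff)
  moreover have "\<exists>C. \<forall>f\<in>l2 (carrier G). l2_norm (carrier G) (subgroup_projection f) \<le> C * l2_norm (carrier G) f"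
    by (intro exI[of _ 1]) (auto simp: subgroup_projection_def l2_cutoff)
  ultimately show ?thesis
    by (auto simp: bounded_ops_def l2_add l2_scale subgroup_projection_def)
qed

text \<open>An operator whose symbol lives on \<open>H\<close> maps functions on a right coset \<open>H x\<close> to functions
  on the same coset.\<close>

lemma subgroup_projection_commute:
  assumes T: "T \<in> subgroup_vna G H"
  shows "op_mult (carrier G) subgroup_projection T = op_mult (carrier G) T subgroup_projection"
proof (rule op_mult_commuteI)
  have inv: "right_invariant T" and supp: "\<And>x. x \<notin> H \<Longrightarrow> vna_symbol G T x = 0"
    using T by (auto simp: subgroup_vna_iff)
  show Tb: "T \<in> bounded_ops (carrier G)" using inv by (simp add: right_invariant_def)
  fix x assume x: "x \<in> carrier G"
  note Tx = bounded_ops_l2[OF Tb l2_delta[OF x]]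
  have Tsupp: "T (delta x) y = 0" if "y \<otimes> inv x \<notin> H" for y
    using that right_invariant_matrix[OF inv x] supp Tx l2_outside by (cases "y \<in> carrier G") auto
  have p: "subgroup_projection (delta x) = (if x \<in> H then delta x else (\<lambda>y. 0))"
    using l2_delta[OF x] by (simp add: subgroup_projection_def) (auto simp: delta_def)
  have T0: "T (\<lambda>y. 0) = (\<lambda>y. 0)" using bounded_ops_scale[OF Tb l2_zero(1), of 0] by simp
  \<comment> \<open>within one right coset of \<open>H\<close>, either both points lie in \<open>H\<close> or none does\<close>
  have mem: "y \<otimes> inv x \<in> H \<longleftrightarrow> (x \<in> H \<longleftrightarrow> y \<in> H)" if "x \<in> H \<or> y \<in> H" "y \<in> carrier G" for y
  proof -
    have "y \<otimes> inv x \<in> H" if "x \<in> H" "y \<in> H"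
      using that H by (simp add: subgroup.m_closed subgroup.m_inv_closed)
    moreover have "y \<in> H" if "y \<otimes> inv x \<in> H" "x \<in> H"
      using subgroup.m_closed[OF H that] x \<open>y \<in> carrier G\<close> by (simp add: m_assoc)
    moreover have "x \<in> H" if *: "y \<otimes> inv x \<in> H" "y \<in> H"
    proof -
      have "inv (y \<otimes> inv x) \<otimes> y = x"
        using x \<open>y \<in> carrier G\<close> by (simp add: inv_mult_group m_assoc)
      then show ?thesis using subgroup.m_closed[OF H subgroup.m_inv_closed[OF H *(1)] *(2)] by simp
    qed
    ultimately show ?thesis using that by blast
  qed
  have "cutoff H (T (delta x)) y = (if x \<in> H then T (delta x) y else 0)" for y
  proof (cases "y \<in> carrier G")
    case True
    then show ?thesis using mem[OF _ True] Tsupp[of y] by auto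
  qed (use l2_outside[OF Tx] in simp)
  moreover have "subgroup_projection (T (delta x)) = cutoff H (T (delta x))"
    using Tx by (simp add: subgroup_projection_def)
  ultimately show "subgroup_projection (T (delta x)) = T (subgroup_projection (delta x))"
    using T0 by (auto simp: p fun_eq_iff)
qed (rule subgroup_projection_bounded)

text \<open>The projection onto \<open>\<ell>\<^sup>2(H)\<close> belongs to the commutant; an operator commuting with it maps
  the point mass at the identity, which lives on \<open>H\<close>, to a symbol that lives on \<open>H\<close>.\<close>

lemma subgroup_vna_bicommutant:
  "bicommutant (carrier G) (subgroup_vna G H) = subgroup_vna G H"
proof
  show "subgroup_vna G H \<subseteq> bicommutant (carrier G) (subgroup_vna G H)"
    by (rule bicommutant_incl[OF subgroup_vna_bounded])
  show "bicommutant (carrier G) (subgroup_vna G H) \<subseteq> subgroup_vna G H"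
  proof
    fix T assume T: "T \<in> bicommutant (carrier G) (subgroup_vna G H)"
    have "bicommutant (carrier G) (subgroup_vna G H) \<subseteq> bicommutant (carrier G) (group_vna G)"
      by (intro commutant_antimono) (auto simp: subgroup_vna_def)
    also have "\<dots> = group_vna G"
      unfolding group_vna_def by (rule commutant_triple[OF commutant_bounded])
    finally have M: "T \<in> group_vna G" using T by blast
    have "subgroup_projection \<in> commutant (carrier G) (subgroup_vna G H)"
      by (intro commutantI subgroup_projection_bounded subgroup_projection_commute)
    then have "T (subgroup_projection (delta \<one>)) = subgroup_projection (T (delta \<one>))"
      by (intro op_mult_commuteD[OF commutantD[OF T]] l2_delta) auto
    moreover have "subgroup_projection (delta \<one>) = delta \<one>"
      using subgroup.one_closed[OF H] l2_delta[OF one_closed]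
      by (simp add: subgroup_projection_def) (auto simp: delta_def)
    moreover have "T (delta \<one>) \<in> l2 (carrier G)"
      using T by (intro bounded_ops_l2[of T] l2_delta) (auto simp: commutant_def)
    ultimately have "vna_symbol G T = cutoff H (vna_symbol G T)"
      by (simp add: vna_symbol_delta subgroup_projection_def)
    then have "vna_symbol G T x = 0" if "x \<notin> H" for x
      using that by (metis cutoff_apply)
    then show "T \<in> subgroup_vna G H" using M by (simp add: subgroup_vna_def)
  qed
qed

lemma subgroup_vna_von_neumann: "von_neumann_algebra (carrier G) (subgroup_vna G H)"
  unfolding von_neumann_algebra_def
proof (intro conjI ballI subgroup_vna_bounded subgroup_vna_bicommutant)
  fix T assume T: "T \<in> subgroup_vna G H"
  then obtain T' where T': "is_adjoint (carrier G) T T'"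
    using ex_adjoint subgroup_vna_bounded by blast
  have M: "T \<in> group_vna G" using T by (simp add: subgroup_vna_def)
  have "vna_symbol G T' x = 0" if x: "x \<notin> H" for x
  proof (cases "x \<in> carrier G")
    case True
    then have "inv x \<notin> H" using x subgroup.m_inv_closed[OF H, of "inv x"] by auto
    then show ?thesis using adjoint_symbol[OF M T' True] T by (simp add: subgroup_vna_iff)
  next
    case False
    then show ?thesis using T' by (intro symbol_outside) (auto simp: is_adjoint_def)
  qed
  then have "T' \<in> subgroup_vna G H" using adjoint_in_vna[OF M T'] by (simp add: subgroup_vna_def)
  then show "\<exists>T'\<in>subgroup_vna G H. is_adjoint (carrier G) T T'" using T' by blast
qed

context
  assumes H_commute: "\<And>g h. g \<in> H \<Longrightarrow> h \<in> H \<Longrightarrow> g \<otimes> h = h \<otimes> g"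
begin

lemma subgroup_vna_in_left_commutant:
  assumes "T \<in> subgroup_vna G H"
  shows "T \<in> commutant (carrier G) (left_regular G ` H)"
proof (rule commutantI)
  show "T \<in> bounded_ops (carrier G)" using assms subgroup_vna_bounded by blast
  fix B assume "B \<in> left_regular G ` H"
  moreover have "left_regular G h \<in> commutant (carrier G) (left_regular G ` H)" if "h \<in> H" for h
    using that H_sub H_commute
    by (intro commutantI op_mult_commuteI)
      (auto simp: left_regular_delta m_assoc[symmetric] subset_iff)
  ultimately show "op_mult (carrier G) T B = op_mult (carrier G) B T"
    using subgroup_vna_commute[OF assms] by blast
qed

lemma subgroup_vna_abelian: "abelian_vn_subalgebra (carrier G) (subgroup_vna G H) (group_vna G)"
  unfolding abelian_vn_subalgebra_def
proof (intro conjI ballI subgroup_vna_von_neumann)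
  show "subgroup_vna G H \<subseteq> group_vna G" by (simp add: subgroup_vna_def)
  show "op_mult (carrier G) T R = op_mult (carrier G) R T"
    if "T \<in> subgroup_vna G H" "R \<in> subgroup_vna G H" for T R
    using subgroup_vna_commute[OF that(1) subgroup_vna_in_left_commutant[OF that(2)]] .
qed

context
  assumes avoid: "\<And>F. finite F \<Longrightarrow> F \<subseteq> carrier G - H \<Longrightarrow>
    \<exists>h\<in>H. \<forall>s\<in>F. \<forall>t\<in>F. s \<otimes> h \<otimes> t \<notin> H"
begin

text \<open>The level set of the value \<open>f x \<noteq> 0\<close> is finite and contains all \<open>H\<close>-conjugates of \<open>x\<close>. If
  \<open>h x h\<^sup>-\<^sup>1 = y\<close>, then \<open>y\<^sup>-\<^sup>1 h x = h \<in> H\<close>, so an \<open>h\<close> that avoids \<open>H\<close> for the inverses of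
  the points of the level set outside \<open>H\<close> on the left and \<open>x\<close> on the right moves \<open>x\<close> out of the level set.\<close>

lemma l2_conj_invariant_support:
  assumes f: "f \<in> l2 (carrier G)"
    and conj: "\<And>h x. h \<in> H \<Longrightarrow> x \<in> carrier G \<Longrightarrow> f (h \<otimes> x \<otimes> inv h) = f x"
    and x: "x \<in> carrier G" "x \<notin> H"
  shows "f x = 0"
proof (rule ccontr)
  assume nz: "f x \<noteq> 0"
  define E where "E = {y \<in> carrier G. f y = f x}"
  have "finite E"
  proof (rule ccontr)
    assume inf: "infinite E"
    obtain n :: nat where n: "(l2_norm (carrier G) f)\<^sup>2 < of_nat n * (cmod (f x))\<^sup>2"
      using nz ex_less_of_nat_mult[of "(cmod (f x))\<^sup>2"] by auto
    obtain D where D: "finite D" "card D = n" "D \<subseteq> E"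
      using infinite_arbitrarily_large[OF inf] by blast
    have "of_nat n * (cmod (f x))\<^sup>2 = (\<Sum>y\<in>D. (cmod (f y))\<^sup>2)"
      using D by (simp add: E_def subset_iff)
    also have "\<dots> \<le> (l2_norm (carrier G) f)\<^sup>2"
      unfolding l2_norm_sq using D l2_summable[OF f]
      by (intro finite_sum_le_infsum) (auto simp: E_def)
    finally show False using n by simp
  qed
  define F where "F = insert x ((\<lambda>y. inv y) ` (E - H))"
  have "inv y \<notin> H" if "y \<in> E - H" for y
    using that subgroup.m_inv_closed[OF H, of "inv y"] by (auto simp: E_def)
  then have F: "finite F" "F \<subseteq> carrier G - H" using \<open>finite E\<close> x by (auto simp: F_def E_def)
  then obtain h where h: "h \<in> H" "\<And>s t. s \<in> F \<Longrightarrow> t \<in> F \<Longrightarrow> s \<otimes> h \<otimes> t \<notin> H"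
    using avoid[OF F] by blast
  have hc: "h \<in> carrier G" using h H_sub by blast
  let ?y = "h \<otimes> x \<otimes> inv h"
  have "inv ?y \<otimes> h \<otimes> x = h"
    using hc x by (simp add: inv_mult_group m_assoc)
  moreover have "?y \<in> E" using conj[OF h(1) x(1)] x hc by (simp add: E_def)
  moreover have "?y \<notin> H"
  proof
    assume "?y \<in> H"
    then have "inv h \<otimes> ?y \<otimes> h \<in> H"
      using h(1) by (simp add: subgroup.m_closed[OF H] subgroup.m_inv_closed[OF H] del: m_closed)
    moreover have "inv h \<otimes> ?y \<otimes> h = x"
      using hc x by (simp add: m_assoc) (simp add: m_assoc[symmetric])
    ultimately show False using x by simp
  qed
  ultimately show False using h(2)[of "inv ?y" x] h(1) by (simp add: F_def)
qed

theorem subgroup_vna_masa: "masa (carrier G) (subgroup_vna G H) (group_vna G)"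
  unfolding masa_def
proof (intro conjI allI impI subgroup_vna_abelian)
  fix B assume B: "abelian_vn_subalgebra (carrier G) B (group_vna G) \<and> subgroup_vna G H \<subseteq> B"
  have "T \<in> subgroup_vna G H" if "T \<in> B" for T
  proof -
    have M: "T \<in> group_vna G" using that B by (auto simp: abelian_vn_subalgebra_def)
    then have inv: "right_invariant T" by (simp add: group_vna_iff)
    then have Tb: "T \<in> bounded_ops (carrier G)" by (simp add: right_invariant_def)
    have l2: "vna_symbol G T \<in> l2 (carrier G)"
      unfolding vna_symbol_delta by (intro bounded_ops_l2[OF Tb] l2_delta) auto
    have conj: "vna_symbol G T (h \<otimes> x \<otimes> inv h) = vna_symbol G T x"
      if h: "h \<in> H" and x: "x \<in> carrier G" for h x
    proof -
      have hc: "h \<in> carrier G" using h H_sub by blast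
      have "op_mult (carrier G) T (left_regular G h) = op_mult (carrier G) (left_regular G h) T"
        using B \<open>T \<in> B\<close> left_regular_in_subgroup_vna[OF h] unfolding abelian_vn_subalgebra_def by blast
      then have "T (left_regular G h (delta \<one>)) = left_regular G h (T (delta \<one>))"
        by (rule op_mult_commuteD) (auto intro: l2_delta)
      then have "T (delta h) = left_regular G h (vna_symbol G T)"
        using hc by (simp add: left_regular_delta vna_symbol_delta)
      then have "T (delta h) (h \<otimes> x) = vna_symbol G T (inv h \<otimes> (h \<otimes> x))"
        using hc x l2 by (simp add: left_regular_apply)
      also have "inv h \<otimes> (h \<otimes> x) = x" using hc x by (simp add: m_assoc[symmetric])
      finally show ?thesis using right_invariant_matrix[OF inv hc, of "h \<otimes> x"] hc x by simp
    qed
    have "vna_symbol G T x = 0" if "x \<notin> H" for x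
      using l2_conj_invariant_support[OF l2 conj _ that] symbol_outside[OF Tb] by (cases "x \<in> carrier G") auto
    then show ?thesis using M by (simp add: subgroup_vna_def)
  qed
  then show "B = subgroup_vna G H" using B by blast
qed

text \<open>The function \<open>v \<delta>\<^bsub>ht\<^esub>\<close> is the symbol of \<open>v\<close> translated by \<open>h t\<close>. Its values on \<open>H\<close> are the
  values of the symbol on the coset \<open>H t\<^sup>-\<^sup>1 h\<^sup>-\<^sup>1\<close>, and the hypotheses imply that this coset misses
  \<open>E\<close>.\<close>

lemma coset_translate_small:
  assumes v: "v \<in> group_vna G" and h: "h \<in> H" and t: "t \<in> carrier G" "t \<notin> H"
    and E: "E \<subseteq> carrier G" "\<And>s. s \<in> E - H \<Longrightarrow> s \<otimes> h \<otimes> t \<notin> H"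
  shows "l2_norm (carrier G) (cutoff H (v (delta (h \<otimes> t))))
    \<le> l2_norm (carrier G) (cutoff (- E) (vna_symbol G v))"
proof -
  have inv: "right_invariant v" using v by (simp add: group_vna_iff)
  then have vb: "v \<in> bounded_ops (carrier G)" by (simp add: right_invariant_def)
  have hc: "h \<in> carrier G" using h H_sub by blast
  have sym: "vna_symbol G v \<in> l2 (carrier G)"
    unfolding vna_symbol_delta by (intro bounded_ops_l2[OF vb] l2_delta) auto
  let ?\<psi> = "translate (carrier G) (\<lambda>y. y \<otimes> inv (h \<otimes> t)) (cutoff (- E) (vna_symbol G v))"
  have bij: "bij_betw (\<lambda>y. y \<otimes> inv (h \<otimes> t)) (carrier G) (carrier G)"
    using hc t by (intro bij_right_mult) auto
  have "y \<otimes> inv (h \<otimes> t) \<notin> E" if y: "y \<in> H" for y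
  proof
    assume *: "y \<otimes> inv (h \<otimes> t) \<in> E"
    define s where "s = y \<otimes> inv (h \<otimes> t)"
    have yc: "y \<in> carrier G" and sc: "s \<in> carrier G" using y H_sub hc t by (auto simp: s_def)
    have st: "s \<otimes> (h \<otimes> t) = y" using yc hc t by (simp add: s_def m_assoc)
    have "s \<in> H"
      using E(2)[of s] * st y sc hc t by (auto simp: s_def[symmetric] m_assoc)
    then have "inv h \<otimes> (inv s \<otimes> y) \<in> H"
      using h y by (intro subgroup.m_closed[OF H] subgroup.m_inv_closed[OF H])
    moreover have "inv h \<otimes> (inv s \<otimes> y) = t"
      using sc hc t by (simp add: st[symmetric] m_assoc[symmetric])
    ultimately show False using t by simp
  qed
  then have "cmod (cutoff H (v (delta (h \<otimes> t))) y) \<le> cmod (?\<psi> y)" if "y \<in> carrier G" for y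
    using that right_invariant_matrix[OF inv _ that, of "h \<otimes> t"] hc t sym
    by (simp add: translate_apply l2_cutoff)
  then have "l2_norm (carrier G) (cutoff H (v (delta (h \<otimes> t)))) \<le> l2_norm (carrier G) ?\<psi>"
    using H_sub by (intro l2_dominated(2) translate_l2(1)[OF bij] l2_cutoff sym) auto
  also have "\<dots> = l2_norm (carrier G) (cutoff (- E) (vna_symbol G v))"
    by (rule translate_l2(2)[OF bij l2_cutoff(1)[OF sym]])
  finally show ?thesis .
qed

text \<open>With \<open>v = u*\<close> and \<open>W = v \<lambda>(h)\<close>, the function \<open>W f\<close> is the symbol of the
  element \<open>u* \<lambda>(h) u\<close> of the subalgebra, so it lives on \<open>H\<close> and has norm 1. Split \<open>f\<close> into its
  part on \<open>H\<close>, a finitely supported part \<open>k\<close> off \<open>H\<close> and a small rest \<open>r\<close>. As \<open>W\<close> is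
  isometric, the first and the last part contribute at most their own norms, and a suitable choice of
  \<open>h\<close> makes the contribution of \<open>k\<close> on \<open>H\<close> small.\<close>

lemma normalizer_in_subgroup_vna:
  assumes u: "u \<in> normalizer (carrier G) (subgroup_vna G H) (group_vna G)"
  shows "u \<in> subgroup_vna G H"
proof -
  let ?N = "l2_norm (carrier G)"
  obtain v where adj: "is_adjoint (carrier G) u v"
    and vu: "op_mult (carrier G) v u = op_id (carrier G)"
    and uv: "op_mult (carrier G) u v = op_id (carrier G)"
    and img: "(\<lambda>T. op_mult (carrier G) v (op_mult (carrier G) T u)) ` subgroup_vna G H = subgroup_vna G H"
    using u unfolding normalizer_def by blast
  have uM: "u \<in> group_vna G" using u by (simp add: normalizer_def)
  have vM: "v \<in> group_vna G" by (rule adjoint_in_vna[OF uM adj])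
  have ub: "u \<in> bounded_ops (carrier G)" and vb: "v \<in> bounded_ops (carrier G)"
    using adj by (auto simp: is_adjoint_def)
  have inner: "l2_inner (carrier G) (u f) g = l2_inner (carrier G) f (v g)"
    if "f \<in> l2 (carrier G)" "g \<in> l2 (carrier G)" for f g
    using adj that by (auto simp: is_adjoint_def)
  have d1: "delta \<one> \<in> l2 (carrier G)" by (rule l2_delta[OF one_closed])
  have v_iso: "?N (v g) = ?N g" if g: "g \<in> l2 (carrier G)" for g
  proof -
    have "u (v g) = g" using fun_cong[OF uv, of g] g by (simp add: op_mult_apply)
    then have "l2_inner (carrier G) (v g) (v g) = l2_inner (carrier G) g g"
      using inner[OF bounded_ops_l2[OF vb g] g] by simp
    then have "(?N (v g))\<^sup>2 = (?N g)\<^sup>2"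
      using g bounded_ops_l2[OF vb g] by (simp add: l2_inner_self flip: of_real_power)
    then show ?thesis by simp
  qed
  define f where "f = vna_symbol G u"
  have f: "f = u (delta \<one>)" "f \<in> l2 (carrier G)"
    unfolding f_def vna_symbol_delta using bounded_ops_l2[OF ub d1] by auto
  have "v f = delta \<one>" using fun_cong[OF vu, of "delta \<one>"] d1 f by (simp add: op_mult_apply)
  then have "l2_inner (carrier G) f f = 1"
    using inner[OF d1 f(2)] f by (simp add: l2_inner_delta_left) (simp add: delta_def)
  then have f_norm: "(?N f)\<^sup>2 = 1"
    using f by (simp add: l2_inner_self flip: of_real_power)
  define \<phi> where "\<phi> = vna_symbol G v"
  have \<phi>: "\<phi> \<in> l2 (carrier G)" unfolding \<phi>_def vna_symbol_delta by (rule bounded_ops_l2[OF vb d1])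
  have "1 \<le> ?N (cutoff H f) + e" if e: "e > 0" for e
  proof -
    have f1: "cutoff (- H) f \<in> l2 (carrier G)" by (rule l2_cutoff(1)[OF f(2)])
    obtain F where F: "finite F" "F \<subseteq> carrier G" "?N (cutoff (- F) (cutoff (- H) f)) \<le> e / 2"
      using l2_tail_small[OF f1, of "e / 2"] e by (metis half_gt_zero subset_refl)
    define C where "C = (\<Sum>t\<in>F - H. cmod (f t))"
    \<comment> \<open>\<open>M\<close> replaces \<open>C\<close> as a denominator since \<open>C = 0\<close> is possible\<close>
    define M where "M = C + 1"
    have C: "C \<le> M" "M > 0" by (auto simp: M_def C_def sum_nonneg add_nonneg_pos)
    define d where "d = e / 2 / M"
    have d: "d > 0" using e C by (simp add: d_def)
    obtain E where E: "finite E" "E \<subseteq> carrier G" "?N (cutoff (- E) \<phi>) \<le> d"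
      using l2_tail_small[OF \<phi> d] by (metis subset_refl)
    have "finite ((F - H) \<union> (E - H))" "(F - H) \<union> (E - H) \<subseteq> carrier G - H" using E F by auto
    then obtain h where h: "h \<in> H" "\<And>s t. s \<in> E - H \<Longrightarrow> t \<in> F - H \<Longrightarrow> s \<otimes> h \<otimes> t \<notin> H"
      using avoid[of "(F - H) \<union> (E - H)"] by blast
    have hc: "h \<in> carrier G" using h H_sub by blast
    define W where "W = op_mult (carrier G) v (left_regular G h)"
    have Wb: "W \<in> bounded_ops (carrier G)" unfolding W_def using vb hc by (intro bounded_ops_mult) auto
    have W_iso: "?N (W g) = ?N g" "W g \<in> l2 (carrier G)" if "g \<in> l2 (carrier G)" for g
      using that hc v_iso[of "left_regular G h g"] bounded_ops_l2[OF regular_bounded(1)[OF hc] that]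
        bounded_ops_l2[OF Wb that]
      by (auto simp: W_def op_mult_apply left_regular_norm)
    have W_delta: "W (delta t) = v (delta (h \<otimes> t))" if "t \<in> carrier G" for t
      using that hc by (simp add: W_def op_mult_apply l2_delta left_regular_delta)
    have supp: "W f y = 0" if "y \<notin> H" for y
    proof -
      have "op_mult (carrier G) v (op_mult (carrier G) (left_regular G h) u) \<in> subgroup_vna G H"
        using img left_regular_in_subgroup_vna[OF h(1)] by blast
      moreover have "vna_symbol G (op_mult (carrier G) v (op_mult (carrier G) (left_regular G h) u)) = W f"
        using d1 f by (simp add: vna_symbol_delta op_mult_apply W_def)
      ultimately show ?thesis using that by (simp add: subgroup_vna_iff)
    qed
    define k where "k = cutoff F (cutoff (- H) f)"
    define r where "r = cutoff (- F) (cutoff (- H) f)"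
    have kr: "k \<in> l2 (carrier G)" "r \<in> l2 (carrier G)" "cutoff H f \<in> l2 (carrier G)"
      unfolding k_def r_def using f1 f by (auto intro: l2_cutoff(1))
    have split: "f = (\<lambda>x. cutoff H f x + (k x + r x))" by (auto simp: k_def r_def)
    have "W f = (\<lambda>y. W (cutoff H f) y + (W k y + W r y))"
      using bounded_ops_add[OF Wb kr(3) l2_add(1)[OF kr(1,2)]] bounded_ops_add[OF Wb kr(1,2)] split by simp
    then have Wf: "W f = (\<lambda>y. cutoff H (W (cutoff H f)) y + (cutoff H (W k) y + cutoff H (W r) y))"
      using supp by (auto simp: fun_eq_iff)
    have k_small: "?N (cutoff H (W k)) \<le> e / 2"
    proof -
      have "W k y = (\<Sum>t\<in>F. cutoff (- H) f t * W (delta t) y)" for y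
        unfolding k_def
        by (rule functional_finite[where \<Phi> = "\<lambda>f. W f y"])
          (use Wb F f1 in \<open>auto simp: bounded_ops_add bounded_ops_scale\<close>)
      also have "(\<Sum>t\<in>F. cutoff (- H) f t * W (delta t) y) = (\<Sum>t\<in>F - H. f t * W (delta t) y)" for y
        using F by (intro sum.mono_neutral_cong_right) auto
      finally have Wk: "cutoff H (W k) = (\<lambda>y. \<Sum>t\<in>F - H. f t * cutoff H (W (delta t)) y)"
        by (auto simp: fun_eq_iff)
      have "?N (cutoff H (W k)) \<le> (\<Sum>t\<in>F - H. cmod (f t) * ?N (cutoff H (W (delta t))))"
        unfolding Wk using F by (intro l2_sum(2) l2_cutoff(1) W_iso(2) l2_delta) auto
      also have "\<dots> \<le> (\<Sum>t\<in>F - H. cmod (f t) * d)"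
      proof (intro sum_mono mult_left_mono)
        fix t assume t: "t \<in> F - H"
        then have "?N (cutoff H (v (delta (h \<otimes> t)))) \<le> ?N (cutoff (- E) \<phi>)"
          unfolding \<phi>_def using F E h by (intro coset_translate_small[OF vM h(1)]) auto
        then show "?N (cutoff H (W (delta t))) \<le> d"
          using E(3) t F W_delta[of t] by auto
      qed auto
      also have "\<dots> = C * d" by (simp add: C_def sum_distrib_right)
      also have "\<dots> \<le> M * d" using d C by (intro mult_right_mono) auto
      also have "\<dots> = e / 2" using C by (simp add: d_def)
      finally show ?thesis .
    qed
    have cut_le: "?N (cutoff H (W g)) \<le> ?N g" if "g \<in> l2 (carrier G)" for g
      using l2_cutoff(2)[OF W_iso(2)[OF that]] W_iso(1)[OF that] by simp
    have cut_l2: "cutoff H (W g) \<in> l2 (carrier G)" if "g \<in> l2 (carrier G)" for g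
      by (rule l2_cutoff(1)[OF W_iso(2)[OF that]])
    have "1 = ?N f" using f_norm l2_norm_nonneg[of "carrier G" f] unfolding power2_eq_1_iff by linarith
    also have "\<dots> = ?N (W f)" using W_iso f by simp
    also have "\<dots> \<le> ?N (cutoff H (W (cutoff H f))) + (?N (cutoff H (W k)) + ?N (cutoff H (W r)))"
      unfolding Wf
      using l2_add(2)[OF cut_l2[OF kr(3)] l2_add(1)[OF cut_l2[OF kr(1)] cut_l2[OF kr(2)]]]
        l2_add(2)[OF cut_l2[OF kr(1)] cut_l2[OF kr(2)]] by linarith
    also have "\<dots> \<le> ?N (cutoff H f) + (e / 2 + e / 2)"
      using cut_le[OF kr(3)] k_small cut_le[OF kr(2)] F(3) by (simp add: r_def)
    finally show ?thesis by simp
  qed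
  then have ge: "1 \<le> ?N (cutoff H f)" by (rule field_le_epsilon)
  \<comment> \<open>the part of \<open>f\<close> on \<open>H\<close> has full norm, so no mass is left at a point outside\<close>
  have "f x = 0" if x: "x \<notin> H" for x
  proof (cases "x \<in> carrier G")
    case True
    have "?N (cutoff H f) = ?N (cutoff H (cutoff (- {x}) f))"
      using x by (intro arg_cong[where f = "?N"]) auto
    also have "\<dots> \<le> ?N (cutoff (- {x}) f)" by (rule l2_cutoff(2)[OF l2_cutoff(1)[OF f(2)]])
    finally have "1 \<le> (?N (cutoff (- {x}) f))\<^sup>2" using ge by (simp add: one_le_power)
    also have "\<dots> \<le> 1 - (cmod (f x))\<^sup>2"
      using l2_norm_cutoff_finite[OF f(2), of "{x}"] True f_norm by simp
    finally show ?thesis by simp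
  qed (use l2_outside[OF f(2)] in simp)
  then show ?thesis using uM by (simp add: subgroup_vna_def f_def)
qed

lemma left_regular_in_normalizer:
  assumes h: "h \<in> H"
  shows "left_regular G h \<in> normalizer (carrier G) (subgroup_vna G H) (group_vna G)"
proof -
  have hc: "h \<in> carrier G" using h H_sub by blast
  have conj: "op_mult (carrier G) (left_regular G (inv h)) (op_mult (carrier G) T (left_regular G h)) = T"
    if T: "T \<in> subgroup_vna G H" for T
  proof -
    have Tb: "T \<in> bounded_ops (carrier G)" using T subgroup_vna_bounded by blast
    have "op_mult (carrier G) T (left_regular G h) = op_mult (carrier G) (left_regular G h) T"
      using commutantD[OF subgroup_vna_in_left_commutant[OF T]] h by simp
    then have "op_mult (carrier G) (left_regular G (inv h)) (op_mult (carrier G) T (left_regular G h))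
        = op_mult (carrier G) (op_id (carrier G)) T"
      using op_mult_assoc[OF Tb] left_regular_inverse[OF hc] by metis
    also have "\<dots> = T"
      using bounded_ops_l2[OF Tb] bounded_ops_undefined[OF Tb] by (auto simp: compose_def fun_eq_iff)
    finally show ?thesis .
  qed
  then have "(\<lambda>T. op_mult (carrier G) (left_regular G (inv h)) (op_mult (carrier G) T (left_regular G h)))
      ` subgroup_vna G H = subgroup_vna G H" by simp
  then show ?thesis
    unfolding normalizer_def
    using left_regular_in_vna[OF hc] left_regular_adjoint[OF hc] left_regular_inverse[OF hc]
      left_regular_inverse[of "inv h"] hc by auto
qed

theorem subgroup_vna_singular: "singular (carrier G) (subgroup_vna G H) (group_vna G)"
  unfolding singular_def
proof
  let ?N = "normalizer (carrier G) (subgroup_vna G H) (group_vna G)"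
  have "bicommutant (carrier G) ?N \<subseteq> bicommutant (carrier G) (subgroup_vna G H)"
    using normalizer_in_subgroup_vna by (intro commutant_antimono) blast
  then show "bicommutant (carrier G) ?N \<subseteq> subgroup_vna G H"
    using subgroup_vna_bicommutant by simp
  show "subgroup_vna G H \<subseteq> bicommutant (carrier G) ?N"
  proof
    fix T assume T: "T \<in> subgroup_vna G H"
    have "commutant (carrier G) ?N \<subseteq> commutant (carrier G) (left_regular G ` H)"
      using left_regular_in_normalizer by (intro commutant_antimono) blast
    then show "T \<in> bicommutant (carrier G) ?N"
      using T subgroup_vna_bounded subgroup_vna_commute[OF T] by (intro commutantI) blast+
  qed
qed

end

end

end

end

section \<open>Products of powers of two commuting elements\<close>

context group
begin

lemma int_pow_commute:
  assumes "x \<in> carrier G" "y \<in> carrier G" "x \<otimes> y = y \<otimes> x"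
  shows "x [^] (i::int) \<otimes> y = y \<otimes> x [^] i"
proof (cases i rule: int_cases2)
  case (nonneg n)
  have "x [^] n \<otimes> y = y \<otimes> x [^] n" for n :: nat
    using assms by (intro group_commutes_pow) auto
  then show ?thesis using nonneg by (simp add: int_pow_int)
next
  case (nonpos n)
  have *: "y \<otimes> x [^] n = x [^] n \<otimes> y"
    using assms by (intro group_commutes_pow[symmetric]) auto
  have "inv (x [^] n) \<otimes> y = inv (x [^] n) \<otimes> (y \<otimes> x [^] n) \<otimes> inv (x [^] n)"
    using assms(1,2) by (simp add: m_assoc)
  also have "y \<otimes> x [^] n = x [^] n \<otimes> y" by (rule *)
  also have "inv (x [^] n) \<otimes> (x [^] n \<otimes> y) \<otimes> inv (x [^] n) = y \<otimes> inv (x [^] n)"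
    using assms(1,2) by (simp add: m_assoc[symmetric])
  finally have "inv (x [^] n) \<otimes> y = y \<otimes> inv (x [^] n)" .
  then show ?thesis using nonpos assms by (simp add: int_pow_neg_int)
qed

definition pow2 :: "'a \<Rightarrow> 'a \<Rightarrow> int \<Rightarrow> int \<Rightarrow> 'a" where
  "pow2 x y i j = x [^] i \<otimes> y [^] j"

lemma pow2_add:
  assumes "x \<in> carrier G" "y \<in> carrier G" "x \<otimes> y = y \<otimes> x"
  shows "pow2 x y i j \<otimes> pow2 x y k l = pow2 x y (i + k) (j + l)"
proof -
  have "x [^] k \<otimes> y [^] j = y [^] j \<otimes> x [^] k"
    using assms int_pow_commute[of y "x [^] k" j] int_pow_commute[of x y k] by simp
  then have "x [^] i \<otimes> (y [^] j \<otimes> x [^] k) \<otimes> y [^] l = x [^] i \<otimes> (x [^] k \<otimes> y [^] j) \<otimes> y [^] l"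
    by simp
  then have "pow2 x y i j \<otimes> pow2 x y k l = (x [^] i \<otimes> x [^] k) \<otimes> (y [^] j \<otimes> y [^] l)"
    using assms(1,2) by (simp add: pow2_def m_assoc)
  then show ?thesis
    using assms(1,2) by (simp add: pow2_def int_pow_mult)
qed

lemma pow2_closed [simp]: "x \<in> carrier G \<Longrightarrow> y \<in> carrier G \<Longrightarrow> pow2 x y i j \<in> carrier G"
  by (simp add: pow2_def)

lemma pow2_zero [simp]: "pow2 x y 0 0 = \<one>"
  by (simp add: pow2_def)

lemma pow2_inv:
  assumes "x \<in> carrier G" "y \<in> carrier G" "x \<otimes> y = y \<otimes> x"
  shows "inv (pow2 x y i j) = pow2 x y (- i) (- j)"
  using pow2_add[OF assms, of "- i" "- j" i j] assms by (intro inv_equality) auto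

lemma pow2_pow:
  assumes "x \<in> carrier G" "y \<in> carrier G" "x \<otimes> y = y \<otimes> x"
  shows "pow2 x y i j [^] (k::int) = pow2 x y (k * i) (k * j)"
proof -
  have "x [^] i \<otimes> y [^] j = y [^] j \<otimes> x [^] i"
    using assms int_pow_commute[of y "x [^] i" j] int_pow_commute[of x y i] by simp
  from int_pow_mult_distrib[OF this, of k] show ?thesis
    using assms(1,2) by (simp add: pow2_def int_pow_pow mult.commute)
qed

definition grid :: "'a \<Rightarrow> 'a \<Rightarrow> 'a set" where
  "grid x y = range (\<lambda>(i, j). pow2 x y i j)"

lemma grid_subgroup:
  assumes "x \<in> carrier G" "y \<in> carrier G" "x \<otimes> y = y \<otimes> x"
  shows "subgroup (grid x y) G"
proof (rule subgroupI)
  show "grid x y \<subseteq> carrier G" using assms by (auto simp: grid_def)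
  show "inv g \<in> grid x y" if "g \<in> grid x y" for g
    using that assms by (force simp: grid_def pow2_inv)
  show "g \<otimes> h \<in> grid x y" if gh: "g \<in> grid x y" "h \<in> grid x y" for g h
  proof -
    obtain i j k l where "g = pow2 x y i j" "h = pow2 x y k l" using gh by (auto simp: grid_def)
    then show ?thesis unfolding grid_def using pow2_add[OF assms]
      by (metis (mono_tags, lifting) UNIV_I case_prod_conv image_eqI)
  qed
qed (simp add: grid_def)

lemma grid_commute:
  assumes "x \<in> carrier G" "y \<in> carrier G" "x \<otimes> y = y \<otimes> x" "g \<in> grid x y" "h \<in> grid x y"
  shows "g \<otimes> h = h \<otimes> g"
  using assms pow2_add[OF assms(1-3)] by (auto simp: grid_def add.commute)

lemma pow2_in_grid [simp]: "pow2 x y i j \<in> grid x y"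
  by (force simp: grid_def)

lemma conj_preimage_subgroup:
  assumes "subgroup H G" "t \<in> carrier G"
  shows "subgroup {g \<in> carrier G. inv t \<otimes> g \<otimes> t \<in> H} G"
proof (rule subgroupI)
  show "{g \<in> carrier G. inv t \<otimes> g \<otimes> t \<in> H} \<noteq> {}"
    using assms subgroup.one_closed[OF assms(1)] by (auto intro!: exI[of _ \<one>])
  show "inv g \<in> {g \<in> carrier G. inv t \<otimes> g \<otimes> t \<in> H}" if "g \<in> {g \<in> carrier G. inv t \<otimes> g \<otimes> t \<in> H}" for g
  proof -
    have "inv (inv t \<otimes> g \<otimes> t) = inv t \<otimes> inv g \<otimes> t"
      using that assms(2) by (simp add: inv_mult_group m_assoc)
    then show ?thesis
      using that assms(2) subgroup.m_inv_closed[OF assms(1), of "inv t \<otimes> g \<otimes> t"] by simp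
  qed
  show "g \<otimes> h \<in> {g \<in> carrier G. inv t \<otimes> g \<otimes> t \<in> H}"
    if gh: "g \<in> {g \<in> carrier G. inv t \<otimes> g \<otimes> t \<in> H}" "h \<in> {g \<in> carrier G. inv t \<otimes> g \<otimes> t \<in> H}" for g h
  proof -
    have "t \<otimes> (inv t \<otimes> (h \<otimes> t)) = h \<otimes> t"
      using gh assms by (simp add: m_assoc[symmetric])
    then have "(inv t \<otimes> g \<otimes> t) \<otimes> (inv t \<otimes> h \<otimes> t) = inv t \<otimes> (g \<otimes> h) \<otimes> t"
      using gh assms by (simp add: m_assoc)
    then show ?thesis
      using gh assms subgroup.m_closed[OF assms(1), of "inv t \<otimes> g \<otimes> t" "inv t \<otimes> h \<otimes> t"] by simp
  qed
qed auto

text \<open>The candidates for \<open>h\<close> are the elements \<open>x\<^sup>i y\<^sup>j\<close> with exponents \<open>(n, n\<^sup>2)\<close> on a parabola. If three of them are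
  bad for the same pair \<open>s, t\<close>, their quotients are conjugated by \<open>t\<close> into the grid, and the
  corresponding two exponent vectors are linearly independent since a line meets a parabola at most twice.
  Some common power \<open>x\<^sup>K, y\<^sup>K\<close> is then conjugated into the grid, which the hypothesis forbids
  for \<open>t\<close> outside. So each of the finitely many pairs excludes at most two points.\<close>

lemma grid_avoids_double_coset:
  assumes xy: "x \<in> carrier G" "y \<in> carrier G" "x \<otimes> y = y \<otimes> x"
    and commens: "\<And>t k. t \<in> carrier G \<Longrightarrow> k > (0::int) \<Longrightarrow> inv t \<otimes> x [^] k \<otimes> t \<in> grid x y \<Longrightarrow>
      inv t \<otimes> y [^] k \<otimes> t \<in> grid x y \<Longrightarrow> t \<in> grid x y"
    and F: "finite F" "F \<subseteq> carrier G - grid x y"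
  shows "\<exists>h\<in>grid x y. \<forall>s\<in>F. \<forall>t\<in>F. s \<otimes> h \<otimes> t \<notin> grid x y"
proof -
  define H where "H = grid x y"
  interpret H: subgroup H G unfolding H_def using grid_subgroup[OF xy] .
  define h where "h n = pow2 x y (int n) ((int n)\<^sup>2)" for n
  have hc [simp]: "h n \<in> carrier G" for n using xy by (simp add: h_def)
  have "finite {n. s \<otimes> h n \<otimes> t \<in> H}" if st: "s \<in> F" "t \<in> F" for s t
  proof (rule ccontr)
    assume inf: "infinite {n. s \<otimes> h n \<otimes> t \<in> H}"
    have c: "s \<in> carrier G" "t \<in> carrier G" "t \<notin> H" using st F by (auto simp: H_def)
    define S where "S = {g \<in> carrier G. inv t \<otimes> g \<otimes> t \<in> H}"
    have S: "subgroup S G" unfolding S_def by (rule conj_preimage_subgroup) (use c H.subgroup_axioms in auto)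
    have diff: "pow2 x y (int m - int n) ((int m)\<^sup>2 - (int n)\<^sup>2) \<in> S"
      if "s \<otimes> h n \<otimes> t \<in> H" "s \<otimes> h m \<otimes> t \<in> H" for n m
    proof -
      have "inv s \<otimes> (s \<otimes> (h m \<otimes> t)) = h m \<otimes> t"
        using c by (simp add: m_assoc[symmetric])
      then have "inv (s \<otimes> h n \<otimes> t) \<otimes> (s \<otimes> h m \<otimes> t) = inv t \<otimes> (inv (h n) \<otimes> h m) \<otimes> t"
        using c by (simp add: inv_mult_group m_assoc)
      also have "inv (h n) \<otimes> h m = pow2 x y (int m - int n) ((int m)\<^sup>2 - (int n)\<^sup>2)"
        using xy by (simp add: h_def pow2_inv pow2_add)
      finally show ?thesis
        using H.m_closed[OF H.m_inv_closed[OF that(1)] that(2)] xy by (simp add: S_def)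
    qed
    obtain n1 where n1: "s \<otimes> h n1 \<otimes> t \<in> H" using inf not_finite_existsD by auto
    obtain n2 where n2: "s \<otimes> h n2 \<otimes> t \<in> H" "n1 < n2"
      using inf by (auto simp: infinite_nat_iff_unbounded)
    obtain n3 where n3: "s \<otimes> h n3 \<otimes> t \<in> H" "n2 < n3"
      using inf by (auto simp: infinite_nat_iff_unbounded)
    define p r where "p = int n2 - int n1" and "r = int n3 - int n1"
    define a b where "a = int n2 + int n1" and "b = int n3 + int n1"
    have v1: "pow2 x y p (p * a) \<in> S" and v2: "pow2 x y r (r * b) \<in> S"
      using diff[OF n1 n2(1)] diff[OF n1 n3(1)]
      by (simp_all add: p_def r_def a_def b_def power2_eq_square algebra_simps)
    have comb: "pow2 x y (k * p + l * r) (k * (p * a) + l * (r * b)) \<in> S" for k l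
      using subgroup.m_closed[OF S subgroup_int_pow_closed[OF S v1, of k] subgroup_int_pow_closed[OF S v2, of l]]
      by (simp only: pow2_pow[OF xy] pow2_add[OF xy])
    \<comment> \<open>the determinant of the two exponent vectors \<open>(p, p a)\<close> and \<open>(r, r b)\<close>\<close>
    define K where "K = p * r * (b - a)"
    have "K > 0" using n2(2) n3(2) by (simp add: K_def p_def r_def a_def b_def)
    moreover have "x [^] K \<in> S"
      using comb[of "r * b" "- (p * a)"] xy by (simp add: K_def algebra_simps pow2_def)
    moreover have "y [^] K \<in> S"
      using comb[of "- r" p] xy by (simp add: K_def algebra_simps pow2_def)
    ultimately have "t \<in> H" using commens[of t K] c by (simp add: S_def H_def)
    then show False using c by simp
  qed
  then have "finite (\<Union>s\<in>F. \<Union>t\<in>F. {n. s \<otimes> h n \<otimes> t \<in> H})" using F by blast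
  then obtain n where "n \<notin> (\<Union>s\<in>F. \<Union>t\<in>F. {n. s \<otimes> h n \<otimes> t \<in> H})"
    using ex_new_if_finite infinite_UNIV_nat by blast
  then show ?thesis by (intro bexI[of _ "h n"]) (auto simp: H_def h_def)
qed

end

section \<open>A convergent rewriting system for triangle presentations\<close>

text \<open>All geometry is expressed through the triangles: the point \<open>y\<close> lies on the line attached to
  \<open>x\<close> iff \<open>(x, y, z) \<in> T\<close> for some \<open>z\<close>. The last two assumptions say that two distinct
  points lie on exactly one line.\<close>

locale triangle_group =
  fixes P :: "'p set" and T :: "('p \<times> 'p \<times> 'p) set"
  assumes T_points: "(x, y, z) \<in> T \<Longrightarrow> x \<in> P \<and> y \<in> P \<and> z \<in> P"
    and T_rotate: "(x, y, z) \<in> T \<Longrightarrow> (y, z, x) \<in> T"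
    and T_unique: "(x, y, z) \<in> T \<Longrightarrow> (x, y, z') \<in> T \<Longrightarrow> z = z'"
    and T_join: "x \<in> P \<Longrightarrow> y \<in> P \<Longrightarrow> x \<noteq> y \<Longrightarrow> \<exists>w z v. (w, x, z) \<in> T \<and> (w, y, v) \<in> T"
    and T_join_unique: "x \<noteq> y \<Longrightarrow> (w, x, z) \<in> T \<Longrightarrow> (w, y, v) \<in> T \<Longrightarrow>
      (w', x, z') \<in> T \<Longrightarrow> (w', y, v') \<in> T \<Longrightarrow> w = w'"
begin

text \<open>The last rule comes from the line \<open>w\<close> through \<open>x\<close> and \<open>y\<close>: the triangles give
  \<open>x\<^sup>-\<^sup>1 = z w\<close> and \<open>y = w\<^sup>-\<^sup>1 v\<^sup>-\<^sup>1\<close>, whence \<open>x\<^sup>-\<^sup>1 y = z v\<^sup>-\<^sup>1\<close>. Since every left-hand side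
  has two letters, irreducibility is a condition on adjacent letters.\<close>

inductive pair_rule :: "'p \<times> bool \<Rightarrow> 'p \<times> bool \<Rightarrow> 'p word \<Rightarrow> bool" where
  cancel: "x \<in> P \<Longrightarrow> pair_rule (x, e) (x, \<not> e) []"
| pos_pos: "(x, y, z) \<in> T \<Longrightarrow> pair_rule (x, True) (y, True) [(z, False)]"
| neg_neg: "(y, x, z) \<in> T \<Longrightarrow> pair_rule (x, False) (y, False) [(z, True)]"
| neg_pos: "x \<noteq> y \<Longrightarrow> (w, x, z) \<in> T \<Longrightarrow> (w, y, v) \<in> T \<Longrightarrow>
    pair_rule (x, False) (y, True) [(z, True), (v, False)]"

inductive step :: "'p word \<Rightarrow> 'p word \<Rightarrow> bool" where
  here: "pair_rule \<alpha> \<beta> r \<Longrightarrow> step (\<alpha> # \<beta> # v) (r @ v)"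
| there: "step u v \<Longrightarrow> step (\<alpha> # u) (\<alpha> # v)"

abbreviation reduces :: "'p word \<Rightarrow> 'p word \<Rightarrow> bool" where
  "reduces \<equiv> step\<^sup>*\<^sup>*"

definition irreducible_word :: "'p word \<Rightarrow> bool" where
  "irreducible_word w \<longleftrightarrow> successively (\<lambda>\<alpha> \<beta>. \<nexists>r. pair_rule \<alpha> \<beta> r) w"

text \<open>The termination measure reads a word as a binary numeral whose last digit is the first letter,
  with a leading 1 after the last letter. It is compatible with prefixing letters,
  and replacing \<open>++\<close> by \<open>-\<close>, \<open>--\<close> by \<open>+\<close> and \<open>-+\<close> by \<open>+-\<close> all decrease it.\<close>

primrec rank :: "'p word \<Rightarrow> nat" where
  "rank [] = 1"
| "rank (\<alpha> # w) = 2 * rank w + (if snd \<alpha> then 1 else 0)"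

text \<open>Word length with different prices for the two signs. As two letters of one sign are exchanged
  for one of the other, rewriting does not increase it as long as neither price exceeds twice the other.
  Two such prices together see the numbers of positive and negative letters separately.\<close>

definition weight :: "nat \<Rightarrow> nat \<Rightarrow> 'p word \<Rightarrow> nat" where
  "weight m n w = sum_list (map (\<lambda>(x, e). if e then m else n) w)"

lemma weight_simps [simp]:
  "weight m n [] = 0"
  "weight m n ((x, e) # w) = (if e then m else n) + weight m n w"
  "weight m n (u @ w) = weight m n u + weight m n w"
  "weight m n (replicate k (x, e)) = k * (if e then m else n)"
  by (auto simp: weight_def sum_list_replicate)

lemma rank_pos: "rank w > 0"
  by (induction w) auto

lemma step_rank: "step u v \<Longrightarrow> rank v < rank u"
proof (induction rule: step.induct)
  case (here \<alpha> \<beta> r v)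
  then show ?case using rank_pos[of v] by (cases rule: pair_rule.cases) auto
qed auto

lemma step_weight:
  assumes "m \<le> 2 * n" "n \<le> 2 * m"
  shows "step u v \<Longrightarrow> weight m n v \<le> weight m n u"
proof (induction rule: step.induct)
  case (here \<alpha> \<beta> r v)
  then show ?case using assms by (cases rule: pair_rule.cases) auto
next
  case (there u v \<alpha>)
  then show ?case by (cases \<alpha>) auto
qed

lemma reduces_weight:
  assumes "m \<le> 2 * n" "n \<le> 2 * m" "reduces u v"
  shows "weight m n v \<le> weight m n u"
  using assms(3) by induction (use step_weight[OF assms(1,2)] in \<open>auto intro: order_trans\<close>)

lemma step_append_right: "step u v \<Longrightarrow> step (u @ w) (v @ w)"
proof (induction rule: step.induct)
  case (here \<alpha> \<beta> r v)
  then show ?case using step.here[of \<alpha> \<beta> r "v @ w"] by simp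
qed (auto intro: step.there)

lemma reduces_append_right: "reduces u v \<Longrightarrow> reduces (u @ w) (v @ w)"
  by (induction rule: rtranclp_induct) (auto intro: step_append_right rtranclp.rtrancl_into_rtrancl)

lemma reduces_Cons: "reduces u v \<Longrightarrow> reduces (\<alpha> # u) (\<alpha> # v)"
  by (induction rule: rtranclp_induct) (auto intro: step.there rtranclp.rtrancl_into_rtrancl)

lemma reduces_append_left: "reduces u v \<Longrightarrow> reduces (w @ u) (w @ v)"
  by (induction w) (auto intro: reduces_Cons)

lemma reduces_here: "pair_rule \<alpha> \<beta> r \<Longrightarrow> reduces (\<alpha> # \<beta> # v) (r @ v)"
  by (auto intro: step.here)

lemma pair_rule_unique: "pair_rule \<alpha> \<beta> r \<Longrightarrow> pair_rule \<alpha> \<beta> s \<Longrightarrow> r = s"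
  by (elim pair_rule.cases) (auto dest: T_unique dest: T_rotate T_join_unique)

lemma T_rotate2: "(x, y, z) \<in> T \<Longrightarrow> (z, x, y) \<in> T"
  by (blast dest: T_rotate)

text \<open>The interesting overlaps are those in which two neighbouring rewritings bring two new points
  on the line of the middle letter. If the points coincide, both sides collapse; otherwise the middle
  letter is the line through them, and the rule for a negative letter followed by a positive one joins
  the two results.\<close>

lemma critical_pair:
  assumes "pair_rule \<alpha> \<beta> r" "pair_rule \<beta> \<gamma> s"
  shows "\<exists>t. reduces (r @ [\<gamma>]) t \<and> reduces (\<alpha> # s) t"
proof -
  have cancelR: "reduces ((x, e) # (x, \<not> e) # v) v" if "x \<in> P" for x e v
    using reduces_here[OF cancel[OF that], of e v] by simp
  have pp: "reduces ((x, True) # (y, True) # v) ((z, False) # v)" if "(x, y, z) \<in> T" for x y z v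
    using reduces_here[OF pos_pos[OF that], of v] by simp
  have nn: "reduces ((x, False) # (y, False) # v) ((z, True) # v)" if "(y, x, z) \<in> T" for x y z v
    using reduces_here[OF neg_neg[OF that], of v] by simp
  have np: "reduces ((x, False) # (y, True) # v) ((z, True) # (u, False) # v)"
    if "x \<noteq> y" "(w, x, z) \<in> T" "(w, y, u) \<in> T" for x y z u w v
    using reduces_here[OF neg_pos[OF that], of v] by simp
  note tr = rtranclp_trans[of step]
  note rot = T_rotate T_rotate2
  from assms(1) show ?thesis
  proof cases
    case c1: (cancel x e)
    from assms(2) show ?thesis
    proof cases
      case (cancel x' e')
      then show ?thesis using c1 by auto
    next
      case (pos_pos x' y z)
      then have "reduces (\<alpha> # s) (r @ [\<gamma>])"
        using c1 nn[of z x y "[]"] by (auto dest: rot)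
      then show ?thesis by auto
    next
      case (neg_neg y x' z)
      then have "reduces (\<alpha> # s) (r @ [\<gamma>])"
        using c1 pp[of x z y "[]"] by (auto dest: rot)
      then show ?thesis by auto
    next
      case (neg_pos x' y w z v)
      have "(x, z, w) \<in> T" "(v, w, y) \<in> T" using neg_pos c1 by (auto dest: rot)
      then have "reduces [(x, True), (z, True), (v, False)] [(y, True)]"
        using tr[OF pp[of x z w "[(v, False)]"] nn[of v w y "[]"]] by auto
      then have "reduces (\<alpha> # s) (r @ [\<gamma>])" using c1 neg_pos by auto
      then show ?thesis by auto
    qed
  next
    case c1: (pos_pos x y u)
    from assms(2) show ?thesis
    proof cases
      case (cancel x' e')
      then have "reduces (r @ [\<gamma>]) (\<alpha> # s)"
        using c1 nn[of y u x "[]"] by (auto dest: rot)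
      then show ?thesis by auto
    next
      case (pos_pos y' z v)
      then have T: "(y, u, x) \<in> T" "(y, z, v) \<in> T" using c1 by (auto dest: rot)
      show ?thesis
      proof (cases "u = z")
        case True
        then have "v = x" using T T_unique by blast
        then have "reduces (r @ [\<gamma>]) []" "reduces (\<alpha> # s) []"
          using c1 pos_pos True T cancelR[of u False "[]"] cancelR[of x True "[]"]
          by (auto dest: T_points)
        then show ?thesis by auto
      next
        case False
        then have "reduces (r @ [\<gamma>]) (\<alpha> # s)"
          using np[OF False T, of "[]"] c1 pos_pos by auto
        then show ?thesis by auto
      qed
    qed (use c1 in auto)
  next
    case c1: (neg_neg y x p)
    from assms(2) show ?thesis
    proof cases
      case (cancel x' e')
      then have "reduces (r @ [\<gamma>]) (\<alpha> # s)"
        using c1 pp[of p y x "[]"] by (auto dest: rot)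
      then show ?thesis by auto
    next
      case (neg_neg z y' v)
      then have T: "(y, x, p) \<in> T" "(y, v, z) \<in> T" using c1 by (auto dest: rot)
      show ?thesis
      proof (cases "x = v")
        case True
        then have "p = z" using T T_unique by blast
        then have "reduces (r @ [\<gamma>]) []" "reduces (\<alpha> # s) []"
          using c1 neg_neg True T cancelR[of x False "[]"] cancelR[of z True "[]"]
          by (auto dest: T_points)
        then show ?thesis by auto
      next
        case False
        then have "reduces (\<alpha> # s) (r @ [\<gamma>])"
          using np[OF False T, of "[]"] c1 neg_neg by auto
        then show ?thesis by auto
      qed
    next
      case (neg_pos y' z w u v)
      then have T: "(y, x, p) \<in> T" "(y, u, w) \<in> T" "(v, w, z) \<in> T" "(w, z, v) \<in> T"
        using c1 by (auto dest: rot)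
      show ?thesis
      proof (cases "x = u")
        case True
        then have "p = w" using T T_unique by blast
        then have "reduces (r @ [\<gamma>]) [(v, False)]" "reduces (\<alpha> # s) [(v, False)]"
          using c1 neg_pos True T cancelR[of x False "[(v, False)]"] pp[of w z v "[]"]
          by (auto dest: T_points)
        then show ?thesis by auto
      next
        case False
        then have "reduces (\<alpha> # s) [(p, True), (w, False), (v, False)]"
          using np[OF False T(1,2), of "[(v, False)]"] c1 neg_pos by auto
        moreover have "reduces [(p, True), (w, False), (v, False)] (r @ [\<gamma>])"
          using reduces_Cons[OF nn[OF T(3), of "[]"]] c1 neg_pos by auto
        ultimately show ?thesis by (auto intro: tr)
      qed
    qed (use c1 in auto)
  next
    case c1: (neg_pos x y w p v)
    from assms(2) show ?thesis
    proof cases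
      case (cancel x' e')
      have "(y, v, w) \<in> T" "(p, w, x) \<in> T" using c1 by (auto dest: rot)
      then have "reduces (r @ [\<gamma>]) (\<alpha> # s)"
        using tr[OF reduces_Cons[OF nn[of y v w "[]"]] pp[of p w x "[]"]] c1 cancel by auto
      then show ?thesis by auto
    next
      case (pos_pos y' z t)
      then have T: "(y, v, w) \<in> T" "(y, z, t) \<in> T" "(p, w, x) \<in> T" "(w, x, p) \<in> T"
        using c1 by (auto dest: rot)
      show ?thesis
      proof (cases "v = z")
        case True
        then have "t = w" using T T_unique by blast
        then have "reduces (r @ [\<gamma>]) [(p, True)]" "reduces (\<alpha> # s) [(p, True)]"
          using c1 pos_pos True T nn[of w x p "[]"] reduces_Cons[OF cancelR[of v False "[]"]]
          by (auto dest: T_points)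
        then show ?thesis by auto
      next
        case False
        have "reduces (r @ [\<gamma>]) [(p, True), (w, True), (t, False)]"
          using reduces_Cons[OF np[OF False T(1,2), of "[]"]] c1 pos_pos by auto
        moreover have "reduces [(p, True), (w, True), (t, False)] (\<alpha> # s)"
          using pp[OF T(3), of "[(t, False)]"] c1 pos_pos by auto
        ultimately show ?thesis by (auto intro: tr)
      qed
    qed (use c1 in auto)
  qed
qed

lemma local_confluence:
  "step u v \<Longrightarrow> step u w \<Longrightarrow> \<exists>t. reduces v t \<and> reduces w t"
proof (induction arbitrary: w rule: step.induct)
  case (here \<alpha> \<beta> r v)
  from here(2) show ?case
  proof (cases rule: step.cases)
    case (here r')
    then show ?thesis using \<open>pair_rule \<alpha> \<beta> r\<close> pair_rule_unique by blast
  next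
    case t: (there x)
    from t(2) show ?thesis
    proof (cases rule: step.cases)
      case h: (here \<gamma> s y)
      then obtain t where "reduces (r @ [\<gamma>]) t" "reduces (\<alpha> # s) t"
        using critical_pair[OF \<open>pair_rule \<alpha> \<beta> r\<close>] by blast
      from this[THEN reduces_append_right, of y] show ?thesis using h t by auto
    next
      case (there z)
      then have "reduces (r @ v) (r @ z)" by (auto intro: reduces_append_left)
      moreover have "reduces w (r @ z)"
        unfolding t there by (rule reduces_here) fact
      ultimately show ?thesis by blast
    qed
  qed
next
  case (there u v \<alpha>)
  from there(3) show ?case
  proof (cases rule: step.cases)
    case h: (here \<beta> r y)
    from \<open>step u v\<close> have "step (\<beta> # y) v" using h by simp
    then show ?thesis
    proof (cases rule: step.cases)
      case hh: (here \<gamma> s z)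
      then obtain t where "reduces (r @ [\<gamma>]) t" "reduces (\<alpha> # s) t"
        using critical_pair h by blast
      from this[THEN reduces_append_right, of z] show ?thesis
        using hh h by auto
    next
      case t: (there z)
      then have "reduces (r @ y) (r @ z)" by (auto intro: reduces_append_left)
      moreover have "reduces (\<alpha> # \<beta> # z) (r @ z)"
        using h by (auto intro: reduces_here)
      ultimately show ?thesis using h t by auto
    qed
  next
    case t: (there x)
    then obtain s where "reduces v s" "reduces x s" using there.IH by auto
    then show ?thesis using t by (auto intro: reduces_Cons)
  qed
qed

text \<open>Newman's lemma for this system.\<close>

lemma confluence:
  "reduces u v \<Longrightarrow> reduces u w \<Longrightarrow> \<exists>t. reduces v t \<and> reduces w t"
proof (induction "rank u" arbitrary: u v w rule: less_induct)
  case less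
  show ?case
  proof (cases "u = v \<or> u = w")
    case False
    then obtain v' w' where s: "step u v'" "reduces v' v" "step u w'" "reduces w' w"
      using less.prems by (metis converse_rtranclpE)
    obtain x where x: "reduces v' x" "reduces w' x" using local_confluence s by blast
    obtain y where y: "reduces v y" "reduces x y"
      using less.hyps[OF step_rank[OF s(1)] s(2) x(1)] by blast
    obtain z where "reduces y z" "reduces w z"
      using less.hyps[OF step_rank[OF s(3)] rtranclp_trans[OF x(2) y(2)] s(4)] by blast
    then show ?thesis using y by (meson rtranclp_trans)
  qed (use less.prems in auto)
qed

lemma irreducible_no_step: "step u v \<Longrightarrow> \<not> irreducible_word u"
  by (induction rule: step.induct)
    (auto simp: irreducible_word_def successively_Cons)

lemma reducible_step: "\<not> irreducible_word u \<Longrightarrow> \<exists>v. step u v"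
proof (induction u)
  case (Cons \<alpha> u)
  then show ?case
    by (cases u) (auto simp: irreducible_word_def successively_Cons dest: step.here step.there)
qed (simp add: irreducible_word_def)

lemma reduces_irreducible: "irreducible_word u \<Longrightarrow> reduces u v \<Longrightarrow> v = u"
  by (metis converse_rtranclpE irreducible_no_step)

lemma ex_irreducible: "\<exists>v. reduces u v \<and> irreducible_word v"
proof (induction "rank u" arbitrary: u rule: less_induct)
  case less
  then show ?case
    by (meson reducible_step step_rank converse_rtranclp_into_rtranclp rtranclp.rtrancl_refl)
qed

definition joinable :: "'p word \<Rightarrow> 'p word \<Rightarrow> bool" where
  "joinable u v \<longleftrightarrow> (\<exists>t. reduces u t \<and> reduces v t)"

lemma joinable_trans: "joinable u v \<Longrightarrow> joinable v w \<Longrightarrow> joinable u w"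
  unfolding joinable_def by (meson confluence rtranclp_trans)

lemma word_equiv_joinable: "word_equiv P (A2_relators T) u v \<Longrightarrow> joinable u v"
proof (induction rule: word_equiv.induct)
  case (cancel u v x e)
  have "reduces (u @ [(x, e), (x, \<not> e)] @ v) (u @ v)"
    using reduces_here[OF pair_rule.cancel[OF \<open>x \<in> P\<close>], of e v]
    by (auto intro: reduces_append_left)
  then show ?case unfolding joinable_def by blast
next
  case (relator u v r)
  then obtain x y z where r: "r = [(x, True), (y, True), (z, True)]" "(x, y, z) \<in> T"
    by (auto simp: A2_relators_def)
  have "reduces (r @ v) ([(z, False), (z, \<not> False)] @ v)"
    using reduces_here[OF pair_rule.pos_pos[OF r(2)], of "(z, True) # v"] r by simp
  also have "reduces \<dots> v"
    using reduces_here[OF pair_rule.cancel, of z False v] r T_points by simp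
  finally show ?case unfolding joinable_def by (blast intro: reduces_append_left)
next
  case (sym v w)
  then show ?case by (auto simp: joinable_def)
qed (auto simp: joinable_def intro: joinable_trans[unfolded joinable_def])

text \<open>Equivalent words have a common reduct, and an irreducible word reduces only to itself.\<close>

theorem irreducible_unique:
  assumes "word_equiv P (A2_relators T) u v" "irreducible_word u" "irreducible_word v"
  shows "u = v"
  using word_equiv_joinable[OF assms(1)] reduces_irreducible assms(2,3)
  unfolding joinable_def by metis

lemma irreducible_weight_le:
  assumes "word_equiv P (A2_relators T) u v" "irreducible_word u" "m \<le> 2 * n" "n \<le> 2 * m"
  shows "weight m n u \<le> weight m n v"
  using word_equiv_joinable[OF assms(1)] reduces_irreducible[OF assms(2)] reduces_weight[OF assms(3,4)]
  unfolding joinable_def by metis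

end

section \<open>Normal forms in the group of a triangle presentation\<close>

context triangle_group
begin

abbreviation "G \<equiv> A2_group P T"
abbreviation "cls \<equiv> word_class P (A2_relators T)"
abbreviation "gen \<equiv> A2_gen P T"

sublocale group G
  unfolding A2_group_def by (rule group_presented_group)

lemma carrier_G: "carrier G = cls ` words_over P"
  by (simp add: A2_group_def presented_group_def)

lemma one_G: "\<one>\<^bsub>G\<^esub> = cls []"
  by (simp add: A2_group_def presented_group_def)

lemma cls_closed [simp]: "w \<in> words_over P \<Longrightarrow> cls w \<in> carrier G"
  by (simp add: carrier_G)

lemma words_simps [simp]:
  "[] \<in> words_over P"
  "\<alpha> # w \<in> words_over P \<longleftrightarrow> fst \<alpha> \<in> P \<and> w \<in> words_over P"
  "u @ w \<in> words_over P \<longleftrightarrow> u \<in> words_over P \<and> w \<in> words_over P"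
  by (auto simp: words_over_def mem_Times_iff)

lemma replicate_words [simp]: "fst \<alpha> \<in> P \<Longrightarrow> replicate n \<alpha> \<in> words_over P"
  by (induction n) auto

lemma cls_append:
  "u \<in> words_over P \<Longrightarrow> v \<in> words_over P \<Longrightarrow> cls (u @ v) = cls u \<otimes>\<^bsub>G\<^esub> cls v"
  by (simp add: A2_group_def presented_group_mult)

lemma cls_Cons:
  "fst \<alpha> \<in> P \<Longrightarrow> v \<in> words_over P \<Longrightarrow> cls (\<alpha> # v) = cls [\<alpha>] \<otimes>\<^bsub>G\<^esub> cls v"
  using cls_append[of "[\<alpha>]" v] by simp

lemma cls_eq_iff: "u \<in> words_over P \<Longrightarrow> cls u = cls v \<longleftrightarrow> word_equiv P (A2_relators T) u v"
  by (rule word_class_eq_iff)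

lemma gen_def: "gen x = cls [(x, True)]"
  by (simp add: A2_gen_def)

lemma gen_closed [simp]: "x \<in> P \<Longrightarrow> gen x \<in> carrier G"
  by (simp add: gen_def)

lemma cls_inverse_letter:
  assumes "x \<in> P"
  shows "cls [(x, False)] = inv\<^bsub>G\<^esub> gen x"
proof -
  have "word_equiv P (A2_relators T) ([] @ [(x, False), (x, \<not> False)] @ []) ([] @ [])"
    using assms by (intro word_equiv.cancel) auto
  then have "cls [(x, False), (x, True)] = cls []"
    using assms by (simp add: cls_eq_iff)
  then have "cls [(x, False)] \<otimes>\<^bsub>G\<^esub> gen x = \<one>\<^bsub>G\<^esub>"
    using assms cls_append[of "[(x, False)]" "[(x, True)]"] by (simp add: one_G gen_def)
  then show ?thesis using assms by (intro inv_equality[symmetric]) auto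
qed

lemma cls_letter: "x \<in> P \<Longrightarrow> cls [(x, e)] = (if e then gen x else inv\<^bsub>G\<^esub> gen x)"
  by (simp add: cls_inverse_letter gen_def)

lemma triangle_relation:
  assumes "(x, y, z) \<in> T"
  shows "gen x \<otimes>\<^bsub>G\<^esub> gen y = inv\<^bsub>G\<^esub> gen z"
proof -
  note T = T_points[OF assms]
  let ?w = "[(x, True), (y, True), (z, True)]"
  have "?w \<in> A2_relators T" using assms by (auto simp: A2_relators_def)
  then have "word_equiv P (A2_relators T) ([] @ ?w @ []) ([] @ [])"
    using T by (intro word_equiv.relator) auto
  then have "cls ?w = \<one>\<^bsub>G\<^esub>" using T by (simp add: cls_eq_iff one_G)
  then have "(gen x \<otimes>\<^bsub>G\<^esub> gen y) \<otimes>\<^bsub>G\<^esub> gen z = \<one>\<^bsub>G\<^esub>"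
    using T by (simp add: cls_Cons[of _ "_ # _"] cls_letter m_assoc)
  then show ?thesis using T by (intro inv_equality[symmetric]) auto
qed

lemma pair_rule_cls:
  assumes "pair_rule \<alpha> \<beta> r"
  shows "fst \<alpha> \<in> P \<and> fst \<beta> \<in> P \<and> r \<in> words_over P \<and> cls [\<alpha>, \<beta>] = cls r"
  using assms
proof cases
  case (cancel x e)
  then show ?thesis by (cases e) (auto simp: cls_Cons[of _ "_ # _"] cls_letter one_G[symmetric])
next
  case (pos_pos x y z)
  then show ?thesis
    using T_points[OF pos_pos(4)] triangle_relation[OF pos_pos(4)]
    by (auto simp: cls_Cons[of _ "_ # _"] cls_letter)
next
  case (neg_neg y x z)
  then show ?thesis
    using T_points[OF neg_neg(4)] triangle_relation[OF neg_neg(4)]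
    by (auto simp: cls_Cons[of _ "_ # _"] cls_letter inv_mult_group[symmetric])
next
  case (neg_pos x y w z v)
  have P: "x \<in> P" "y \<in> P" "w \<in> P" "z \<in> P" "v \<in> P" using neg_pos T_points by blast+
  have "inv\<^bsub>G\<^esub> gen x = gen z \<otimes>\<^bsub>G\<^esub> gen w"
    using triangle_relation[of z w x] neg_pos T_rotate2 by simp
  moreover have "gen y = inv\<^bsub>G\<^esub> gen w \<otimes>\<^bsub>G\<^esub> inv\<^bsub>G\<^esub> gen v"
    using triangle_relation[of v w y] neg_pos T_rotate2 P by (simp add: inv_mult_group[symmetric])
  moreover have "gen w \<otimes>\<^bsub>G\<^esub> (inv\<^bsub>G\<^esub> gen w \<otimes>\<^bsub>G\<^esub> inv\<^bsub>G\<^esub> gen v) = inv\<^bsub>G\<^esub> gen v"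
    using P by (simp add: m_assoc[symmetric])
  ultimately have "inv\<^bsub>G\<^esub> gen x \<otimes>\<^bsub>G\<^esub> gen y = gen z \<otimes>\<^bsub>G\<^esub> inv\<^bsub>G\<^esub> gen v"
    using P by (simp add: m_assoc)
  then show ?thesis
    using neg_pos P by (auto simp: cls_Cons[of _ "_ # _"] cls_letter)
qed

lemma step_cls: "step u v \<Longrightarrow> u \<in> words_over P \<Longrightarrow> v \<in> words_over P \<and> cls u = cls v"
proof (induction rule: step.induct)
  case (here \<alpha> \<beta> r v)
  then show ?case
    using pair_rule_cls[OF here(1)] cls_append[of "[\<alpha>, \<beta>]" v] cls_append[of r v] by simp
next
  case (there u v \<alpha>)
  then have "cls (\<alpha> # u) = cls [\<alpha>] \<otimes>\<^bsub>G\<^esub> cls u" "cls (\<alpha> # v) = cls [\<alpha>] \<otimes>\<^bsub>G\<^esub> cls v"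
    using there by (simp_all add: cls_Cons[of \<alpha> u] cls_Cons[of \<alpha> v])
  with there show ?case by (simp del: cls_closed)
qed

lemma reduces_cls: "reduces u v \<Longrightarrow> u \<in> words_over P \<Longrightarrow> v \<in> words_over P \<and> cls u = cls v"
  by (induction rule: rtranclp_induct) (auto dest: step_cls)

lemma ex_irreducible_cls:
  assumes "g \<in> carrier G"
  obtains w where "w \<in> words_over P" "irreducible_word w" "cls w = g"
proof -
  obtain u where "u \<in> words_over P" "cls u = g" using assms by (auto simp: carrier_G)
  then show ?thesis using that ex_irreducible[of u] reduces_cls[of u] by blast
qed

lemma irreducible_cls_eq:
  assumes "u \<in> words_over P" "irreducible_word u" "irreducible_word v" "cls u = cls v"
  shows "u = v"
  using assms irreducible_unique by (simp add: cls_eq_iff)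

text \<open>Irreducible words are geodesic with respect to each admissible weight. This gives lower bounds
  for word lengths in the group.\<close>

lemma irreducible_cls_weight_le:
  assumes "u \<in> words_over P" "irreducible_word u" "cls u = cls v" "m \<le> 2 * n" "n \<le> 2 * m"
  shows "weight m n u \<le> weight m n v"
  using assms irreducible_weight_le by (simp add: cls_eq_iff)

lemma pair_rule_iffs:
  "(\<exists>r. pair_rule (x, True) (y, True) r) \<longleftrightarrow> (\<exists>z. (x, y, z) \<in> T)"
  "(\<exists>r. pair_rule (x, False) (y, False) r) \<longleftrightarrow> (\<exists>z. (y, x, z) \<in> T)"
  "(\<exists>r. pair_rule (x, True) (y, False) r) \<longleftrightarrow> x \<in> P \<and> x = y"
proof -
  show "(\<exists>r. pair_rule (x, True) (y, True) r) \<longleftrightarrow> (\<exists>z. (x, y, z) \<in> T)"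
    by (subst pair_rule.simps) auto
  show "(\<exists>r. pair_rule (x, False) (y, False) r) \<longleftrightarrow> (\<exists>z. (y, x, z) \<in> T)"
    by (subst pair_rule.simps) auto
  show "(\<exists>r. pair_rule (x, True) (y, False) r) \<longleftrightarrow> x \<in> P \<and> x = y"
    by (subst pair_rule.simps) auto
qed

lemma irreducible_Nil [simp]: "irreducible_word []"
  by (simp add: irreducible_word_def)

lemma irreducible_append_iff:
  "irreducible_word (u @ v) \<longleftrightarrow> irreducible_word u \<and> irreducible_word v \<and>
    (u \<noteq> [] \<and> v \<noteq> [] \<longrightarrow> \<not> (\<exists>r. pair_rule (last u) (hd v) r))"
  by (auto simp: irreducible_word_def successively_append_iff)

lemma irreducible_replicate:
  assumes "\<not> (\<exists>r. pair_rule \<alpha> \<alpha> r)"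
  shows "irreducible_word (replicate n \<alpha>)"
proof (induction n)
  case (Suc n)
  then show ?case using assms by (cases n) (auto simp: irreducible_word_def successively_Cons)
qed (simp add: irreducible_word_def)

lemma cls_replicate_pos:
  assumes "x \<in> P"
  shows "cls (replicate n (x, True)) = gen x [^]\<^bsub>G\<^esub> int n"
proof (induction n)
  case (Suc n)
  have "cls (replicate (Suc n) (x, True)) = gen x \<otimes>\<^bsub>G\<^esub> gen x [^]\<^bsub>G\<^esub> int n"
    using cls_Cons[of "(x, True)" "replicate n (x, True)"] assms Suc by (simp add: gen_def)
  also have "\<dots> = gen x [^]\<^bsub>G\<^esub> (1 + int n)"
    using assms int_pow_mult[of "gen x" 1 "int n"] by simp
  finally show ?case by simp
qed (simp add: one_G)

lemma cls_replicate_neg: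
  assumes "x \<in> P"
  shows "cls (replicate n (x, False)) = gen x [^]\<^bsub>G\<^esub> (- int n)"
proof (induction n)
  case (Suc n)
  have "cls (replicate (Suc n) (x, False)) = inv\<^bsub>G\<^esub> gen x \<otimes>\<^bsub>G\<^esub> gen x [^]\<^bsub>G\<^esub> (- int n)"
    using cls_Cons[of "(x, False)" "replicate n (x, False)"] assms Suc by (simp add: cls_inverse_letter)
  also have "\<dots> = gen x [^]\<^bsub>G\<^esub> (- 1 + - int n)"
    using assms int_pow_mult[of "gen x" "- 1" "- int n"] int_pow_neg[of "gen x" 1] by simp
  finally show ?case by simp
qed (simp add: one_G)

text \<open>If \<open>x y\<close> is irreducible, then it differs from every other irreducible word of its class, and
  \<open>y x\<close> would reduce either to itself or to a single letter. So both products reduce to a single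
  letter, and to the same one.\<close>

lemma commuting_generators:
  assumes "x \<in> P" "y \<in> P" "x \<noteq> y" "gen x \<otimes>\<^bsub>G\<^esub> gen y = gen y \<otimes>\<^bsub>G\<^esub> gen x"
  shows "\<exists>z. (x, y, z) \<in> T \<and> (y, x, z) \<in> T"
proof -
  have E: "cls [(x, True), (y, True)] = cls [(y, True), (x, True)]"
    using assms by (simp add: cls_Cons[of _ "[_]"] cls_letter)
  have irr1: "irreducible_word [\<alpha>]" for \<alpha> by (simp add: irreducible_word_def)
  have irr: "irreducible_word [(x, True), (y, True)]" if "\<nexists>z. (x, y, z) \<in> T" for x y
    using that pair_rule_iffs(1)[of x y] by (auto simp: irreducible_word_def)
  have flip: "(y, x, z) \<in> T"
    if "(x, y, z) \<in> T" "cls [(x, True), (y, True)] = cls [(y, True), (x, True)]" for x y z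
  proof -
    have z: "z \<in> P" "cls [(z, False)] = cls [(y, True), (x, True)]"
      using that T_points pair_rule_cls[OF pos_pos[OF that(1)]] by auto
    have "\<exists>z. (y, x, z) \<in> T"
      using irreducible_cls_eq[OF _ irr1 irr, of "(z, False)" y x] z by auto
    then obtain z' where z': "(y, x, z') \<in> T" by blast
    then have "cls [(z, False)] = cls [(z', False)]"
      using z pair_rule_cls[OF pos_pos[OF z']] by simp
    then show ?thesis
      using z z' irreducible_cls_eq[OF _ irr1 irr1, of "(z, False)" "(z', False)"] by simp
  qed
  show ?thesis
  proof (cases "\<exists>z. (x, y, z) \<in> T \<or> (y, x, z) \<in> T")
    case False
    then have "[(x, True), (y, True)] = [(y, True), (x, True)]"
      using E assms by (intro irreducible_cls_eq irr) auto
    then show ?thesis using assms by simp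
  qed (use E flip in metis)
qed

end

section \<open>The flat spanned by three commuting generators\<close>

lemma linear_bound_le:
  fixes p q C :: nat
  assumes "\<And>N. N * p \<le> C + N * q"
  shows "p \<le> q"
proof (rule ccontr)
  assume "\<not> p \<le> q"
  then have "(C + 1) * (q + 1) \<le> (C + 1) * p" by (intro mult_le_mono2) simp
  also have "\<dots> \<le> C + (C + 1) * q" by (rule assms)
  finally show False by simp
qed

locale commuting_triple = triangle_group +
  fixes a b c
  assumes abc_points: "a \<in> P" "b \<in> P" "c \<in> P"
    and abc_distinct: "a \<noteq> b" "b \<noteq> c" "a \<noteq> c"
    and ab_commute: "gen a \<otimes>\<^bsub>G\<^esub> gen b = gen b \<otimes>\<^bsub>G\<^esub> gen a"
    and bc_commute: "gen b \<otimes>\<^bsub>G\<^esub> gen c = gen c \<otimes>\<^bsub>G\<^esub> gen b"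
    and ac_commute: "gen a \<otimes>\<^bsub>G\<^esub> gen c = gen c \<otimes>\<^bsub>G\<^esub> gen a"
begin

abbreviation "D \<equiv> {a, b, c}"

lemma D_points: "x \<in> D \<Longrightarrow> x \<in> P"
  using abc_points by blast

text \<open>The third vertices of the triangles on \<open>a, b\<close>, on \<open>b, c\<close> and on \<open>a, c\<close> are at first unrelated.
  But the points \<open>a\<close> and \<open>b\<close> lie on the line of \<open>c\<close> and on the line of the third vertex \<open>z\<close> of
  the triangle on \<open>a, b\<close>, so \<open>z = c\<close>.\<close>

lemma abc_triple: "(a, b, c) \<in> T" "(b, a, c) \<in> T"
proof -
  obtain z where z: "(a, b, z) \<in> T" "(b, a, z) \<in> T"
    using commuting_generators[OF abc_points(1,2) abc_distinct(1) ab_commute] by blast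
  obtain y where y: "(b, c, y) \<in> T" "(c, b, y) \<in> T"
    using commuting_generators[OF abc_points(2,3) abc_distinct(2) bc_commute] by blast
  obtain x where x: "(a, c, x) \<in> T" "(c, a, x) \<in> T"
    using commuting_generators[OF abc_points(1,3) abc_distinct(3) ac_commute] by blast
  have "(z, a, b) \<in> T" "(z, b, a) \<in> T" using z T_rotate2 by blast+
  then have "z = c"
    using T_join_unique[OF abc_distinct(1) _ _ x(2) y(2)] by blast
  then show "(a, b, c) \<in> T" "(b, a, c) \<in> T" using z by auto
qed

lemma D_triple:
  assumes "x \<in> D" "y \<in> D" "z \<in> D" "x \<noteq> y" "y \<noteq> z" "x \<noteq> z"
  shows "(x, y, z) \<in> T"
  using assms abc_triple T_rotate T_rotate2 by blast

lemma D_third: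
  assumes "x \<in> D" "y \<in> D" "x \<noteq> y"
  obtains z where "z \<in> D" "z \<noteq> x" "z \<noteq> y"
  using assms abc_distinct by auto

text \<open>The lines of \<open>a\<close>, \<open>b\<close> and \<open>c\<close> form a proper triangle with vertices \<open>a\<close>, \<open>b\<close> and \<open>c\<close>: two of them
  meet in the third point.\<close>

lemma D_line_meet:
  assumes "x \<in> D" "y \<in> D" "x \<noteq> y" "(x, p, u) \<in> T" "(y, p, v) \<in> T"
  shows "p \<in> D \<and> p \<noteq> x \<and> p \<noteq> y"
proof -
  obtain z where z: "z \<in> D" "z \<noteq> x" "z \<noteq> y" using D_third assms by metis
  then have "(x, z, y) \<in> T" "(y, z, x) \<in> T" using D_triple assms by metis+
  then have "p = z" using T_join_unique[of p z x] assms by blast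
  then show ?thesis using z by simp
qed

lemma D_no_square: "x \<in> D \<Longrightarrow> (x, x, v) \<notin> T"
proof
  assume x: "x \<in> D" and v: "(x, x, v) \<in> T"
  obtain y where y: "y \<in> D" "y \<noteq> x" using abc_distinct by blast
  then obtain z where z: "z \<in> D" "z \<noteq> x" "z \<noteq> y" using D_third[OF x] by blast
  have "(y, x, z) \<in> T" using D_triple x y z by metis
  then show False using D_line_meet[OF x y(1) y(2)[symmetric] v] by blast
qed

lemma D_replicate_irreducible: "x \<in> D \<Longrightarrow> irreducible_word (replicate n (x, e))"
  using D_no_square by (intro irreducible_replicate) (cases e; simp only: pair_rule_iffs; blast)

lemma D_word_irreducible:
  assumes "x \<in> D" "y \<in> D" "x \<noteq> y"
  shows "irreducible_word (replicate m (x, True) @ replicate n (y, False))"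
proof -
  have "\<nexists>r. pair_rule (x, True) (y, False) r" using pair_rule_iffs(3) assms by simp
  then have "\<nexists>r. pair_rule (last (replicate m (x, True))) (hd (replicate n (y, False))) r" if "m \<noteq> 0" "n \<noteq> 0"
    using that by simp
  then show ?thesis
    unfolding irreducible_append_iff using assms D_replicate_irreducible by auto
qed

abbreviation "\<phi> \<equiv> pow2 (gen a) (gen b)"
definition "\<Gamma>0 = grid (gen a) (gen b)"

lemma gen_ab_closed: "gen a \<in> carrier G" "gen b \<in> carrier G"
  using abc_points by auto

lemmas phi_add = pow2_add[OF gen_ab_closed ab_commute]
lemmas phi_inv = pow2_inv[OF gen_ab_closed ab_commute]
lemmas phi_pow = pow2_pow[OF gen_ab_closed ab_commute]

sublocale \<Gamma>0: subgroup \<Gamma>0 G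
  unfolding \<Gamma>0_def by (rule grid_subgroup[OF gen_ab_closed ab_commute])

lemma \<Gamma>0_commute: "g \<in> \<Gamma>0 \<Longrightarrow> h \<in> \<Gamma>0 \<Longrightarrow> g \<otimes>\<^bsub>G\<^esub> h = h \<otimes>\<^bsub>G\<^esub> g"
  unfolding \<Gamma>0_def by (rule grid_commute[OF gen_ab_closed ab_commute])

lemma gen_pow_phi:
  "gen a [^]\<^bsub>G\<^esub> (k::int) = \<phi> k 0" "gen b [^]\<^bsub>G\<^esub> (k::int) = \<phi> 0 k" "gen c [^]\<^bsub>G\<^esub> (k::int) = \<phi> (- k) (- k)"
proof -
  show "gen a [^]\<^bsub>G\<^esub> k = \<phi> k 0" "gen b [^]\<^bsub>G\<^esub> k = \<phi> 0 k"
    using abc_points by (simp_all add: pow2_def)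
  have "gen c = inv\<^bsub>G\<^esub> (\<phi> 1 1)"
    using triangle_relation[OF abc_triple(1)] abc_points by (simp add: pow2_def)
  then have "gen c = \<phi> (- 1) (- 1)" by (simp add: phi_inv)
  then show "gen c [^]\<^bsub>G\<^esub> k = \<phi> (- k) (- k)" by (simp add: phi_pow)
qed

lemma \<Gamma>0_generated: "generate G {gen a, gen b, gen c} = \<Gamma>0"
proof (rule generateI[symmetric])
  show "subgroup \<Gamma>0 G" by (rule \<Gamma>0.subgroup_axioms)
  have "gen x [^]\<^bsub>G\<^esub> (1::int) \<in> \<Gamma>0" if "x \<in> D" for x
    using that by (auto simp: gen_pow_phi \<Gamma>0_def simp del: int_pow_1)
  from this[of a] this[of b] this[of c] show "{gen a, gen b, gen c} \<subseteq> \<Gamma>0"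
    using abc_points by simp
  show "\<Gamma>0 \<subseteq> K" if K: "subgroup K G" "{gen a, gen b, gen c} \<subseteq> K" for K
    using subgroup.m_closed[OF K(1)] subgroup_int_pow_closed[OF K(1)] K(2)
    by (auto simp: \<Gamma>0_def grid_def pow2_def)
qed

lemma D_pow_in_\<Gamma>0: "x \<in> D \<Longrightarrow> gen x [^]\<^bsub>G\<^esub> (k::int) \<in> \<Gamma>0"
  by (auto simp: gen_pow_phi \<Gamma>0_def)

definition "flat_word x y m n = replicate m (x, True) @ replicate n (y, False)"

lemma flat_word_words: "x \<in> D \<Longrightarrow> y \<in> D \<Longrightarrow> flat_word x y m n \<in> words_over P"
  using D_points by (simp add: flat_word_def)

lemma flat_word_cls:
  "x \<in> D \<Longrightarrow> y \<in> D \<Longrightarrow> cls (flat_word x y m n) = gen x [^]\<^bsub>G\<^esub> int m \<otimes>\<^bsub>G\<^esub> gen y [^]\<^bsub>G\<^esub> (- int n)"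
  using D_points[of x] D_points[of y]
  by (simp add: flat_word_def cls_append cls_replicate_pos cls_replicate_neg)

text \<open>The relation \<open>abc = 1\<close> allows one of the three exponents to be cancelled so that of the
  remaining two one is nonnegative and the other nonpositive. The six cases are the six sectors of
  the flat.\<close>

lemma phi_flat_word:
  "\<exists>x\<in>D. \<exists>y\<in>D. \<exists>m n. x \<noteq> y \<and> \<phi> i j = cls (flat_word x y m n) \<and> (m = 0 \<and> n = 0 \<longrightarrow> i = 0 \<and> j = 0)"
proof -
  have *: ?thesis
    if "x \<in> D" "y \<in> D" "x \<noteq> y" "k \<ge> 0" "l \<ge> 0" "k = 0 \<and> l = 0 \<longrightarrow> i = 0 \<and> j = 0"
      "\<phi> i j = gen x [^]\<^bsub>G\<^esub> k \<otimes>\<^bsub>G\<^esub> gen y [^]\<^bsub>G\<^esub> (- l)" for x y and k l :: int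
  proof -
    have "\<phi> i j = cls (flat_word x y (nat k) (nat l))" using that by (simp add: flat_word_cls)
    moreover have "nat k = 0 \<and> nat l = 0 \<longrightarrow> i = 0 \<and> j = 0" using that by auto
    ultimately show ?thesis using that by blast
  qed
  consider "i \<ge> 0 \<and> j \<le> 0" | "i \<le> 0 \<and> j \<ge> 0" | "i \<ge> j \<and> j \<ge> 0" | "j \<ge> i \<and> i \<ge> 0"
    | "0 \<ge> i \<and> i \<ge> j" | "0 \<ge> j \<and> j \<ge> i" by linarith
  then show ?thesis
  proof cases
    case 1 then show ?thesis using abc_distinct by (intro *[of a b i "- j"]) (auto simp: gen_pow_phi phi_add)
  next
    case 2 then show ?thesis using abc_distinct by (intro *[of b a j "- i"]) (auto simp: gen_pow_phi phi_add)
  next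
    case 3 then show ?thesis using abc_distinct by (intro *[of a c "i - j" j]) (auto simp: gen_pow_phi phi_add)
  next
    case 4 then show ?thesis using abc_distinct by (intro *[of b c "j - i" i]) (auto simp: gen_pow_phi phi_add)
  next
    case 5 then show ?thesis using abc_distinct by (intro *[of c b "- i" "i - j"]) (auto simp: gen_pow_phi phi_add)
  next
    case 6 then show ?thesis using abc_distinct by (intro *[of c a "- j" "j - i"]) (auto simp: gen_pow_phi phi_add)
  qed
qed

lemma \<Gamma>0_flat_word:
  assumes "h \<in> \<Gamma>0"
  obtains x y m n where "x \<in> D" "y \<in> D" "x \<noteq> y" "h = cls (flat_word x y m n)"
proof -
  obtain i j where "h = \<phi> i j" using assms by (auto simp: \<Gamma>0_def grid_def)
  then show ?thesis using phi_flat_word[of i j] that by blast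
qed

lemma flat_word_irreducible: "x \<in> D \<Longrightarrow> y \<in> D \<Longrightarrow> x \<noteq> y \<Longrightarrow> irreducible_word (flat_word x y m n)"
  unfolding flat_word_def by (rule D_word_irreducible)

lemma phi_trivial: "\<phi> i j = \<one>\<^bsub>G\<^esub> \<Longrightarrow> i = 0 \<and> j = 0"
proof -
  assume *: "\<phi> i j = \<one>\<^bsub>G\<^esub>"
  obtain x y m n where xy: "x \<in> D" "y \<in> D" "x \<noteq> y" "\<phi> i j = cls (flat_word x y m n)"
    "m = 0 \<and> n = 0 \<longrightarrow> i = 0 \<and> j = 0"
    using phi_flat_word[of i j] by blast
  then have "flat_word x y m n = []"
    using * irreducible_cls_eq[of "flat_word x y m n" "[]"]
    by (simp add: flat_word_words flat_word_irreducible one_G)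
  then show ?thesis using xy by (simp add: flat_word_def)
qed

lemma \<Gamma>0_iso: "G\<lparr>carrier := \<Gamma>0\<rparr> \<cong> integer_group \<times>\<times> integer_group"
proof -
  have G0: "group (G\<lparr>carrier := \<Gamma>0\<rparr>)" by (rule \<Gamma>0.subgroup_is_group) (rule is_group)
  let ?f = "\<lambda>(i, j). \<phi> i j"
  have "inj ?f"
  proof (rule injI)
    fix p p' assume e: "?f p = ?f p'"
    obtain i j k l where p: "p = (i, j)" "p' = (k, l)" by (metis surj_pair)
    have "\<phi> (i - k) (j - l) = \<phi> i j \<otimes>\<^bsub>G\<^esub> inv\<^bsub>G\<^esub> (\<phi> k l)" by (simp add: phi_inv phi_add)
    also have "\<dots> = \<one>\<^bsub>G\<^esub>" using e p gen_ab_closed by simp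
    finally show "p = p'" using phi_trivial[of "i - k" "j - l"] p by simp
  qed
  then have "?f \<in> iso (integer_group \<times>\<times> integer_group) (G\<lparr>carrier := \<Gamma>0\<rparr>)"
    by (auto simp: iso_def hom_def bij_betw_def phi_add \<Gamma>0_def grid_def)
  then have "integer_group \<times>\<times> integer_group \<cong> G\<lparr>carrier := \<Gamma>0\<rparr>"
    by (auto simp: is_iso_def)
  then show ?thesis
    by (rule group.iso_sym[rotated]) (simp add: DirProd_group)
qed

text \<open>Let \<open>t\<^sup>-\<^sup>1 x\<^sup>K t = y\<^sup>m z\<^sup>-\<^sup>n\<close>. Raising to the power \<open>N\<close> gives irreducible words on both sides
  whose weights differ by at most the total weight of words for \<open>t\<close> and \<open>t\<^sup>-\<^sup>1\<close>, independently of \<open>N\<close>. So \<open>K\<close>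
  positive letters have exactly the same weight as \<open>m\<close> positive and \<open>n\<close> negative ones, for each
  admissible choice of prices, and therefore \<open>n = 0\<close> and \<open>m = K\<close>.\<close>

lemma conjugate_power:
  assumes t: "t \<in> carrier G" and x: "x \<in> D" and h: "inv\<^bsub>G\<^esub> t \<otimes>\<^bsub>G\<^esub> gen x [^]\<^bsub>G\<^esub> int K \<otimes>\<^bsub>G\<^esub> t \<in> \<Gamma>0"
  shows "\<exists>y\<in>D. inv\<^bsub>G\<^esub> t \<otimes>\<^bsub>G\<^esub> gen x [^]\<^bsub>G\<^esub> int K \<otimes>\<^bsub>G\<^esub> t = gen y [^]\<^bsub>G\<^esub> int K"
proof -
  define g where "g = inv\<^bsub>G\<^esub> t \<otimes>\<^bsub>G\<^esub> gen x [^]\<^bsub>G\<^esub> int K \<otimes>\<^bsub>G\<^esub> t"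
  obtain y z m n where yz: "y \<in> D" "z \<in> D" "y \<noteq> z" "g = cls (flat_word y z m n)"
    using \<Gamma>0_flat_word h unfolding g_def by metis
  have xc: "gen x \<in> carrier G" using x D_points by simp
  have yzc: "gen y \<in> carrier G" "gen z \<in> carrier G" using yz D_points by simp_all
  have gN: "g [^]\<^bsub>G\<^esub> int N = inv\<^bsub>G\<^esub> t \<otimes>\<^bsub>G\<^esub> gen x [^]\<^bsub>G\<^esub> int (N * K) \<otimes>\<^bsub>G\<^esub> t" for N
  proof (induction N)
    case (Suc N)
    have e: "t \<otimes>\<^bsub>G\<^esub> (inv\<^bsub>G\<^esub> t \<otimes>\<^bsub>G\<^esub> r) = r" if "r \<in> carrier G" for r
      using that t by (simp add: m_assoc[symmetric])
    have "g [^]\<^bsub>G\<^esub> int (Suc N) = g \<otimes>\<^bsub>G\<^esub> g [^]\<^bsub>G\<^esub> int N"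
      using int_pow_mult[of g 1 "int N"] t xc by (simp add: g_def)
    also have "\<dots> = inv\<^bsub>G\<^esub> t \<otimes>\<^bsub>G\<^esub> (gen x [^]\<^bsub>G\<^esub> int K \<otimes>\<^bsub>G\<^esub> gen x [^]\<^bsub>G\<^esub> int (N * K)) \<otimes>\<^bsub>G\<^esub> t"
      unfolding Suc using t xc e by (simp add: g_def m_assoc)
    also have "gen x [^]\<^bsub>G\<^esub> int K \<otimes>\<^bsub>G\<^esub> gen x [^]\<^bsub>G\<^esub> int (N * K) = gen x [^]\<^bsub>G\<^esub> int (Suc N * K)"
      using xc by (simp add: int_pow_mult)
    finally show ?case .
  qed (use t in simp)
  have gN': "g [^]\<^bsub>G\<^esub> int N = cls (flat_word y z (N * m) (N * n))" for N
  proof -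
    have "gen y [^]\<^bsub>G\<^esub> int m \<otimes>\<^bsub>G\<^esub> gen z [^]\<^bsub>G\<^esub> (- int n) = gen z [^]\<^bsub>G\<^esub> (- int n) \<otimes>\<^bsub>G\<^esub> gen y [^]\<^bsub>G\<^esub> int m"
      using yz D_pow_in_\<Gamma>0 \<Gamma>0_commute by simp
    from int_pow_mult_distrib[OF this, of "int N"] show ?thesis
      using yz yzc by (simp add: flat_word_cls int_pow_pow mult.commute)
  qed
  obtain w where w: "w \<in> words_over P" "cls w = t" using t by (auto simp: carrier_G)
  obtain w' where w': "w' \<in> words_over P" "cls w' = inv\<^bsub>G\<^esub> t"
    using t inv_closed by (metis carrier_G imageE)
  have bounds: "K * k = m * k + n * l" if kl: "k \<le> 2 * l" "l \<le> 2 * k" for k l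
  proof -
    define C where "C = weight k l w + weight k l w'"
    have "N * (m * k + n * l) \<le> C + N * (K * k)" for N
    proof -
      have "cls (flat_word y z (N * m) (N * n)) = cls (w' @ replicate (N * K) (x, True) @ w)"
        using gN[of N] gN'[of N] w w' t xc D_points[OF x]
        by (simp add: cls_append cls_replicate_pos m_assoc)
      then have "weight k l (flat_word y z (N * m) (N * n)) \<le> weight k l (w' @ replicate (N * K) (x, True) @ w)"
        using yz kl by (intro irreducible_cls_weight_le) (auto simp: flat_word_words flat_word_irreducible)
      then show ?thesis by (simp add: flat_word_def C_def algebra_simps)
    qed
    then have 1: "m * k + n * l \<le> K * k" by (rule linear_bound_le)
    have "N * (K * k) \<le> C + N * (m * k + n * l)" for N
    proof -
      have "t \<otimes>\<^bsub>G\<^esub> (g [^]\<^bsub>G\<^esub> int N \<otimes>\<^bsub>G\<^esub> inv\<^bsub>G\<^esub> t) = gen x [^]\<^bsub>G\<^esub> int (N * K)"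
      proof -
        have e: "t \<otimes>\<^bsub>G\<^esub> (inv\<^bsub>G\<^esub> t \<otimes>\<^bsub>G\<^esub> r) = r" if "r \<in> carrier G" for r
          using that t by (simp add: m_assoc[symmetric])
        show ?thesis unfolding gN using t xc e by (simp add: m_assoc)
      qed
      then have "cls (replicate (N * K) (x, True)) = cls (w @ flat_word y z (N * m) (N * n) @ w')"
        using gN'[of N] w w' D_points[OF x] yz by (simp add: cls_append cls_replicate_pos flat_word_words)
      then have "weight k l (replicate (N * K) (x, True)) \<le> weight k l (w @ flat_word y z (N * m) (N * n) @ w')"
        using x kl D_points by (intro irreducible_cls_weight_le D_replicate_irreducible) auto
      then show ?thesis by (simp add: flat_word_def C_def algebra_simps)
    qed
    then have "K * k \<le> m * k + n * l" by (rule linear_bound_le)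
    with 1 show ?thesis by simp
  qed
  have "n = 0" "m = K" using bounds[of 1 1] bounds[of 1 2] by auto
  then have "g = gen y [^]\<^bsub>G\<^esub> int K" using yz yzc by (simp add: flat_word_cls)
  then show ?thesis using yz unfolding g_def by blast
qed

text \<open>A letter that is not one of \<open>a, b, c\<close> can be rewritten after at most one of them: if
  it is positive, it would otherwise be the intersection of two of the lines of \<open>a, b, c\<close>, hence again
  one of these points.\<close>

lemma D_left_blocked_unique:
  assumes "fst \<alpha> \<notin> D"
    and "x \<in> D" "y \<in> D" "pair_rule (x, True) \<alpha> r" "pair_rule (y, True) \<alpha> s"
  shows "x = y"
proof (rule ccontr)
  assume "x \<noteq> y"
  obtain p e where \<alpha>: "\<alpha> = (p, e)" by (cases \<alpha>)
  show False
  proof (cases e)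
    case True
    then have "(\<exists>r. pair_rule (x, True) (p, True) r)" "(\<exists>r. pair_rule (y, True) (p, True) r)"
      using assms \<alpha> by auto
    then obtain u v where "(x, p, u) \<in> T" "(y, p, v) \<in> T" unfolding pair_rule_iffs by blast
    then show False using D_line_meet[OF assms(2,3) \<open>x \<noteq> y\<close>] assms(1) \<alpha> by auto
  next
    case False
    then have "(\<exists>r. pair_rule (x, True) (p, False) r)" using assms \<alpha> by auto
    then have "x = p" unfolding pair_rule_iffs by simp
    then show False using assms \<alpha> by auto
  qed
qed

lemma D_right_blocked_unique:
  assumes "fst \<beta> \<notin> D"
    and "x \<in> D" "y \<in> D" "pair_rule \<beta> (x, False) r" "pair_rule \<beta> (y, False) s"
  shows "x = y"
proof (rule ccontr)
  assume "x \<noteq> y"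
  obtain p e where \<beta>: "\<beta> = (p, e)" by (cases \<beta>)
  show False
  proof (cases e)
    case False
    then have "(\<exists>r. pair_rule (p, False) (x, False) r)" "(\<exists>r. pair_rule (p, False) (y, False) r)"
      using assms \<beta> by auto
    then obtain u v where "(x, p, u) \<in> T" "(y, p, v) \<in> T" unfolding pair_rule_iffs by blast
    then show False using D_line_meet[OF assms(2,3) \<open>x \<noteq> y\<close>] assms(1) \<beta> by auto
  next
    case True
    then have "(\<exists>r. pair_rule (p, True) (x, False) r)" using assms \<beta> by auto
    then have "x = p" unfolding pair_rule_iffs by simp
    then show False using assms \<beta> by auto
  qed
qed

text \<open>At least two elements \<open>x\<^sub>1, x\<^sub>2\<close> of the triple may precede \<open>w\<close>. Conjugation by \<open>w\<close> takes their
  \<open>K\<close>-th powers to powers of \<open>y\<^sub>1\<close> and \<open>y\<^sub>2\<close>. Neither \<open>y\<^sub>i\<^sup>-\<^sup>1\<close> may follow \<open>w\<close>, as otherwise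
  \<open>x\<^sub>i\<^sup>K w y\<^sub>i\<^sup>-\<^sup>K\<close> would be a second irreducible word for the same element. Only one letter is
  blocked on the right, so \<open>y\<^sub>1 = y\<^sub>2\<close>, although the two powers are distinct.\<close>

lemma no_conjugation_off_flat:
  assumes w: "w \<in> words_over P" "irreducible_word w" "w \<noteq> []" "fst (hd w) \<notin> D" "fst (last w) \<notin> D"
    and K: "K > 0"
    and conj: "\<And>x. x \<in> D \<Longrightarrow> inv\<^bsub>G\<^esub> (cls w) \<otimes>\<^bsub>G\<^esub> gen x [^]\<^bsub>G\<^esub> int K \<otimes>\<^bsub>G\<^esub> cls w \<in> \<Gamma>0"
  shows False
proof -
  let ?t = "cls w"
  have t: "?t \<in> carrier G" using w by simp
  define good where "good x \<longleftrightarrow> (\<nexists>r. pair_rule (x, True) (hd w) r)" for x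
  have "\<not> good x \<Longrightarrow> \<not> good y \<Longrightarrow> x = y" if "x \<in> D" "y \<in> D" for x y
    using D_left_blocked_unique[OF w(4)] that unfolding good_def by blast
  then obtain x1 x2 where x: "x1 \<in> D" "x2 \<in> D" "x1 \<noteq> x2" "good x1" "good x2"
    using abc_distinct by (metis insertCI)
  obtain y1 where y1: "y1 \<in> D" "inv\<^bsub>G\<^esub> ?t \<otimes>\<^bsub>G\<^esub> gen x1 [^]\<^bsub>G\<^esub> int K \<otimes>\<^bsub>G\<^esub> ?t = gen y1 [^]\<^bsub>G\<^esub> int K"
    using conjugate_power[OF t x(1) conj[OF x(1)]] by blast
  obtain y2 where y2: "y2 \<in> D" "inv\<^bsub>G\<^esub> ?t \<otimes>\<^bsub>G\<^esub> gen x2 [^]\<^bsub>G\<^esub> int K \<otimes>\<^bsub>G\<^esub> ?t = gen y2 [^]\<^bsub>G\<^esub> int K"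
    using conjugate_power[OF t x(2) conj[OF x(2)]] by blast
  have blocked: "\<exists>r. pair_rule (last w) (y, False) r"
    if xy: "x \<in> D" "good x" "y \<in> D" "inv\<^bsub>G\<^esub> ?t \<otimes>\<^bsub>G\<^esub> gen x [^]\<^bsub>G\<^esub> int K \<otimes>\<^bsub>G\<^esub> ?t = gen y [^]\<^bsub>G\<^esub> int K" for x y
  proof (rule ccontr)
    assume free: "\<nexists>r. pair_rule (last w) (y, False) r"
    let ?v = "replicate K (x, True) @ w @ replicate K (y, False)"
    have P: "x \<in> P" "y \<in> P" using xy D_points by auto
    then have c: "gen x \<in> carrier G" "gen y \<in> carrier G" by auto
    have "irreducible_word ?v"
      using w(2,3) K free xy D_replicate_irreducible
      by (simp add: irreducible_append_iff good_def)
    moreover have "cls ?v = ?t"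
    proof -
      have "cls ?v = gen x [^]\<^bsub>G\<^esub> int K \<otimes>\<^bsub>G\<^esub> ?t \<otimes>\<^bsub>G\<^esub> inv\<^bsub>G\<^esub> (gen y [^]\<^bsub>G\<^esub> int K)"
        using w P c t by (simp add: cls_append cls_replicate_pos cls_replicate_neg m_assoc int_pow_neg)
      also have "gen x [^]\<^bsub>G\<^esub> int K \<otimes>\<^bsub>G\<^esub> ?t = ?t \<otimes>\<^bsub>G\<^esub> gen y [^]\<^bsub>G\<^esub> int K"
        unfolding xy(4)[symmetric] using c t
        by (simp add: m_assoc[symmetric])
      finally show ?thesis using c t by (simp add: m_assoc)
    qed
    ultimately have "?v = w"
      using w P by (intro irreducible_cls_eq) auto
    then have "length ?v = length w" by simp
    then show False using K by simp
  qed
  have "y1 = y2"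
    using D_right_blocked_unique[OF w(5) y1(1) y2(1)] blocked[OF x(1,4) y1] blocked[OF x(2,5) y2] by blast
  then have "inv\<^bsub>G\<^esub> ?t \<otimes>\<^bsub>G\<^esub> gen x1 [^]\<^bsub>G\<^esub> int K \<otimes>\<^bsub>G\<^esub> ?t = inv\<^bsub>G\<^esub> ?t \<otimes>\<^bsub>G\<^esub> gen x2 [^]\<^bsub>G\<^esub> int K \<otimes>\<^bsub>G\<^esub> ?t"
    using y1 y2 by simp
  then have "gen x1 [^]\<^bsub>G\<^esub> int K = gen x2 [^]\<^bsub>G\<^esub> int K"
    using t x D_points by simp
  then have "replicate K (x1, True) = replicate K (x2, True)"
    using x D_points by (intro irreducible_cls_eq D_replicate_irreducible) (auto simp: cls_replicate_pos)
  then show False using x K by (simp add: replicate_eq_replicate)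
qed

lemma \<Gamma>0_conjugate:
  assumes h: "h \<in> \<Gamma>0" and g: "g \<in> \<Gamma>0"
  shows "inv\<^bsub>G\<^esub> h \<otimes>\<^bsub>G\<^esub> g \<otimes>\<^bsub>G\<^esub> h = g"
proof -
  have "inv\<^bsub>G\<^esub> h \<otimes>\<^bsub>G\<^esub> g \<otimes>\<^bsub>G\<^esub> h = inv\<^bsub>G\<^esub> h \<otimes>\<^bsub>G\<^esub> (h \<otimes>\<^bsub>G\<^esub> g)"
    using \<Gamma>0_commute[OF h g] h g \<Gamma>0.mem_carrier by (simp add: m_assoc)
  also have "\<dots> = g"
    using h g \<Gamma>0.mem_carrier by (simp add: m_assoc[symmetric])
  finally show ?thesis .
qed

text \<open>Outer letters from the triple can be stripped off: multiplying \<open>t\<close> on either side by an element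
  of the abelian flat does not change whether \<open>t\<close> conjugates the given powers into the flat, nor
  whether \<open>t\<close> lies in it. The induction ends at the empty word or at a word to which the preceding
  lemma applies.\<close>

lemma commensurator_word:
  assumes K: "K > 0"
  shows "w \<in> words_over P \<Longrightarrow> irreducible_word w \<Longrightarrow>
    (\<And>x. x \<in> D \<Longrightarrow> inv\<^bsub>G\<^esub> (cls w) \<otimes>\<^bsub>G\<^esub> gen x [^]\<^bsub>G\<^esub> int K \<otimes>\<^bsub>G\<^esub> cls w \<in> \<Gamma>0) \<Longrightarrow> cls w \<in> \<Gamma>0"
proof (induction w rule: measure_induct_rule[of length])
  case (less w)
  have letter: "cls [\<alpha>] \<in> \<Gamma>0" if "fst \<alpha> \<in> D" for \<alpha>
  proof -
    have "cls [(fst \<alpha>, snd \<alpha>)] = gen (fst \<alpha>) [^]\<^bsub>G\<^esub> (if snd \<alpha> then 1 else - 1 :: int)"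
      using that D_points by (subst cls_letter) (auto simp: int_pow_neg)
    then show ?thesis using D_pow_in_\<Gamma>0[OF that] by simp
  qed
  consider "w = []" | "w \<noteq> []" "fst (hd w) \<in> D" | "w \<noteq> []" "fst (last w) \<in> D"
    | "w \<noteq> []" "fst (hd w) \<notin> D" "fst (last w) \<notin> D" by blast
  then show ?case
  proof cases
    case 1
    then show ?thesis by (simp flip: one_G)
  next
    case 2
    define h t where "h = cls [hd w]" and "t = cls (tl w)"
    have w: "w = [hd w] @ tl w" using 2 by simp
    have irr: "irreducible_word (tl w)" and P: "[hd w] \<in> words_over P" "tl w \<in> words_over P"
      using less.prems(1,2) w irreducible_append_iff words_simps(3) by metis+
    have wt: "cls w = h \<otimes>\<^bsub>G\<^esub> t" unfolding h_def t_def using cls_append[OF P] w by simp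
    have h: "h \<in> \<Gamma>0" unfolding h_def using letter 2 by simp
    have c: "h \<in> carrier G" "t \<in> carrier G" using P by (simp_all add: h_def t_def del: words_simps)
    have "inv\<^bsub>G\<^esub> t \<otimes>\<^bsub>G\<^esub> gen x [^]\<^bsub>G\<^esub> int K \<otimes>\<^bsub>G\<^esub> t \<in> \<Gamma>0" if x: "x \<in> D" for x
    proof -
      have "inv\<^bsub>G\<^esub> t \<otimes>\<^bsub>G\<^esub> (inv\<^bsub>G\<^esub> h \<otimes>\<^bsub>G\<^esub> gen x [^]\<^bsub>G\<^esub> int K \<otimes>\<^bsub>G\<^esub> h) \<otimes>\<^bsub>G\<^esub> t \<in> \<Gamma>0"
        using less.prems(3)[OF x] c D_points[OF x] unfolding wt by (simp add: m_assoc inv_mult_group)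
      then show ?thesis using \<Gamma>0_conjugate[OF h D_pow_in_\<Gamma>0[OF x]] by simp
    qed
    then have "t \<in> \<Gamma>0"
      unfolding t_def by (intro less.IH irr P(2)) (use 2 in auto)
    then show ?thesis unfolding wt using h by (rule \<Gamma>0.m_closed[rotated])
  next
    case 3
    define h t where "h = cls [last w]" and "t = cls (butlast w)"
    have w: "w = butlast w @ [last w]" using 3 by simp
    have irr: "irreducible_word (butlast w)" and P: "[last w] \<in> words_over P" "butlast w \<in> words_over P"
      using less.prems(1,2) w irreducible_append_iff words_simps(3) by metis+
    have wt: "cls w = t \<otimes>\<^bsub>G\<^esub> h" unfolding h_def t_def using cls_append[OF P(2,1)] w by simp
    have h: "h \<in> \<Gamma>0" unfolding h_def using letter 3 by simp
    have c: "h \<in> carrier G" "t \<in> carrier G" using P by (simp_all add: h_def t_def del: words_simps)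
    have "inv\<^bsub>G\<^esub> t \<otimes>\<^bsub>G\<^esub> gen x [^]\<^bsub>G\<^esub> int K \<otimes>\<^bsub>G\<^esub> t \<in> \<Gamma>0" if x: "x \<in> D" for x
    proof -
      define g where "g = inv\<^bsub>G\<^esub> t \<otimes>\<^bsub>G\<^esub> gen x [^]\<^bsub>G\<^esub> int K \<otimes>\<^bsub>G\<^esub> t"
      have gc: "g \<in> carrier G" using c D_points[OF x] by (simp add: g_def)
      have "inv\<^bsub>G\<^esub> h \<otimes>\<^bsub>G\<^esub> g \<otimes>\<^bsub>G\<^esub> h \<in> \<Gamma>0"
        using less.prems(3)[OF x] c D_points[OF x] unfolding wt g_def by (simp add: m_assoc inv_mult_group)
      from \<Gamma>0.m_closed[OF \<Gamma>0.m_closed[OF h this] \<Gamma>0.m_inv_closed[OF h]]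
      have "h \<otimes>\<^bsub>G\<^esub> (inv\<^bsub>G\<^esub> h \<otimes>\<^bsub>G\<^esub> g \<otimes>\<^bsub>G\<^esub> h) \<otimes>\<^bsub>G\<^esub> inv\<^bsub>G\<^esub> h \<in> \<Gamma>0"
        .
      also have "h \<otimes>\<^bsub>G\<^esub> (inv\<^bsub>G\<^esub> h \<otimes>\<^bsub>G\<^esub> g \<otimes>\<^bsub>G\<^esub> h) \<otimes>\<^bsub>G\<^esub> inv\<^bsub>G\<^esub> h = g"
      proof -
        have "h \<otimes>\<^bsub>G\<^esub> (inv\<^bsub>G\<^esub> h \<otimes>\<^bsub>G\<^esub> g \<otimes>\<^bsub>G\<^esub> h) = g \<otimes>\<^bsub>G\<^esub> h"
          using c gc by (simp add: m_assoc[symmetric])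
        then show ?thesis using c gc by (simp add: m_assoc)
      qed
      finally show ?thesis by (simp add: g_def)
    qed
    then have "t \<in> \<Gamma>0"
      unfolding t_def by (intro less.IH irr P(2)) (use 3 in auto)
    then show ?thesis unfolding wt using h by (rule \<Gamma>0.m_closed)
  next
    case 4
    then show ?thesis using no_conjugation_off_flat[OF less.prems(1,2) 4 K] less.prems(3) by blast
  qed
qed

lemma commensurator_flat:
  assumes t: "t \<in> carrier G" and K: "K > (0::int)"
    and A: "inv\<^bsub>G\<^esub> t \<otimes>\<^bsub>G\<^esub> gen a [^]\<^bsub>G\<^esub> K \<otimes>\<^bsub>G\<^esub> t \<in> \<Gamma>0" and B: "inv\<^bsub>G\<^esub> t \<otimes>\<^bsub>G\<^esub> gen b [^]\<^bsub>G\<^esub> K \<otimes>\<^bsub>G\<^esub> t \<in> \<Gamma>0"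
  shows "t \<in> \<Gamma>0"
proof -
  define S where "S = {g \<in> carrier G. inv\<^bsub>G\<^esub> t \<otimes>\<^bsub>G\<^esub> g \<otimes>\<^bsub>G\<^esub> t \<in> \<Gamma>0}"
  have S: "subgroup S G"
    unfolding S_def by (rule conj_preimage_subgroup[OF \<Gamma>0.subgroup_axioms t])
  have ab: "\<phi> K 0 \<in> S" "\<phi> 0 K \<in> S"
    using A B gen_ab_closed by (simp_all add: S_def gen_pow_phi)
  have "gen c [^]\<^bsub>G\<^esub> K \<in> S"
    using subgroup.m_inv_closed[OF S subgroup.m_closed[OF S ab]] by (simp add: phi_add phi_inv gen_pow_phi)
  then have conj: "inv\<^bsub>G\<^esub> t \<otimes>\<^bsub>G\<^esub> gen x [^]\<^bsub>G\<^esub> K \<otimes>\<^bsub>G\<^esub> t \<in> \<Gamma>0" if "x \<in> D" for x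
    using that A B by (auto simp: S_def)
  obtain w where w: "w \<in> words_over P" "irreducible_word w" "cls w = t"
    by (rule ex_irreducible_cls[OF t])
  have "cls w \<in> \<Gamma>0"
  proof (rule commensurator_word[of "nat K"])
    show "inv\<^bsub>G\<^esub> (cls w) \<otimes>\<^bsub>G\<^esub> gen x [^]\<^bsub>G\<^esub> int (nat K) \<otimes>\<^bsub>G\<^esub> cls w \<in> \<Gamma>0" if "x \<in> D" for x
      using conj[OF that] K w by simp
  qed (use K w in auto)
  then show ?thesis using w by simp
qed

theorem flat_avoids_double_coset:
  assumes "finite F" "F \<subseteq> carrier G - \<Gamma>0"
  shows "\<exists>h\<in>\<Gamma>0. \<forall>s\<in>F. \<forall>t\<in>F. s \<otimes>\<^bsub>G\<^esub> h \<otimes>\<^bsub>G\<^esub> t \<notin> \<Gamma>0"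
  unfolding \<Gamma>0_def
proof (rule grid_avoids_double_coset[OF gen_ab_closed ab_commute])
  show "t \<in> grid (gen a) (gen b)"
    if "t \<in> carrier G" "k > (0::int)"
      "inv\<^bsub>G\<^esub> t \<otimes>\<^bsub>G\<^esub> gen a [^]\<^bsub>G\<^esub> k \<otimes>\<^bsub>G\<^esub> t \<in> grid (gen a) (gen b)"
      "inv\<^bsub>G\<^esub> t \<otimes>\<^bsub>G\<^esub> gen b [^]\<^bsub>G\<^esub> k \<otimes>\<^bsub>G\<^esub> t \<in> grid (gen a) (gen b)" for t k
    using commensurator_flat[unfolded \<Gamma>0_def, OF that] .
qed (use assms in \<open>auto simp: \<Gamma>0_def\<close>)

end

section \<open>The singular masa of the flat\<close>

text \<open>Two distinct points lie on exactly one line, and every line is attached to exactly one point.\<close>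

lemma plane_triangle_group:
  assumes plane: "projective_plane P L I q" and pres: "triangle_presentation P L I lam T"
  shows "triangle_group P T"
proof
  have bij: "bij_betw lam P L" and sub: "T \<subseteq> P \<times> P \<times> P"
    and ex: "\<And>x y. x \<in> P \<Longrightarrow> y \<in> P \<Longrightarrow> (\<exists>z\<in>P. (x, y, z) \<in> T) \<longleftrightarrow> I y (lam x)"
    and rot: "\<And>x y z. (x, y, z) \<in> T \<Longrightarrow> (y, z, x) \<in> T"
    and uniq: "\<And>x y z z'. x \<in> P \<Longrightarrow> y \<in> P \<Longrightarrow> (x, y, z) \<in> T \<Longrightarrow> (x, y, z') \<in> T \<Longrightarrow> z = z'"
    using pres unfolding triangle_presentation_def by blast+
  have line: "\<exists>!l. l \<in> L \<and> I x l \<and> I y l" if "x \<in> P" "y \<in> P" "x \<noteq> y" for x y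
    using plane that unfolding projective_plane_def by blast
  show points: "x \<in> P \<and> y \<in> P \<and> z \<in> P" if "(x, y, z) \<in> T" for x y z using sub that by blast
  show "(y, z, x) \<in> T" if "(x, y, z) \<in> T" for x y z by (rule rot[OF that])
  show "z = z'" if "(x, y, z) \<in> T" "(x, y, z') \<in> T" for x y z z'
    using uniq points that by blast
  show "\<exists>w z v. (w, x, z) \<in> T \<and> (w, y, v) \<in> T" if xy: "x \<in> P" "y \<in> P" "x \<noteq> y" for x y
  proof -
    obtain l where l: "l \<in> L" "I x l" "I y l" using line[OF xy] by blast
    obtain w where "w \<in> P" "lam w = l" using bij l(1) by (auto simp: bij_betw_def)
    then show ?thesis using ex[of w x] ex[of w y] xy l by blast
  qed
  show "w = w'" if "x \<noteq> y" and T: "(w, x, z) \<in> T" "(w, y, v) \<in> T" "(w', x, z') \<in> T" "(w', y, v') \<in> T"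
    for x y w z v w' z' v'
  proof -
    have P: "x \<in> P" "y \<in> P" "w \<in> P" "w' \<in> P" using T points by blast+
    have "I x (lam w)" "I y (lam w)" "I x (lam w')" "I y (lam w')"
      using T points ex P by blast+
    moreover have "lam w \<in> L" "lam w' \<in> L" using bij P by (auto simp: bij_betw_def)
    ultimately have "lam w = lam w'" using line[OF P(1,2) that(1)] by blast
    then show ?thesis using bij P by (auto simp: bij_betw_def inj_on_def)
  qed
qed

theorem theorem2p8:
  fixes P :: "'p set" and L :: "'l set" and I :: "'p \<Rightarrow> 'l \<Rightarrow> bool"
    and q :: nat and lam :: "'p \<Rightarrow> 'l" and \<T> :: "('p \<times> 'p \<times> 'p) set"
    and a b c :: 'p and \<Gamma> :: "'p word set monoid" and \<Gamma>\<^sub>0 :: "'p word set set"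
  assumes "projective_plane P L I q" and "q \<ge> 2"
    and "triangle_presentation P L I lam \<T>"
    and "\<Gamma> = A2_group P \<T>"
    and "a \<in> P" "b \<in> P" "c \<in> P"
    and "a \<noteq> b" "b \<noteq> c" "a \<noteq> c"
    and "A2_gen P \<T> a \<otimes>\<^bsub>\<Gamma>\<^esub> A2_gen P \<T> b = A2_gen P \<T> b \<otimes>\<^bsub>\<Gamma>\<^esub> A2_gen P \<T> a"
    and "A2_gen P \<T> b \<otimes>\<^bsub>\<Gamma>\<^esub> A2_gen P \<T> c = A2_gen P \<T> c \<otimes>\<^bsub>\<Gamma>\<^esub> A2_gen P \<T> b"
    and "A2_gen P \<T> a \<otimes>\<^bsub>\<Gamma>\<^esub> A2_gen P \<T> c = A2_gen P \<T> c \<otimes>\<^bsub>\<Gamma>\<^esub> A2_gen P \<T> a"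
    and "\<Gamma>\<^sub>0 = generate \<Gamma> {A2_gen P \<T> a, A2_gen P \<T> b, A2_gen P \<T> c}"
  shows "\<Gamma>\<lparr>carrier := \<Gamma>\<^sub>0\<rparr> \<cong> integer_group \<times>\<times> integer_group \<and>
    masa (carrier \<Gamma>) (subgroup_vna \<Gamma> \<Gamma>\<^sub>0) (group_vna \<Gamma>) \<and>
    singular (carrier \<Gamma>) (subgroup_vna \<Gamma> \<Gamma>\<^sub>0) (group_vna \<Gamma>)"
proof -
  note \<Gamma> = assms(4)
  interpret triangle_group P \<T> by (rule plane_triangle_group[OF assms(1,3)])
  interpret commuting_triple P \<T> a b c
    by unfold_locales (use assms in simp_all)
  have \<Gamma>\<^sub>0: "\<Gamma>\<^sub>0 = \<Gamma>0"
    using assms(14) \<Gamma>0_generated \<Gamma> by simp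
  show ?thesis
    unfolding \<Gamma>\<^sub>0 \<Gamma>
    using \<Gamma>0_iso
      subgroup_vna_masa[OF \<Gamma>0.subgroup_axioms \<Gamma>0_commute flat_avoids_double_coset]
      subgroup_vna_singular[OF \<Gamma>0.subgroup_axioms \<Gamma>0_commute flat_avoids_double_coset]
    by blast
qed

end
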